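(* Let $\Gamma$ be a tropical curve of genus $2$ and $\mathbb{T}E$ a tropical curve of genus $1$. If $\varphi:\Gamma\to\mathbb{T}E$ is an optimal cover of degree $d$, then $\mathbb{T}E':=\ker(\varphi_* )$ is a tropical elliptic curve and $\mathrm{Jac}(\Gamma)$ splits, i.e. there exists an isogeny $\phi:\mathbb{T}E'\oplus\mathbb{T}E\to\mathrm{Jac}(\Gamma)$ whose kernel is isomorphic to $\mathrm{Jac}_d(\mathbb{T}E)$, the group of $d$-torsion points of $\mathbb{T}E$.
   Context: Integral tori. A real torus with integral structure is a triple $\Sigma=(\Lambda,\Lambda',[\cdot,\cdot])$ with $\Lambda,\Lambda'$ finitely generated free abelian groups of the same rank and $[\cdot,\cdot]:\Lambda\times\Lambda'\to\mathbb{R}$ a non-degenerate pairing (non-degenerate after extending scalars to $\mathbb{R}$, so $\lambda'\mapsto[\cdot,\lambda']$ makes $\Lambda'$ a lattice in $\mathrm{Hom}(\Lambda,\mathbb{R})$). Its underlying group is $\mathrm{Hom}(\Lambda,\mathbb{R})/\Lambda'$. A morphism $f:\Sigma_1\to\Sigma_2$ is a pair of group homomorphisms $(f^\#:\Lambda_2\to\Lambda_1,\ f_\#:\Lambda_1'\to\Lambda_2')$ with $[f^\#(\lambda_2),\lambda_1']_1=[\lambda_2,f_\#(\lambda_1')]_2$; it induces, via $\mathrm{Hom}(f^\#,\mathbb{R})$, a homomorphism of underlying groups, whose kernel is denoted $\ker(f)$. It is surjective if $f^\#$ is injective, finite if $f_\#$ is injective, and an isogeny if both. $\mathrm{Ker}(f)_0=(\Lambda_1/\mathrm{im}(f^\#)^{\mathrm{sat}},\ker(f_\#),\text{induced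 pairing})$ is an integral torus, identified with the identity component of $\ker(f)$; saying that $\ker(f)$ is an elliptic curve means that $\ker(f)$ is connected and $\ker(f)=\mathrm{Ker}(f)_0$ is one-dimensional. The coproduct $\Sigma_1\oplus\Sigma_2$ is $(\Lambda_1\times\Lambda_2,\Lambda_1'\times\Lambda_2',[\cdot,\cdot]_1+[\cdot,\cdot]_2)$. Tropical curves and covers. A tropical curve is the geometric realization of a finite connected metric graph without legs/ends and without vertex weights; models are obtained by adding or deleting $2$-valent vertices; its genus is $|E(G)|-|V(G)|+1$. A harmonic morphism (= tropical cover) $\varphi:\Gamma\to\tilde\Gamma$ is a continuous surjective map such that for suitable models vertices map to vertices, preimages of edges are edges, $\varphi$ is affine on each edge $e$ with integer slope $d_e(\varphi)\ge0$ (possibly $0$), and for every $P\in\Gamma$ the number $d_P(\varphi)=\sum_{v\mapsto\tilde v}d_v(\varphi)$ (sum over tangent directions $v$ at $P$ mapping to $\tilde v$) is independent of the tangent direction $\tilde v$ at $\varphi(P)$. Its degree is $\deg(\varphi)=\sum_{P\mapsto\tilde P}d_P(\varphi)$ for any $\tilde P\in\tilde\Gamma$. For $\Gamma$ of genus $2$ and $\mathbb{T}E$ of genus $1$, a cover $\varphi:\Gamma\to\mathbb{T}E$ is optimal if, whenever $\varphi=\psi\circ\tilde\varphi$ with $\mathbb{T}\tilde E$ a curve of genus $1$ and covers $\tilde\varphi:\Gamma\to\mathbb{T}\tilde E$, $\psi:\mathbb{T}\tilde E\to\mathbb{T}E$, then $\psi$ is an isomorphism (i.e. $\deg\psi=1$).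 Jacobian. $\Omega^1_\Gamma(\mathbb{Z})$ is the group of integral harmonic $1$-forms $\sum_e\omega_e\,de$ on an oriented model (at each vertex, sum of $\omega_e$ over incoming edges equals sum over outgoing edges); $H_1(\Gamma,\mathbb{Z})$ is the group of integral $1$-cycles; $\int_e de'=l(e)$ if $e=e'$, else $0$. $\mathrm{Jac}(\Gamma)=(\Omega^1_\Gamma(\mathbb{Z}),H_1(\Gamma,\mathbb{Z}),\int)$. The push-forward $\varphi_*:\mathrm{Jac}(\Gamma)\to\mathrm{Jac}(\tilde\Gamma)$ is the morphism whose $\varphi_*^\#$ is pull-back of $1$-forms ($d\tilde e\mapsto\sum_{e\mapsto\tilde e}d_e(\varphi)\,de$) and whose $\varphi_{*\#}$ is push-forward of cycles ($\sum a_e e\mapsto\sum a_e\varphi(e)$); equivalently it is push-forward of divisors under $\mathrm{Jac}\cong\mathrm{Pic}^0$. A tropical elliptic curve is a tropical curve of genus $1$, identified with its Jacobian, a one-dimensional integral torus $\mathbb{R}/l\mathbb{Z}$; every one-dimensional integral torus $(\mathbb{Z}\omega,\mathbb{Z}B,[\cdot,\cdot])$ is regarded as the elliptic curve of length $|[\omega,B]|$. *)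

theory Defs
  imports
    "HOL-Analysis.Analysis"
    "HOL-Algebra.Coset"
    "HOL-Algebra.Free_Abelian_Groups"
begin

section \<open>Real tori with integral structure\<close>

text \<open>Abelian groups are HOL-Algebra groups in multiplicative notation.\<close>

record ('a, 'b) itorus =
  Lam  :: "'a monoid"            \<comment> \<open>\<open>\<Lambda>\<close>\<close>
  Lam' :: "'b monoid"            \<comment> \<open>\<open>\<Lambda>'\<close>\<close>
  pairing :: "'a \<Rightarrow> 'b \<Rightarrow> real"

definition bilinear_pairing :: "('a, 'b) itorus \<Rightarrow> bool" where
  "bilinear_pairing S \<longleftrightarrow>
     (\<forall>x\<in>carrier (Lam S). \<forall>y\<in>carrier (Lam S). \<forall>b\<in>carrier (Lam' S).
        pairing S (x \<otimes>\<^bsub>Lam S\<^esub> y) b = pairing S x b + pairing S y b) \<and>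
     (\<forall>x\<in>carrier (Lam S). \<forall>b\<in>carrier (Lam' S). \<forall>c\<in>carrier (Lam' S).
        pairing S x (b \<otimes>\<^bsub>Lam' S\<^esub> c) = pairing S x b + pairing S x c)"

text \<open>The last two conjuncts are non-degeneracy, in both arguments, of the real bilinear
  extension of the pairing, written in coordinates with respect to the bases
  \<open>h (frag_of i)\<close> and \<open>h' (frag_of j)\<close>; \<open>n\<close> is the dimension of the torus.\<close>

definition integral_torus_dim :: "nat \<Rightarrow> ('a, 'b) itorus \<Rightarrow> bool" where
  "integral_torus_dim n S \<longleftrightarrow>
     comm_group (Lam S) \<and> comm_group (Lam' S) \<and> bilinear_pairing S \<and>
     (\<exists>h \<in> iso (free_Abelian_group {..<n}) (Lam S).
      \<exists>h' \<in> iso (free_Abelian_group {..<n}) (Lam' S).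
        (\<forall>c :: nat \<Rightarrow> real.
           (\<forall>i<n. (\<Sum>j<n. c j * pairing S (h (frag_of i)) (h' (frag_of j))) = 0)
             \<longrightarrow> (\<forall>j<n. c j = 0)) \<and>
        (\<forall>c :: nat \<Rightarrow> real.
           (\<forall>j<n. (\<Sum>i<n. c i * pairing S (h (frag_of i)) (h' (frag_of j))) = 0)
             \<longrightarrow> (\<forall>i<n. c i = 0)))"

definition integral_torus :: "('a, 'b) itorus \<Rightarrow> bool" where
  "integral_torus S \<longleftrightarrow> (\<exists>n. integral_torus_dim n S)"

subsection \<open>The underlying group and its topology\<close>

text \<open>\<open>Hom(\<Lambda>, \<real>)\<close>. Homomorphisms are normalised to vanish off the carrier, so that equality
  of homomorphisms is equality of functions.\<close>

definition real_dual :: "'a monoid \<Rightarrow> ('a \<Rightarrow> real) monoid" where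
  "real_dual L =
     \<lparr>carrier = {F. (\<forall>x\<in>carrier L. \<forall>y\<in>carrier L. F (x \<otimes>\<^bsub>L\<^esub> y) = F x + F y) \<and>
                    (\<forall>x. x \<notin> carrier L \<longrightarrow> F x = 0)},
      mult = (\<lambda>F G x. F x + G x), one = (\<lambda>_. 0)\<rparr>"

definition period :: "('a, 'b) itorus \<Rightarrow> 'b \<Rightarrow> 'a \<Rightarrow> real" where
  "period S b = (\<lambda>x. if x \<in> carrier (Lam S) then pairing S x b else 0)"

definition periods :: "('a, 'b) itorus \<Rightarrow> ('a \<Rightarrow> real) set" where
  "periods S = period S ` carrier (Lam' S)"

definition torus_group :: "('a, 'b) itorus \<Rightarrow> ('a \<Rightarrow> real) set monoid" where
  "torus_group S = real_dual (Lam S) Mod periods S"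

definition quotient_top :: "'a topology \<Rightarrow> ('a \<Rightarrow> 'b) \<Rightarrow> 'b topology" where
  "quotient_top X f =
     topology (\<lambda>U. U \<subseteq> f ` topspace X \<and> openin X {x \<in> topspace X. f x \<in> U})"

lemma openin_quotient_top:
  "openin (quotient_top X f) U \<longleftrightarrow>
     U \<subseteq> f ` topspace X \<and> openin X {x \<in> topspace X. f x \<in> U}"
proof -
  have "istopology (\<lambda>U. U \<subseteq> f ` topspace X \<and> openin X {x \<in> topspace X. f x \<in> U})"
    unfolding istopology_def
  proof (intro conjI allI impI; (elim conjE)?)
    fix S T assume "openin X {x \<in> topspace X. f x \<in> S}" "openin X {x \<in> topspace X. f x \<in> T}"
    then have "openin X ({x \<in> topspace X. f x \<in> S} \<inter> {x \<in> topspace X. f x \<in> T})"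
      by (rule openin_Int)
    moreover have "{x \<in> topspace X. f x \<in> S} \<inter> {x \<in> topspace X. f x \<in> T} =
        {x \<in> topspace X. f x \<in> S \<inter> T}" by auto
    ultimately show "openin X {x \<in> topspace X. f x \<in> S \<inter> T}" by simp
  next
    fix K assume K: "\<forall>U\<in>K. U \<subseteq> f ` topspace X \<and> openin X {x \<in> topspace X. f x \<in> U}"
    have "openin X (\<Union>U\<in>K. {x \<in> topspace X. f x \<in> U})"
      using K by blast
    moreover have "(\<Union>U\<in>K. {x \<in> topspace X. f x \<in> U}) = {x \<in> topspace X. f x \<in> \<Union>K}"
      by auto
    ultimately show "openin X {x \<in> topspace X. f x \<in> \<Union>K}" by simp
  qed blast+
  then show ?thesis by (simp add: quotient_top_def topology_inverse')
qed

lemma topspace_quotient_top: "topspace (quotient_top X f) = f ` topspace X"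
proof
  show "topspace (quotient_top X f) \<subseteq> f ` topspace X"
    using openin_quotient_top[of X f "topspace (quotient_top X f)"] by simp
  have "{x \<in> topspace X. f x \<in> f ` topspace X} = topspace X" by auto
  then have "openin (quotient_top X f) (f ` topspace X)"
    by (simp add: openin_quotient_top)
  then show "f ` topspace X \<subseteq> topspace (quotient_top X f)"
    by (rule openin_subset)
qed

lemma quotient_map_quotient_top: "quotient_map X (quotient_top X f) f"
  by (auto simp: quotient_map_def topspace_quotient_top openin_quotient_top)

text \<open>\<open>Hom(\<Lambda>, \<real>)\<close> carries the topology of pointwise convergence, which for finitely generated
  \<open>\<Lambda>\<close> is its Euclidean topology.\<close>

definition torus_top :: "('a, 'b) itorus \<Rightarrow> ('a \<Rightarrow> real) set topology" where
  "torus_top S =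
     quotient_top (top_of_set (carrier (real_dual (Lam S))))
       (\<lambda>F. periods S #>\<^bsub>real_dual (Lam S)\<^esub> F)"

subsection \<open>Morphisms\<close>

text \<open>A morphism \<open>f\<close> from \<open>S\<close> to \<open>T\<close> is the pair \<open>(f\<^sup>#, f\<^sub>#)\<close>.\<close>

type_synonym ('a, 'b, 'c, 'd) torus_map = "('c \<Rightarrow> 'a) \<times> ('b \<Rightarrow> 'd)"

definition torus_morphism ::
  "('a, 'b) itorus \<Rightarrow> ('c, 'd) itorus \<Rightarrow> ('a, 'b, 'c, 'd) torus_map \<Rightarrow> bool" where
  "torus_morphism S T f \<longleftrightarrow>
     integral_torus S \<and> integral_torus T \<and>
     fst f \<in> hom (Lam T) (Lam S) \<and> snd f \<in> hom (Lam' S) (Lam' T) \<and>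
     (\<forall>y\<in>carrier (Lam T). \<forall>b\<in>carrier (Lam' S).
        pairing S (fst f y) b = pairing T y (snd f b))"

definition torus_isogeny ::
  "('a, 'b) itorus \<Rightarrow> ('c, 'd) itorus \<Rightarrow> ('a, 'b, 'c, 'd) torus_map \<Rightarrow> bool" where
  "torus_isogeny S T f \<longleftrightarrow>
     torus_morphism S T f \<and> inj_on (fst f) (carrier (Lam T)) \<and> inj_on (snd f) (carrier (Lam' S))"

text \<open>The homomorphism of underlying groups. An element of the torus group is a coset \<open>C\<close>; all
  its representatives give the same coset on the right-hand side.\<close>

definition torus_hom ::
  "('a, 'b) itorus \<Rightarrow> ('c, 'd) itorus \<Rightarrow> ('a, 'b, 'c, 'd) torus_map
     \<Rightarrow> ('a \<Rightarrow> real) set \<Rightarrow> ('c \<Rightarrow> real) set" where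
  "torus_hom S T f C =
     (\<Union>F\<in>C. periods T #>\<^bsub>real_dual (Lam T)\<^esub> (\<lambda>y. if y \<in> carrier (Lam T) then F (fst f y) else 0))"

definition torus_kernel ::
  "('a, 'b) itorus \<Rightarrow> ('c, 'd) itorus \<Rightarrow> ('a, 'b, 'c, 'd) torus_map \<Rightarrow> ('a \<Rightarrow> real) set monoid" where
  "torus_kernel S T f =
     (torus_group S)\<lparr>carrier := kernel (torus_group S) (torus_group T) (torus_hom S T f)\<rparr>"

definition torsion :: "nat \<Rightarrow> ('a, 'b) itorus \<Rightarrow> ('a \<Rightarrow> real) set monoid" where
  "torsion d S =
     (torus_group S)
       \<lparr>carrier := {x \<in> carrier (torus_group S). x [^]\<^bsub>torus_group S\<^esub> d = \<one>\<^bsub>torus_group S\<^esub>}\<rparr>"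

definition torus_sum ::
  "('a, 'b) itorus \<Rightarrow> ('c, 'd) itorus \<Rightarrow> ('a \<times> 'c, 'b \<times> 'd) itorus" where
  "torus_sum S T =
     \<lparr>Lam = Lam S \<times>\<times> Lam T, Lam' = Lam' S \<times>\<times> Lam' T,
      pairing = (\<lambda>(x, y) (b, c). pairing S x b + pairing T y c)\<rparr>"

definition saturation :: "'a monoid \<Rightarrow> 'a set \<Rightarrow> 'a set" where
  "saturation L A = {x \<in> carrier L. \<exists>n::nat. n > 0 \<and> x [^]\<^bsub>L\<^esub> n \<in> A}"

abbreviation sat_image :: "('a, 'b) itorus \<Rightarrow> ('c, 'd) itorus \<Rightarrow> ('a, 'b, 'c, 'd) torus_map \<Rightarrow> 'a set"
  where "sat_image S T f \<equiv> saturation (Lam S) (fst f ` carrier (Lam T))"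

text \<open>\<open>Ker(f)\<^sub>0\<close>. The value of the induced pairing on a coset \<open>C\<close> does not depend on the
  representative chosen, since the second argument lies in the kernel of \<open>f\<^sub>#\<close>.\<close>

definition Ker0 ::
  "('a, 'b) itorus \<Rightarrow> ('c, 'd) itorus \<Rightarrow> ('a, 'b, 'c, 'd) torus_map \<Rightarrow> ('a set, 'b) itorus" where
  "Ker0 S T f =
     \<lparr>Lam = Lam S Mod sat_image S T f,
      Lam' = (Lam' S)\<lparr>carrier := kernel (Lam' S) (Lam' T) (snd f)\<rparr>,
      pairing = (\<lambda>C b. pairing S (SOME x. x \<in> C) b)\<rparr>"

definition Ker0_inclusion ::
  "('a, 'b) itorus \<Rightarrow> ('c, 'd) itorus \<Rightarrow> ('a, 'b, 'c, 'd) torus_map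
     \<Rightarrow> ('a set, 'b, 'a, 'b) torus_map" where
  "Ker0_inclusion S T f = (\<lambda>x. sat_image S T f #>\<^bsub>Lam S\<^esub> x, \<lambda>b. b)"

text \<open>The kernel is connected and equal, via the canonical inclusion, to the one-dimensional
  integral torus \<open>Ker(f)\<^sub>0\<close>.\<close>

definition kernel_is_elliptic_curve ::
  "('a, 'b) itorus \<Rightarrow> ('c, 'd) itorus \<Rightarrow> ('a, 'b, 'c, 'd) torus_map \<Rightarrow> bool" where
  "kernel_is_elliptic_curve S T f \<longleftrightarrow>
     connectedin (torus_top S) (carrier (torus_kernel S T f)) \<and>
     integral_torus_dim 1 (Ker0 S T f) \<and>
     torus_hom (Ker0 S T f) S (Ker0_inclusion S T f)
       \<in> iso (torus_group (Ker0 S T f)) (torus_kernel S T f)"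


section \<open>Tropical curves\<close>

text \<open>A tropical curve is presented by one of its models on a set of points: finitely many
  vertices, and finitely many edges, each with a length and an affine parametrisation
  \<open>par e : [0, len e]\<close> of the closed edge. The parametrisation also orients the edge.
  Loops and multiple edges are allowed; all edges have finite length. Values of \<open>par e\<close> outside
  \<open>[0, len e]\<close> are irrelevant.\<close>

record 'p mgraph =
  verts :: "'p set"
  edges :: "nat set"
  len :: "nat \<Rightarrow> real"
  par :: "nat \<Rightarrow> real \<Rightarrow> 'p"

definition src :: "'p mgraph \<Rightarrow> nat \<Rightarrow> 'p" where "src G e = par G e 0"
definition tgt :: "'p mgraph \<Rightarrow> nat \<Rightarrow> 'p" where "tgt G e = par G e (len G e)"

definition open_edge :: "'p mgraph \<Rightarrow> nat \<Rightarrow> 'p set" where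
  "open_edge G e = par G e ` {0<..<len G e}"

definition points :: "'p mgraph \<Rightarrow> 'p set" where
  "points G = verts G \<union> (\<Union>e\<in>edges G. open_edge G e)"

definition tropical_curve :: "'p mgraph \<Rightarrow> bool" where
  "tropical_curve G \<longleftrightarrow>
     finite (verts G) \<and> verts G \<noteq> {} \<and> finite (edges G) \<and>
     (\<forall>e\<in>edges G. len G e > 0 \<and> src G e \<in> verts G \<and> tgt G e \<in> verts G \<and>
        inj_on (par G e) {0<..<len G e} \<and> open_edge G e \<inter> verts G = {}) \<and>
     (\<forall>e\<in>edges G. \<forall>e'\<in>edges G. e \<noteq> e' \<longrightarrow> open_edge G e \<inter> open_edge G e' = {}) \<and>
     (\<forall>v\<in>verts G. \<forall>w\<in>verts G.
        (v, w) \<in> ({(src G e, tgt G e) | e. e \<in> edges G} \<union> {(tgt G e, src G e) | e. e \<in> edges G})\<^sup>*)"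

definition genus :: "'p mgraph \<Rightarrow> int" where
  "genus G = int (card (edges G)) - int (card (verts G)) + 1"

definition realization_top :: "'p mgraph \<Rightarrow> 'p topology" where
  "realization_top G =
     topology (\<lambda>U. U \<subseteq> points G \<and>
       (\<forall>e\<in>edges G. openin (top_of_set {0..len G e}) {t \<in> {0..len G e}. par G e t \<in> U}))"

lemma openin_realization_top:
  "openin (realization_top G) U \<longleftrightarrow>
     U \<subseteq> points G \<and>
     (\<forall>e\<in>edges G. openin (top_of_set {0..len G e}) {t \<in> {0..len G e}. par G e t \<in> U})"
proof -
  have "istopology (\<lambda>U. U \<subseteq> points G \<and>
       (\<forall>e\<in>edges G. openin (top_of_set {0..len G e}) {t \<in> {0..len G e}. par G e t \<in> U}))"
    unfolding istopology_def
  proof (intro conjI allI impI ballI; (elim conjE)?)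
    fix S T e
    assume e: "e \<in> edges G"
      and "\<forall>e\<in>edges G. openin (top_of_set {0..len G e}) {t \<in> {0..len G e}. par G e t \<in> S}"
      and "\<forall>e\<in>edges G. openin (top_of_set {0..len G e}) {t \<in> {0..len G e}. par G e t \<in> T}"
    then have "openin (top_of_set {0..len G e})
        ({t \<in> {0..len G e}. par G e t \<in> S} \<inter> {t \<in> {0..len G e}. par G e t \<in> T})"
      by (intro openin_Int) blast+
    moreover have "{t \<in> {0..len G e}. par G e t \<in> S} \<inter> {t \<in> {0..len G e}. par G e t \<in> T} =
        {t \<in> {0..len G e}. par G e t \<in> S \<inter> T}" by auto
    ultimately show "openin (top_of_set {0..len G e}) {t \<in> {0..len G e}. par G e t \<in> S \<inter> T}"
      by simp
  next
    fix K e
    assume e: "e \<in> edges G" and K: "\<forall>U\<in>K. U \<subseteq> points G \<and>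
       (\<forall>e\<in>edges G. openin (top_of_set {0..len G e}) {t \<in> {0..len G e}. par G e t \<in> U})"
    have "openin (top_of_set {0..len G e}) (\<Union>U\<in>K. {t \<in> {0..len G e}. par G e t \<in> U})"
      using K e by blast
    moreover have "(\<Union>U\<in>K. {t \<in> {0..len G e}. par G e t \<in> U}) =
        {t \<in> {0..len G e}. par G e t \<in> \<Union>K}" by auto
    ultimately show "openin (top_of_set {0..len G e}) {t \<in> {0..len G e}. par G e t \<in> \<Union>K}"
      by simp
  qed blast+
  then show ?thesis by (simp add: realization_top_def topology_inverse')
qed

text \<open>\<open>R\<close> arises from \<open>G\<close> by inserting finitely many 2-valent vertices in the interior of edges
  (and possibly reorienting the pieces).\<close>

definition refines :: "'p mgraph \<Rightarrow> 'p mgraph \<Rightarrow> bool" where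
  "refines R G \<longleftrightarrow>
     points R = points G \<and> verts G \<subseteq> verts R \<and>
     (\<forall>e'\<in>edges R. \<exists>e\<in>edges G. \<exists>a\<ge>0. a + len R e' \<le> len G e \<and>
        ((\<forall>t\<in>{0..len R e'}. par R e' t = par G e (a + t)) \<or>
         (\<forall>t\<in>{0..len R e'}. par R e' t = par G e (a + len R e' - t))))"

text \<open>Two models present the same tropical curve iff one is obtained from the other by inserting
  and then deleting 2-valent vertices, i.e. iff they have a common refinement.\<close>

definition model_of :: "'p mgraph \<Rightarrow> 'p mgraph \<Rightarrow> bool" where
  "model_of G \<Gamma> \<longleftrightarrow>
     tropical_curve G \<and> (\<exists>R. tropical_curve R \<and> refines R G \<and> refines R \<Gamma>)"


section \<open>Harmonic morphisms\<close>

text \<open>The edge \<open>e\<close> is mapped onto the edge \<open>e'\<close> with slope \<open>k > 0\<close>; \<open>s\<close> says whether orientations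
  are preserved.\<close>

definition edge_over ::
  "'p mgraph \<Rightarrow> 'q mgraph \<Rightarrow> ('p \<Rightarrow> 'q) \<Rightarrow> nat \<Rightarrow> nat \<Rightarrow> bool \<Rightarrow> nat \<Rightarrow> bool" where
  "edge_over G H \<phi> e e' s k \<longleftrightarrow>
     e' \<in> edges H \<and> k > 0 \<and> len H e' = real k * len G e \<and>
     (\<forall>t\<in>{0..len G e}.
        \<phi> (par G e t) = par H e' (if s then real k * t else len H e' - real k * t))"

definition edge_contracted :: "'p mgraph \<Rightarrow> 'q mgraph \<Rightarrow> ('p \<Rightarrow> 'q) \<Rightarrow> nat \<Rightarrow> bool" where
  "edge_contracted G H \<phi> e \<longleftrightarrow> (\<exists>w\<in>verts H. \<forall>t\<in>{0..len G e}. \<phi> (par G e t) = w)"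

definition slope :: "'p mgraph \<Rightarrow> 'q mgraph \<Rightarrow> ('p \<Rightarrow> 'q) \<Rightarrow> nat \<Rightarrow> nat" where
  "slope G H \<phi> e =
     (THE k. (\<exists>e' s. edge_over G H \<phi> e e' s k) \<or> k = 0 \<and> edge_contracted G H \<phi> e)"

text \<open>Tangent directions at a point \<open>P\<close>: \<open>(e, t, s)\<close> is the direction at \<open>P = par e t\<close> along
  the edge \<open>e\<close>, with increasing parameter if \<open>s\<close> and decreasing parameter otherwise. A loop at a
  vertex gives two directions.\<close>

definition tangents :: "'p mgraph \<Rightarrow> 'p \<Rightarrow> (nat \<times> real \<times> bool) set" where
  "tangents G P =
     {(e, t, s). e \<in> edges G \<and> 0 \<le> t \<and> t \<le> len G e \<and> par G e t = P \<and>
        (if s then t < len G e else 0 < t)}"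

fun tangent_over ::
  "'p mgraph \<Rightarrow> 'q mgraph \<Rightarrow> ('p \<Rightarrow> 'q) \<Rightarrow> nat \<times> real \<times> bool \<Rightarrow> nat \<times> real \<times> bool \<Rightarrow> bool" where
  "tangent_over G H \<phi> (e, t, s) (e', t', s') \<longleftrightarrow>
     (\<exists>r k. edge_over G H \<phi> e e' r k \<and>
        t' = (if r then real k * t else len H e' - real k * t) \<and> s' = (s = r))"

text \<open>\<open>d\<^sub>P(\<phi>)\<close>, computed at the tangent direction \<open>w\<close> at \<open>\<phi> P\<close>.\<close>

definition local_degree ::
  "'p mgraph \<Rightarrow> 'q mgraph \<Rightarrow> ('p \<Rightarrow> 'q) \<Rightarrow> 'p \<Rightarrow> nat \<times> real \<times> bool \<Rightarrow> nat" where
  "local_degree G H \<phi> P w =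
     (\<Sum>v\<in>{v \<in> tangents G P. tangent_over G H \<phi> v w}. slope G H \<phi> (fst v))"

definition harmonic_on :: "'p mgraph \<Rightarrow> 'q mgraph \<Rightarrow> ('p \<Rightarrow> 'q) \<Rightarrow> bool" where
  "harmonic_on G H \<phi> \<longleftrightarrow>
     continuous_map (realization_top G) (realization_top H) \<phi> \<and>
     \<phi> ` points G = points H \<and> \<phi> ` verts G \<subseteq> verts H \<and>
     (\<forall>e\<in>edges G. (\<exists>e' s k. edge_over G H \<phi> e e' s k) \<or> edge_contracted G H \<phi> e) \<and>
     (\<forall>P\<in>points G. \<forall>w\<in>tangents H (\<phi> P). \<forall>w'\<in>tangents H (\<phi> P).
        local_degree G H \<phi> P w = local_degree G H \<phi> P w')"

definition tropical_cover :: "'p mgraph \<Rightarrow> 'q mgraph \<Rightarrow> ('p \<Rightarrow> 'q) \<Rightarrow> bool" where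
  "tropical_cover \<Gamma> \<Delta> \<phi> \<longleftrightarrow>
     (\<exists>G H. model_of G \<Gamma> \<and> model_of H \<Delta> \<and> harmonic_on G H \<phi>)"

text \<open>The degree may be computed over any point \<open>Q\<close> (at any tangent direction \<open>w\<close> there) and in
  any suitable models. When edges are contracted to \<open>Q\<close> its fibre is infinite, so the sum is
  restricted to the finitely many points of non-zero local degree.\<close>

definition has_degree :: "'p mgraph \<Rightarrow> 'q mgraph \<Rightarrow> ('p \<Rightarrow> 'q) \<Rightarrow> nat \<Rightarrow> bool" where
  "has_degree \<Gamma> \<Delta> \<phi> d \<longleftrightarrow>
     (\<forall>G H. model_of G \<Gamma> \<and> model_of H \<Delta> \<and> harmonic_on G H \<phi> \<longrightarrow>
        (\<forall>Q\<in>points H. \<forall>w\<in>tangents H Q.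
           (\<Sum>P | P \<in> points G \<and> \<phi> P = Q \<and> local_degree G H \<phi> P w \<noteq> 0.
              local_degree G H \<phi> P w) = d))"

text \<open>The intermediate curve ranges over curves with points in \<open>nat \<times> real\<close>; up to isomorphism
  this covers all tropical curves (take \<open>(0, i)\<close> for the vertices and \<open>(Suc e, t)\<close> for the
  points of the open edge \<open>e\<close>).\<close>

definition optimal_cover :: "'p mgraph \<Rightarrow> 'q mgraph \<Rightarrow> ('p \<Rightarrow> 'q) \<Rightarrow> bool" where
  "optimal_cover \<Gamma> E \<phi> \<longleftrightarrow>
     tropical_cover \<Gamma> E \<phi> \<and>
     (\<forall>(E' :: (nat \<times> real) mgraph) \<phi>' \<psi>.
        tropical_curve E' \<and> genus E' = 1 \<and>
        tropical_cover \<Gamma> E' \<phi>' \<and> tropical_cover E' E \<psi> \<and>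
        (\<forall>P\<in>points \<Gamma>. \<phi> P = \<psi> (\<phi>' P))
        \<longrightarrow> has_degree E' E \<psi> 1)"


section \<open>Jacobians and push-forward\<close>

text \<open>Forms \<open>\<Sum> \<omega>\<^sub>e de\<close> and chains \<open>\<Sum> a\<^sub>e e\<close> are given by their coefficients, with value 0 on
  numbers that are not edges.\<close>

definition coefficient_group :: "(nat \<Rightarrow> int) set \<Rightarrow> (nat \<Rightarrow> int) monoid" where
  "coefficient_group A = \<lparr>carrier = A, mult = (\<lambda>a b e. a e + b e), one = (\<lambda>_. 0)\<rparr>"

definition harmonic_forms :: "'p mgraph \<Rightarrow> (nat \<Rightarrow> int) monoid" where
  "harmonic_forms G = coefficient_group
     {\<omega>. (\<forall>e. e \<notin> edges G \<longrightarrow> \<omega> e = 0) \<and>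
         (\<forall>v\<in>verts G. (\<Sum>e | e \<in> edges G \<and> tgt G e = v. \<omega> e) =
                       (\<Sum>e | e \<in> edges G \<and> src G e = v. \<omega> e))}"

definition boundary :: "'p mgraph \<Rightarrow> (nat \<Rightarrow> int) \<Rightarrow> 'p \<Rightarrow> int" where
  "boundary G a v =
     (\<Sum>e\<in>edges G. a e * ((if tgt G e = v then 1 else 0) - (if src G e = v then 1 else 0)))"

definition cycles :: "'p mgraph \<Rightarrow> (nat \<Rightarrow> int) monoid" where
  "cycles G = coefficient_group
     {a. (\<forall>e. e \<notin> edges G \<longrightarrow> a e = 0) \<and> (\<forall>v\<in>verts G. boundary G a v = 0)}"

definition Jac :: "'p mgraph \<Rightarrow> (nat \<Rightarrow> int, nat \<Rightarrow> int) itorus" where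
  "Jac G = \<lparr>Lam = harmonic_forms G, Lam' = cycles G,
            pairing = (\<lambda>\<omega> a. \<Sum>e\<in>edges G. of_int (\<omega> e * a e) * len G e)\<rparr>"

text \<open>The sign with which the oriented edge \<open>e\<close> is mapped to the oriented edge \<open>e'\<close>; it is 0 if
  \<open>e\<close> does not lie over \<open>e'\<close>. It accounts for the fact that a morphism of models need not
  respect the chosen orientations.\<close>

definition edge_sign :: "'p mgraph \<Rightarrow> 'q mgraph \<Rightarrow> ('p \<Rightarrow> 'q) \<Rightarrow> nat \<Rightarrow> nat \<Rightarrow> int" where
  "edge_sign G H \<phi> e e' =
     (if \<exists>k. edge_over G H \<phi> e e' True k then 1
      else if \<exists>k. edge_over G H \<phi> e e' False k then - 1 else 0)"

definition pullback_form ::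
  "'p mgraph \<Rightarrow> 'q mgraph \<Rightarrow> ('p \<Rightarrow> 'q) \<Rightarrow> (nat \<Rightarrow> int) \<Rightarrow> nat \<Rightarrow> int" where
  "pullback_form G H \<phi> \<omega> =
     (\<lambda>e. if e \<in> edges G
          then int (slope G H \<phi> e) * (\<Sum>e'\<in>edges H. edge_sign G H \<phi> e e' * \<omega> e') else 0)"

definition pushforward_cycle ::
  "'p mgraph \<Rightarrow> 'q mgraph \<Rightarrow> ('p \<Rightarrow> 'q) \<Rightarrow> (nat \<Rightarrow> int) \<Rightarrow> nat \<Rightarrow> int" where
  "pushforward_cycle G H \<phi> a =
     (\<lambda>e'. if e' \<in> edges H then \<Sum>e\<in>edges G. edge_sign G H \<phi> e e' * a e else 0)"

definition push_forward ::
  "'p mgraph \<Rightarrow> 'q mgraph \<Rightarrow> ('p \<Rightarrow> 'q)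
     \<Rightarrow> (nat \<Rightarrow> int, nat \<Rightarrow> int, nat \<Rightarrow> int, nat \<Rightarrow> int) torus_map" where
  "push_forward G H \<phi> = (pullback_form G H \<phi>, pushforward_cycle G H \<phi>)"

end

theory Submission
  imports Defs
begin

text \<open>
  Harmonic forms and cycles on a model satisfy the same linear conditions, so \<open>Jac G\<close> is the cycle
  lattice \<open>L\<close> of \<open>G\<close> paired with itself by the positive definite length pairing, and \<open>\<phi>\<^sup>*\<close> is adjoint to
  \<open>\<phi>\<^sub>*\<close> with \<open>\<phi>\<^sub>* \<phi>\<^sup>* = d\<close>. If all push-forwards of cycles were divisible by some \<open>k > 1\<close>, then \<open>\<phi>\<close> would
  lift to the \<open>k\<close>-fold cyclic cover of the curve of genus one, against optimality; hence
  \<open>\<phi>\<^sub>*\<close> is surjective on cycles, which is what makes \<open>ker(\<phi>\<^sub>*)\<close> connected. The isogeny is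
  \<open>f\<^sub># (a, b) = a + \<phi>\<^sup>* b\<close> and \<open>f\<^sup># x = ([x], \<phi>\<^sub>* x)\<close>. A point of its kernel is determined by its component
  in \<open>TE\<close>, and the components that occur are exactly the \<open>d\<close>-torsion points.
\<close>

section \<open>Tori and their quotient groups\<close>

text \<open>The proof works in coordinates. A cycle is determined by its values on the edges outside
  a spanning tree, so \<open>cycles G\<close> is a lattice of rank two with coordinates
  \<open>p\<close> and \<open>q\<close>, and \<open>cycles H\<close> is the integers with coordinate
  \<open>e0\<close>. The saturation of the pulled-back forms becomes the zero set of a determinant,
  and the claims on \<open>Ker0\<close> become Bezout and Cramer arithmetic. The main obstacle is
  the lift. Optimality quantifies over genuine curves, so the cyclic cover has to be built as a set
  of points, and the lifted map has to meet the whole definition of a harmonic morphism,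
  surjectivity included. Path lifting is replaced by a potential modulo \<open>k\<close> on the
  vertices of \<open>G\<close> that names the sheet of each vertex; it exists because all
  push-forwards of cycles are multiples of \<open>k\<close>. Surjectivity on cycles serves twice: it
  moves a functional by a period into the subspace that vanishes on pulled-back forms, and it
  realises every \<open>d\<close>-torsion point in the kernel of the isogeny.\<close>

lemma integral_torusD:
  assumes "integral_torus S"
  shows "comm_group (Lam S)" "comm_group (Lam' S)" "bilinear_pairing S"
  using assms by (auto simp: integral_torus_def integral_torus_dim_def)

lemma carrier_real_dual:
  "F \<in> carrier (real_dual L) \<longleftrightarrow>
     (\<forall>x\<in>carrier L. \<forall>y\<in>carrier L. F (x \<otimes>\<^bsub>L\<^esub> y) = F x + F y) \<and>
     (\<forall>x. x \<notin> carrier L \<longrightarrow> F x = 0)"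
  by (simp add: real_dual_def)

lemma real_dual_simps [simp]:
  "F \<otimes>\<^bsub>real_dual L\<^esub> G = (\<lambda>x. F x + G x)" "\<one>\<^bsub>real_dual L\<^esub> = (\<lambda>_. 0)"
  by (simp_all add: real_dual_def)

lemma comm_group_real_dual: "comm_group (real_dual L)"
proof (rule comm_groupI)
  fix F assume F: "F \<in> carrier (real_dual L)"
  show "\<exists>G\<in>carrier (real_dual L). G \<otimes>\<^bsub>real_dual L\<^esub> F = \<one>\<^bsub>real_dual L\<^esub>"
    using F by (intro bexI[of _ "\<lambda>x. - F x"]) (auto simp: carrier_real_dual)
qed (auto simp: carrier_real_dual)

lemma inv_real_dual [simp]:
  assumes "F \<in> carrier (real_dual L)"
  shows "inv\<^bsub>real_dual L\<^esub> F = (\<lambda>x. - F x)"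
proof -
  interpret comm_group "real_dual L" by (rule comm_group_real_dual)
  show ?thesis
    by (rule inv_equality) (use assms in \<open>auto simp: carrier_real_dual\<close>)
qed

lemma real_dual_pow: "F [^]\<^bsub>real_dual L\<^esub> (n::nat) = (\<lambda>x. real n * F x)"
  by (induction n) (auto simp: algebra_simps real_dual_def)

lemma real_dual_diff:
  assumes "F \<in> carrier (real_dual L)" "G \<in> carrier (real_dual L)"
  shows "(\<lambda>x. F x - G x) \<in> carrier (real_dual L)"
  using assms by (simp add: carrier_real_dual)

lemma real_dual_one:
  assumes "monoid L" "F \<in> carrier (real_dual L)"
  shows "F \<one>\<^bsub>L\<^esub> = 0"
proof -
  interpret monoid L by fact
  have "F (\<one>\<^bsub>L\<^esub> \<otimes>\<^bsub>L\<^esub> \<one>\<^bsub>L\<^esub>) = F \<one>\<^bsub>L\<^esub> + F \<one>\<^bsub>L\<^esub>"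
    using assms(2) by (simp add: carrier_real_dual del: l_one r_one)
  then show ?thesis by simp
qed

lemma real_dual_nat_pow:
  assumes "monoid L" "F \<in> carrier (real_dual L)" "x \<in> carrier L"
  shows "F (x [^]\<^bsub>L\<^esub> (n::nat)) = real n * F x"
proof -
  interpret monoid L by fact
  show ?thesis
  proof (induction n)
    case 0
    then show ?case using real_dual_one[OF assms(1,2)] by simp
  next
    case (Suc n)
    have "F (x [^]\<^bsub>L\<^esub> n \<otimes>\<^bsub>L\<^esub> x) = F (x [^]\<^bsub>L\<^esub> n) + F x"
      using assms by (simp add: carrier_real_dual)
    with Suc show ?case by (simp add: algebra_simps)
  qed
qed

lemma periods_subgroup:
  assumes "integral_torus S"
  shows "subgroup (periods S) (real_dual (Lam S))"
proof -
  interpret L: comm_group "Lam S" using assms by (rule integral_torusD)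
  interpret L': comm_group "Lam' S" using assms by (rule integral_torusD)
  interpret D: comm_group "real_dual (Lam S)" by (rule comm_group_real_dual)
  have bil: "bilinear_pairing S" using assms by (rule integral_torusD)
  have "period S \<in> hom (Lam' S) (real_dual (Lam S))"
    using bil by (auto simp: hom_def carrier_real_dual period_def bilinear_pairing_def fun_eq_iff)
  then interpret h: group_hom "Lam' S" "real_dual (Lam S)" "period S"
    by unfold_locales
  show ?thesis unfolding periods_def by (rule h.img_is_subgroup)
qed

lemma periods_normal:
  assumes "integral_torus S"
  shows "normal (periods S) (real_dual (Lam S))"
  using comm_group.normal_iff_subgroup[OF comm_group_real_dual] periods_subgroup[OF assms] by blast

abbreviation torus_class :: "('a, 'b) itorus \<Rightarrow> ('a \<Rightarrow> real) \<Rightarrow> ('a \<Rightarrow> real) set" where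
  "torus_class S F \<equiv> periods S #>\<^bsub>real_dual (Lam S)\<^esub> F"

lemma (in comm_group) rcos_eq_iff:
  assumes "subgroup N G" "x \<in> carrier G" "y \<in> carrier G"
  shows "N #> x = N #> y \<longleftrightarrow> x \<otimes> inv y \<in> N"
proof -
  have "N #> x = N #> y \<longleftrightarrow> x \<in> N #> y"
    using assms repr_independence[of x N y] rcos_self[of x N] by blast
  then show ?thesis
    using subgroup.rcos_module[OF assms(1) _ assms(3,2)] by (simp add: is_group)
qed

lemma torus_class_eq_iff:
  assumes "integral_torus S" "F \<in> carrier (real_dual (Lam S))" "G \<in> carrier (real_dual (Lam S))"
  shows "torus_class S F = torus_class S G \<longleftrightarrow> (\<lambda>x. F x - G x) \<in> periods S"
  using comm_group.rcos_eq_iff[OF comm_group_real_dual periods_subgroup[OF assms(1)] assms(2,3)] assms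
  by simp

lemma carrier_torus_group:
  "carrier (torus_group S) = torus_class S ` carrier (real_dual (Lam S))"
  by (simp add: torus_group_def carrier_FactGroup)

lemma torus_class_mult:
  assumes "integral_torus S" "F \<in> carrier (real_dual (Lam S))" "G \<in> carrier (real_dual (Lam S))"
  shows "torus_class S F \<otimes>\<^bsub>torus_group S\<^esub> torus_class S G = torus_class S (\<lambda>x. F x + G x)"
  using normal.rcos_sum[OF periods_normal[OF assms(1)] assms(2,3)] by (simp add: torus_group_def)

lemma torus_group_one: "\<one>\<^bsub>torus_group S\<^esub> = periods S"
  by (simp add: torus_group_def)

lemma torus_class_eq_one_iff:
  assumes "integral_torus S" "F \<in> carrier (real_dual (Lam S))"
  shows "torus_class S F = \<one>\<^bsub>torus_group S\<^esub> \<longleftrightarrow> F \<in> periods S"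
proof -
  interpret D: comm_group "real_dual (Lam S)" by (rule comm_group_real_dual)
  show ?thesis
    using D.coset_join1[of "periods S" F] D.coset_join2[of F "periods S"] assms
      periods_subgroup[OF assms(1)] by (auto simp: torus_group_one)
qed

lemma torus_class_pow:
  assumes "integral_torus S" "F \<in> carrier (real_dual (Lam S))"
  shows "torus_class S F [^]\<^bsub>torus_group S\<^esub> (n::nat) = torus_class S (\<lambda>x. real n * F x)"
  using normal.FactGroup_pow[OF periods_normal[OF assms(1)] assms(2), of n]
  by (simp add: torus_group_def real_dual_pow)

lemma carrier_torsion:
  assumes "integral_torus S"
  shows "carrier (torsion n S) =
    torus_class S ` {F \<in> carrier (real_dual (Lam S)). (\<lambda>x. real n * F x) \<in> periods S}"
proof -
  interpret D: comm_group "real_dual (Lam S)" by (rule comm_group_real_dual)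
  have "(\<lambda>x. real n * F x) \<in> carrier (real_dual (Lam S))" if "F \<in> carrier (real_dual (Lam S))" for F
    using that by (auto simp: carrier_real_dual algebra_simps)
  then have "torus_class S F [^]\<^bsub>torus_group S\<^esub> n = \<one>\<^bsub>torus_group S\<^esub> \<longleftrightarrow>
      (\<lambda>x. real n * F x) \<in> periods S" if "F \<in> carrier (real_dual (Lam S))" for F
    using torus_class_eq_one_iff[OF assms] that by (simp add: torus_class_pow[OF assms])
  then show ?thesis
    unfolding torsion_def carrier_torus_group by auto
qed

lemma torus_class_self:
  assumes "integral_torus S" "F \<in> carrier (real_dual (Lam S))" "C = torus_class S F"
  shows "F \<in> C"
  using group.rcos_self[OF comm_group.axioms(2)[OF comm_group_real_dual] assms(2) periods_subgroup[OF assms(1)]]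
    assms(3) by simp

subsection \<open>Morphisms on points\<close>

text \<open>This is \<open>Hom(f\<^sup>#, \<real>)\<close>, the map on functionals that
  \<open>torus_hom\<close> induces on cosets; the value 0 off the carrier keeps it inside
  \<open>real_dual\<close>.\<close>

definition dual_map :: "('c, 'd) itorus \<Rightarrow> ('a, 'b, 'c, 'd) torus_map \<Rightarrow> ('a \<Rightarrow> real) \<Rightarrow> 'c \<Rightarrow> real" where
  "dual_map T f F = (\<lambda>y. if y \<in> carrier (Lam T) then F (fst f y) else 0)"

lemma dual_map_closed:
  assumes "torus_morphism S T f" "F \<in> carrier (real_dual (Lam S))"
  shows "dual_map T f F \<in> carrier (real_dual (Lam T))"
proof -
  have h: "fst f \<in> hom (Lam T) (Lam S)" using assms(1) by (simp add: torus_morphism_def)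
  interpret T: comm_group "Lam T"
    using assms(1) by (auto simp: torus_morphism_def intro: integral_torusD)
  show ?thesis
    using assms(2) h hom_in_carrier[OF h]
    by (auto simp: carrier_real_dual dual_map_def hom_mult)
qed

lemma dual_map_add: "dual_map T f (\<lambda>x. F x + G x) = (\<lambda>y. dual_map T f F y + dual_map T f G y)"
  by (auto simp: dual_map_def)

lemma dual_map_diff: "dual_map T f (\<lambda>x. F x - G x) = (\<lambda>y. dual_map T f F y - dual_map T f G y)"
  by (auto simp: dual_map_def)

lemma dual_map_period:
  assumes "torus_morphism S T f" "b \<in> carrier (Lam' S)"
  shows "dual_map T f (period S b) = period T (snd f b)"
  using assms hom_in_carrier[of "fst f" "Lam T" "Lam S"]
  by (auto simp: dual_map_def period_def torus_morphism_def)

lemma dual_map_periods: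
  assumes "torus_morphism S T f" "F \<in> periods S"
  shows "dual_map T f F \<in> periods T"
  using assms dual_map_period[OF assms(1)] hom_in_carrier[of "snd f" "Lam' S" "Lam' T"]
  by (auto simp: periods_def torus_morphism_def)

text \<open>Two representatives of a class differ by a period, and \<open>dual_map\<close> sends
  periods to periods, so the union in \<open>torus_hom\<close> is taken over equal cosets.\<close>

lemma torus_hom_class:
  assumes f: "torus_morphism S T f" and F: "F \<in> carrier (real_dual (Lam S))"
  shows "torus_hom S T f (torus_class S F) = torus_class T (dual_map T f F)"
proof -
  have S: "integral_torus S" and T: "integral_torus T"
    using f by (auto simp: torus_morphism_def)
  have *: "torus_class T (dual_map T f G) = torus_class T (dual_map T f F)"
    if "G \<in> torus_class S F" for G
  proof -
    interpret D: comm_group "real_dual (Lam S)" by (rule comm_group_real_dual)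
    have G: "G \<in> carrier (real_dual (Lam S))"
      using subgroup.elemrcos_carrier[OF periods_subgroup[OF S] D.is_group F that] .
    have "(\<lambda>x. G x - F x) \<in> periods S"
      using subgroup.rcos_module[OF periods_subgroup[OF S] D.is_group F G] that F by simp
    from dual_map_periods[OF f this] show ?thesis
      by (simp add: torus_class_eq_iff T dual_map_closed[OF f] F G dual_map_diff)
  qed
  have "F \<in> torus_class S F" by (rule torus_class_self[OF S F refl])
  moreover have "torus_hom S T f (torus_class S F) =
      (\<Union>G\<in>torus_class S F. torus_class T (dual_map T f G))"
    by (simp add: torus_hom_def dual_map_def)
  ultimately show ?thesis using * by blast
qed

lemma torus_hom_hom:
  assumes f: "torus_morphism S T f"
  shows "torus_hom S T f \<in> hom (torus_group S) (torus_group T)"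
proof -
  have S: "integral_torus S" and T: "integral_torus T"
    using f by (auto simp: torus_morphism_def)
  interpret D: comm_group "real_dual (Lam S)" by (rule comm_group_real_dual)
  show ?thesis
  proof (rule homI)
    fix x assume "x \<in> carrier (torus_group S)"
    then show "torus_hom S T f x \<in> carrier (torus_group T)"
      by (auto simp: carrier_torus_group torus_hom_class[OF f] dual_map_closed[OF f])
  next
    fix x y assume "x \<in> carrier (torus_group S)" "y \<in> carrier (torus_group S)"
    then obtain F G where FG: "F \<in> carrier (real_dual (Lam S))" "G \<in> carrier (real_dual (Lam S))"
      and xy: "x = torus_class S F" "y = torus_class S G"
      by (auto simp: carrier_torus_group)
    have FG': "(\<lambda>x. F x + G x) \<in> carrier (real_dual (Lam S))"
      using D.m_closed[OF FG] by simp
    show "torus_hom S T f (x \<otimes>\<^bsub>torus_group S\<^esub> y) =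
        torus_hom S T f x \<otimes>\<^bsub>torus_group T\<^esub> torus_hom S T f y"
      using FG FG'
      by (simp add: xy torus_class_mult S T torus_hom_class[OF f] dual_map_closed[OF f] dual_map_add)
  qed
qed

lemma carrier_torus_kernel:
  assumes f: "torus_morphism S T f"
  shows "carrier (torus_kernel S T f) =
    torus_class S ` {F \<in> carrier (real_dual (Lam S)). dual_map T f F \<in> periods T}"
proof -
  have T: "integral_torus T" using f by (auto simp: torus_morphism_def)
  have "torus_hom S T f (torus_class S F) = \<one>\<^bsub>torus_group T\<^esub> \<longleftrightarrow> dual_map T f F \<in> periods T"
    if "F \<in> carrier (real_dual (Lam S))" for F
    using torus_class_eq_one_iff[OF T dual_map_closed[OF f that]] that
    by (simp add: torus_hom_class[OF f])
  then show ?thesis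
    unfolding torus_kernel_def kernel_def carrier_torus_group by auto
qed

text \<open>A union of lines through the origin is connected, and so is its image under the quotient map.\<close>

lemma connectedin_torus_top_lines:
  assumes V: "V \<subseteq> carrier (real_dual (Lam S))" and sc: "\<And>F t. F \<in> V \<Longrightarrow> (\<lambda>x. t * F x) \<in> V"
    and "V \<noteq> {}"
  shows "connectedin (torus_top S) (torus_class S ` V)"
proof -
  have line: "connected (range (\<lambda>t::real. (\<lambda>x. t * F x)))" for F :: "'a \<Rightarrow> real"
    by (intro connected_continuous_image continuous_on_coordinatewise_then_product
        continuous_intros connected_UNIV)
  have "connected (\<Union>F\<in>V. range (\<lambda>t::real. (\<lambda>x. t * F x)))"
  proof (rule connected_Union)
    have "(\<lambda>x. 0) \<in> range (\<lambda>t::real. (\<lambda>x. t * F x))" for F :: "'a \<Rightarrow> real"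
      by (rule range_eqI[of _ _ 0]) simp
    then show "\<Inter> ((\<lambda>F. range (\<lambda>t::real. (\<lambda>x. t * F x))) ` V) \<noteq> {}" by blast
  qed (use line in auto)
  moreover have "(\<Union>F\<in>V. range (\<lambda>t::real. (\<lambda>x. t * F x))) = V"
  proof
    show "V \<subseteq> (\<Union>F\<in>V. range (\<lambda>t::real. (\<lambda>x. t * F x)))"
    proof
      fix F assume "F \<in> V"
      moreover have "F \<in> range (\<lambda>t::real. (\<lambda>x. t * F x))" by (rule range_eqI[of _ _ 1]) simp
      ultimately show "F \<in> (\<Union>F\<in>V. range (\<lambda>t::real. (\<lambda>x. t * F x)))" by blast
    qed
    show "(\<Union>F\<in>V. range (\<lambda>t::real. (\<lambda>x. t * F x))) \<subseteq> V"
      using sc by blast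
  qed
  ultimately have "connected V" by simp
  then have "connectedin (top_of_set (carrier (real_dual (Lam S)))) V"
    using V by (simp add: connectedin_subtopology)
  then show ?thesis
    unfolding torus_top_def
    by (rule connectedin_continuous_map_image[OF quotient_imp_continuous_map[OF quotient_map_quotient_top]])
qed

section \<open>Spanning trees and the cycle lattice\<close>

lemma tropical_curveD:
  assumes "tropical_curve G"
  shows "finite (verts G)" "verts G \<noteq> {}" "finite (edges G)"
    "\<And>e. e \<in> edges G \<Longrightarrow> len G e > 0" "\<And>e. e \<in> edges G \<Longrightarrow> src G e \<in> verts G"
    "\<And>e. e \<in> edges G \<Longrightarrow> tgt G e \<in> verts G"
    "\<And>e. e \<in> edges G \<Longrightarrow> inj_on (par G e) {0<..<len G e}"
    "\<And>e. e \<in> edges G \<Longrightarrow> open_edge G e \<inter> verts G = {}"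
    "\<And>e e'. e \<in> edges G \<Longrightarrow> e' \<in> edges G \<Longrightarrow> e \<noteq> e' \<Longrightarrow> open_edge G e \<inter> open_edge G e' = {}"
  using assms by (auto simp: tropical_curve_def)

lemma open_edgeI: "0 < t \<Longrightarrow> t < len G e \<Longrightarrow> par G e t \<in> open_edge G e"
  by (simp add: open_edge_def)

lemma open_edge_unique:
  assumes G: "tropical_curve G"
    and "e \<in> edges G" "e1 \<in> edges G" "0 < t" "t < len G e" "0 < t1" "t1 < len G e1"
    and eq: "par G e t = par G e1 t1"
  shows "e = e1" "t = t1"
proof -
  have "par G e t \<in> open_edge G e" "par G e1 t1 \<in> open_edge G e1"
    using assms(4-7) by (auto intro: open_edgeI)
  then show "e = e1" using tropical_curveD(9)[OF G assms(2,3)] eq by auto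
  then show "t = t1" using tropical_curveD(7)[OF G assms(2)] assms by (auto dest: inj_onD)
qed

definition adj :: "'p mgraph \<Rightarrow> nat set \<Rightarrow> ('p \<times> 'p) set" where
  "adj G T = {(src G e, tgt G e) | e. e \<in> T} \<union> {(tgt G e, src G e) | e. e \<in> T}"

lemma tropical_curve_connected:
  assumes "tropical_curve G" "v \<in> verts G" "w \<in> verts G"
  shows "(v, w) \<in> (adj G (edges G))\<^sup>*"
  using assms by (simp add: tropical_curve_def adj_def)

lemma adj_mono: "S \<subseteq> T \<Longrightarrow> (adj G S)\<^sup>* \<subseteq> (adj G T)\<^sup>*"
  by (intro rtrancl_mono) (auto simp: adj_def)

text \<open>The form in which connectedness is used: it supplies the edge that enlarges a partial
  spanning tree, and later it spreads surjectivity of the lifted map over the whole cover.\<close>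

lemma rtrancl_leaves:
  assumes "(v, w) \<in> R\<^sup>*" "v \<in> W" "w \<notin> W"
  shows "\<exists>x y. (x, y) \<in> R \<and> x \<in> W \<and> y \<notin> W"
  using assms by (induction rule: rtrancl_induct) blast+

text \<open>The last clause expresses that \<open>T\<close> contains no cycle.\<close>

definition spanning_tree :: "'p mgraph \<Rightarrow> nat set \<Rightarrow> bool" where
  "spanning_tree G T \<longleftrightarrow>
     T \<subseteq> edges G \<and> card T + 1 = card (verts G) \<and>
     (\<forall>v\<in>verts G. \<forall>w\<in>verts G. (v, w) \<in> (adj G T)\<^sup>*) \<and>
     (\<forall>f :: nat \<Rightarrow> int. \<exists>p :: 'p \<Rightarrow> int. \<forall>e\<in>T. p (tgt G e) - p (src G e) = f e)"

text \<open>The tree is grown vertex by vertex. Connectedness supplies an edge \<open>e\<close> that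
  leaves the current vertex set \<open>W\<close>; its outer end \<open>y\<close> carries no
  potential value yet, so potentials extend.\<close>

lemma spanning_tree_exists:
  fixes G :: "'p mgraph"
  assumes G: "tropical_curve G"
  shows "\<exists>T. spanning_tree G T"
proof -
  note D = tropical_curveD[OF G]
  have grow: "Suc n \<le> card (verts G) \<Longrightarrow>
      \<exists>W T. W \<subseteq> verts G \<and> T \<subseteq> edges G \<and> card W = Suc n \<and> card T = n \<and>
        (\<forall>e\<in>T. src G e \<in> W \<and> tgt G e \<in> W) \<and> (\<forall>v\<in>W. \<forall>w\<in>W. (v, w) \<in> (adj G T)\<^sup>*) \<and>
        (\<forall>f :: nat \<Rightarrow> int. \<exists>p :: 'p \<Rightarrow> int. \<forall>e\<in>T. p (tgt G e) - p (src G e) = f e)" for n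
  proof (induction n)
    case 0
    obtain v where "v \<in> verts G" using D(2) by blast
    then show ?case by (intro exI[of _ "{v}"] exI[of _ "{}"]) auto
  next
    case (Suc n)
    then obtain W T where W: "W \<subseteq> verts G" "T \<subseteq> edges G" "card W = Suc n" "card T = n"
      and ends: "\<forall>e\<in>T. src G e \<in> W \<and> tgt G e \<in> W"
      and conn: "\<forall>v\<in>W. \<forall>w\<in>W. (v, w) \<in> (adj G T)\<^sup>*"
      and pot: "\<forall>f :: nat \<Rightarrow> int. \<exists>p :: 'p \<Rightarrow> int. \<forall>e\<in>T. p (tgt G e) - p (src G e) = f e"
      by auto
    have "W \<noteq> verts G" using W(3) Suc.prems by auto
    then obtain w where w: "w \<in> verts G" "w \<notin> W" using W(1) by blast
    obtain v where v: "v \<in> W" using W(3) by fastforce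
    obtain x y where xy: "(x, y) \<in> adj G (edges G)" "x \<in> W" "y \<notin> W"
      using rtrancl_leaves[OF tropical_curve_connected[OF G] v w(2)] v w W(1) by blast
    then obtain e where e: "e \<in> edges G"
      and or: "src G e = x \<and> tgt G e = y \<or> tgt G e = x \<and> src G e = y"
      by (auto simp: adj_def)
    have yV: "y \<in> verts G" using e or D(5,6) by auto
    have eT: "e \<notin> T" using or xy ends by auto
    have fin: "finite W" "finite T" using W D finite_subset by blast+
    have adj1: "(x, y) \<in> adj G (insert e T)" "(y, x) \<in> adj G (insert e T)"
      using or by (auto simp: adj_def)
    have conn': "(v, w) \<in> (adj G (insert e T))\<^sup>*" if "v \<in> W" "w \<in> W" for v w
      using conn that adj_mono[of T "insert e T" G] by blast
    have conn2: "\<forall>v\<in>insert y W. \<forall>w\<in>insert y W. (v, w) \<in> (adj G (insert e T))\<^sup>*"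
    proof (intro ballI)
      fix v w assume "v \<in> insert y W" "w \<in> insert y W"
      then have "(v, x) \<in> (adj G (insert e T))\<^sup>*" "(x, w) \<in> (adj G (insert e T))\<^sup>*"
        using conn' xy adj1 by (auto intro: r_into_rtrancl)
      then show "(v, w) \<in> (adj G (insert e T))\<^sup>*" by (rule rtrancl_trans)
    qed
    have pot2: "\<exists>p :: 'p \<Rightarrow> int. \<forall>e'\<in>insert e T. p (tgt G e') - p (src G e') = f e'"
      for f :: "nat \<Rightarrow> int"
    proof -
      obtain p :: "'p \<Rightarrow> int" where p: "\<forall>e\<in>T. p (tgt G e) - p (src G e) = f e"
        using pot by blast
      \<comment> \<open>Solves the equation on \<open>e\<close> for the value at \<open>y\<close>,
        with a sign that depends on which end of \<open>e\<close> is \<open>y\<close>. No edge of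
        \<open>T\<close> meets \<open>y\<close>, so the other equations survive.\<close>
      define p' where "p' = p(y := if src G e = x then p x + f e else p x - f e)"
      have "x \<noteq> y" using xy by auto
      then have "p' (tgt G e) - p' (src G e) = f e" using or by (auto simp: p'_def)
      moreover have "p' (tgt G e') - p' (src G e') = f e'" if "e' \<in> T" for e'
        using p ends that xy by (auto simp: p'_def)
      ultimately show ?thesis by blast
    qed
    show ?case
      using W e yV eT fin ends or xy conn2 pot2
      by (intro exI[of _ "insert y W"] exI[of _ "insert e T"]) auto
  qed
  have "card (verts G) > 0" using D by (simp add: card_gt_0_iff)
  then obtain n where n: "card (verts G) = Suc n" by (cases "card (verts G)") auto
  obtain W T where WT: "W \<subseteq> verts G" "T \<subseteq> edges G" "card W = Suc n" "card T = n"
    and conn: "\<forall>v\<in>W. \<forall>w\<in>W. (v, w) \<in> (adj G T)\<^sup>*"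
    and pot: "\<forall>f :: nat \<Rightarrow> int. \<exists>p :: 'p \<Rightarrow> int. \<forall>e\<in>T. p (tgt G e) - p (src G e) = f e"
    using grow[of n] n by auto
  have "W = verts G" using WT n D card_subset_eq by metis
  then show ?thesis using WT conn pot n by (auto simp: spanning_tree_def)
qed

lemma spanning_tree_card:
  assumes "tropical_curve G" "spanning_tree G T"
  shows "int (card (edges G - T)) = genus G"
proof -
  have "finite (edges G)" "T \<subseteq> edges G" "card T + 1 = card (verts G)"
    using assms by (auto simp: spanning_tree_def tropical_curve_def)
  then show ?thesis
    using card_mono[of "edges G" T] by (simp add: card_Diff_subset finite_subset genus_def)
qed

section \<open>Chains, boundaries and coordinates on the cycle lattice\<close>

lemma boundary_add: "boundary G (\<lambda>e. a e + b e) v = boundary G a v + boundary G b v"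
  by (simp add: boundary_def distrib_right sum.distrib)

lemma boundary_scale: "boundary G (\<lambda>e. c * a e) v = c * boundary G a v"
  by (simp add: boundary_def sum_distrib_left mult.assoc)

lemma boundary_edge:
  assumes "finite (edges G)" "e \<in> edges G"
  shows "boundary G (\<lambda>e'. if e' = e then c else 0) v =
    c * ((if tgt G e = v then 1 else 0) - (if src G e = v then 1 else 0))"
proof -
  have "boundary G (\<lambda>e'. if e' = e then c else 0) v =
      (\<Sum>e'\<in>edges G. if e' = e then
        c * ((if tgt G e = v then 1 else 0) - (if src G e = v then 1 else 0)) else 0)"
    unfolding boundary_def by (rule sum.cong) auto
  then show ?thesis using assms by simp
qed

text \<open>Discrete integration by parts: boundary and coboundary are adjoint. For a cycle the
  left-hand side vanishes, so a coboundary sums to 0 along every cycle.\<close>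

lemma sum_potential_boundary:
  assumes "tropical_curve G"
  shows "(\<Sum>v\<in>verts G. p v * boundary G a v) = (\<Sum>e\<in>edges G. a e * (p (tgt G e) - p (src G e)))"
proof -
  note D = tropical_curveD[OF assms]
  have "(\<Sum>v\<in>verts G. p v * boundary G a v) =
      (\<Sum>v\<in>verts G. \<Sum>e\<in>edges G.
         (if v = tgt G e then a e * p v else 0) - (if v = src G e then a e * p v else 0))"
    unfolding boundary_def sum_distrib_left
    by (intro sum.cong refl) (auto simp: algebra_simps)
  also have "\<dots> = (\<Sum>e\<in>edges G. \<Sum>v\<in>verts G.
         (if v = tgt G e then a e * p v else 0) - (if v = src G e then a e * p v else 0))"
    by (rule sum.swap)
  also have "\<dots> = (\<Sum>e\<in>edges G. a e * (p (tgt G e) - p (src G e)))"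
    using D by (intro sum.cong refl) (simp add: sum_subtractf algebra_simps)
  finally show ?thesis .
qed

lemma cycles_iff:
  "a \<in> carrier (cycles G) \<longleftrightarrow>
     (\<forall>e. e \<notin> edges G \<longrightarrow> a e = 0) \<and> (\<forall>v\<in>verts G. boundary G a v = 0)"
  by (simp add: cycles_def coefficient_group_def)

lemma harmonic_forms_eq_cycles:
  assumes "finite (edges G)"
  shows "harmonic_forms G = cycles G"
proof -
  have "boundary G a v = (\<Sum>e | e \<in> edges G \<and> tgt G e = v. a e) -
      (\<Sum>e | e \<in> edges G \<and> src G e = v. a e)" for a v
  proof -
    have "boundary G a v = (\<Sum>e\<in>edges G. (if tgt G e = v then a e else 0)) -
        (\<Sum>e\<in>edges G. (if src G e = v then a e else 0))"
      unfolding boundary_def sum_subtractf[symmetric] by (intro sum.cong refl) auto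
    then show ?thesis using assms by (simp add: sum.inter_filter)
  qed
  then show ?thesis unfolding harmonic_forms_def cycles_def by simp
qed

lemma cycles_mult [simp]: "a \<otimes>\<^bsub>cycles G\<^esub> b = (\<lambda>e. a e + b e)"
  and cycles_one [simp]: "\<one>\<^bsub>cycles G\<^esub> = (\<lambda>_. 0)"
  by (simp_all add: cycles_def coefficient_group_def)

lemma cycles_add: "a \<in> carrier (cycles G) \<Longrightarrow> b \<in> carrier (cycles G) \<Longrightarrow>
    (\<lambda>e. a e + b e) \<in> carrier (cycles G)"
  by (simp add: cycles_iff boundary_add)

lemma cycles_scale: "a \<in> carrier (cycles G) \<Longrightarrow> (\<lambda>e. c * a e) \<in> carrier (cycles G)"
  by (simp add: cycles_iff boundary_scale)

lemma cycles_zero: "(\<lambda>_. 0) \<in> carrier (cycles G)"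
  by (simp add: cycles_iff boundary_def)

lemma cycles_sum:
  "(\<And>i. i \<in> I \<Longrightarrow> a i \<in> carrier (cycles G)) \<Longrightarrow> (\<lambda>e. \<Sum>i\<in>I. a i e) \<in> carrier (cycles G)"
  by (induction I rule: infinite_finite_induct) (auto simp: cycles_zero cycles_add)

text \<open>Adds up the edges of the path, each with the sign of its traversal; an edge that is used
  repeatedly just accumulates.\<close>

lemma tree_path:
  assumes G: "tropical_curve G" and T: "T \<subseteq> edges G" and "(v, w) \<in> (adj G T)\<^sup>*"
  shows "\<exists>a. (\<forall>e. e \<notin> T \<longrightarrow> a e = 0) \<and>
    (\<forall>x. boundary G a x = (if x = w then 1 else 0) - (if x = v then 1 else 0))"
  using assms(3)
proof (induction rule: rtrancl_induct)
  case base
  show ?case by (intro exI[of _ "\<lambda>_. 0"]) (simp add: boundary_def)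
next
  case (step y z)
  then obtain a where a: "\<forall>e. e \<notin> T \<longrightarrow> a e = 0"
    "\<And>x. boundary G a x = (if x = y then 1 else 0) - (if x = v then 1 else 0)" by blast
  have fin: "finite (edges G)" using G by (rule tropical_curveD)
  from step(2) obtain e and c :: int where e: "e \<in> T"
    and c: "c = 1 \<and> src G e = y \<and> tgt G e = z \<or> c = - 1 \<and> tgt G e = y \<and> src G e = z"
    by (fastforce simp: adj_def)
  have "boundary G (\<lambda>e'. a e' + (if e' = e then c else 0)) x =
      (if x = z then 1 else 0) - (if x = v then 1 else 0)" for x
    unfolding boundary_add a(2) using boundary_edge[OF fin, of e c x] e c T by auto
  then show ?case
    using a(1) e by (intro exI[of _ "\<lambda>e'. a e' + (if e' = e then c else 0)"]) auto
qed

text \<open>Closes \<open>e\<close> by a path inside the tree from its target back to its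
  source.\<close>

lemma fundamental_cycle:
  assumes G: "tropical_curve G" and T: "spanning_tree G T" and e: "e \<in> edges G - T"
  shows "\<exists>c\<in>carrier (cycles G). c e = 1 \<and> (\<forall>e'. e' \<notin> T \<longrightarrow> e' \<noteq> e \<longrightarrow> c e' = 0)"
proof -
  note D = tropical_curveD[OF G]
  have TE: "T \<subseteq> edges G" using T by (simp add: spanning_tree_def)
  have "(tgt G e, src G e) \<in> (adj G T)\<^sup>*"
    using T D(5,6) e by (auto simp: spanning_tree_def)
  from tree_path[OF G TE this] obtain a where a: "\<forall>e. e \<notin> T \<longrightarrow> a e = 0"
    "\<And>x. boundary G a x = (if x = src G e then 1 else 0) - (if x = tgt G e then 1 else 0)" by blast
  have "boundary G (\<lambda>e'. a e' + (if e' = e then 1 else 0)) x = 0" for x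
    unfolding boundary_add a(2) using boundary_edge[OF D(3), of e 1 x] e by auto
  then show ?thesis
    using a(1) e TE
    by (intro bexI[of _ "\<lambda>e'. a e' + (if e' = e then 1 else 0)"]) (auto simp: cycles_iff)
qed

text \<open>The difference \<open>c\<close> lives on the tree, where it is the coboundary of a
  potential \<open>p\<close>. Integration by parts then makes the sum of the squares of
  \<open>c\<close> equal to 0.\<close>

lemma cycle_eqI:
  assumes G: "tropical_curve G" and T: "spanning_tree G T"
    and ab: "a \<in> carrier (cycles G)" "b \<in> carrier (cycles G)"
    and eq: "\<And>e. e \<in> edges G - T \<Longrightarrow> a e = b e"
  shows "a = b"
proof -
  define c where "c = (\<lambda>e. a e - b e)"
  have c: "c \<in> carrier (cycles G)"
    using cycles_add[OF ab(1) cycles_scale[OF ab(2), of "- 1"]] by (simp add: c_def)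
  obtain p :: "'a \<Rightarrow> int" where p: "\<forall>e\<in>T. p (tgt G e) - p (src G e) = c e"
    using T unfolding spanning_tree_def by blast
  have TE: "T \<subseteq> edges G" using T by (simp add: spanning_tree_def)
  have fin: "finite (edges G)" using G by (rule tropical_curveD)
  have off: "c e = 0" if "e \<notin> T" for e
    using c eq that by (cases "e \<in> edges G") (auto simp: c_def cycles_iff)
  have "0 = (\<Sum>v\<in>verts G. p v * boundary G c v)" using c by (simp add: cycles_iff)
  also have "\<dots> = (\<Sum>e\<in>edges G. c e * (p (tgt G e) - p (src G e)))"
    by (rule sum_potential_boundary[OF G])
  also have "\<dots> = (\<Sum>e\<in>edges G. c e * c e)"
    using p off by (intro sum.cong refl) (metis mult_zero_left)
  finally have "\<forall>e\<in>edges G. c e * c e = 0"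
    using sum_nonneg_eq_0_iff[of "edges G" "\<lambda>e. c e * c e"] fin by auto
  then have "c e = 0" for e using off TE by (cases "e \<in> edges G") auto
  then show ?thesis by (auto simp: c_def fun_eq_iff)
qed

text \<open>Fundamental cycles are dual to the edges outside the tree, so weighting them with
  \<open>f\<close> prescribes the values there.\<close>

lemma cycle_extend:
  assumes G: "tropical_curve G" and T: "spanning_tree G T"
  shows "\<exists>a\<in>carrier (cycles G). \<forall>e\<in>edges G - T. a e = f e"
proof -
  have "\<forall>e\<in>edges G - T. \<exists>c. c \<in> carrier (cycles G) \<and> c e = 1 \<and> (\<forall>e'. e' \<notin> T \<longrightarrow> e' \<noteq> e \<longrightarrow> c e' = 0)"
    using fundamental_cycle[OF G T] by blast
  then obtain c where c: "\<And>e. e \<in> edges G - T \<Longrightarrow> c e \<in> carrier (cycles G)"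
    "\<And>e. e \<in> edges G - T \<Longrightarrow> c e e = 1"
    "\<And>e e'. e \<in> edges G - T \<Longrightarrow> e' \<notin> T \<Longrightarrow> e' \<noteq> e \<Longrightarrow> c e e' = 0"
    by metis
  define a where "a = (\<lambda>e'. \<Sum>e\<in>edges G - T. f e * c e e')"
  have "a \<in> carrier (cycles G)"
    unfolding a_def using c(1) by (intro cycles_sum cycles_scale) auto
  moreover have "a e' = f e'" if "e' \<in> edges G - T" for e'
  proof -
    have "a e' = (\<Sum>e\<in>edges G - T. if e = e' then f e else 0)"
      unfolding a_def using c(2,3) that by (intro sum.cong refl) auto
    then show ?thesis using that tropical_curveD(3)[OF G] by simp
  qed
  ultimately show ?thesis by blast
qed

text \<open>A potential can match \<open>f\<close> exactly on a spanning tree. On a further edge the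
  defect is the sum of \<open>f\<close> along its fundamental cycle, which is a multiple of
  \<open>k\<close>. This is the combinatorial substitute for the lifting criterion of covering
  theory.\<close>

lemma potential_mod:
  fixes G :: "'p mgraph" and f :: "nat \<Rightarrow> int"
  assumes G: "tropical_curve G"
    and f: "\<And>a. a \<in> carrier (cycles G) \<Longrightarrow> k dvd (\<Sum>e\<in>edges G. a e * f e)"
  shows "\<exists>p :: 'p \<Rightarrow> int. \<forall>e\<in>edges G. k dvd f e - (p (tgt G e) - p (src G e))"
proof -
  obtain T where T: "spanning_tree G T" using spanning_tree_exists[OF G] by blast
  obtain p :: "'p \<Rightarrow> int" where p: "\<forall>e\<in>T. p (tgt G e) - p (src G e) = f e"
    using T unfolding spanning_tree_def by blast
  note D = tropical_curveD[OF G]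
  have "k dvd f e - (p (tgt G e) - p (src G e))" if e: "e \<in> edges G" for e
  proof (cases "e \<in> T")
    case True
    with p show ?thesis by simp
  next
    case False
    then obtain c where c: "c \<in> carrier (cycles G)" "c e = 1" "\<forall>e'. e' \<notin> T \<longrightarrow> e' \<noteq> e \<longrightarrow> c e' = 0"
      using fundamental_cycle[OF G T, of e] e by blast
    have "(\<Sum>e\<in>edges G. c e * (p (tgt G e) - p (src G e))) = (\<Sum>v\<in>verts G. p v * boundary G c v)"
      by (rule sum_potential_boundary[OF G, symmetric])
    also have "\<dots> = 0" using c(1) by (simp add: cycles_iff)
    finally have "(\<Sum>e\<in>edges G. c e * f e) =
        (\<Sum>e\<in>edges G. c e * (f e - (p (tgt G e) - p (src G e))))"
      by (simp add: right_diff_distrib sum_subtractf)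
    also have "\<dots> = (\<Sum>e'\<in>edges G. if e' = e then f e - (p (tgt G e) - p (src G e)) else 0)"
      using p c by (intro sum.cong refl) force
    also have "\<dots> = f e - (p (tgt G e) - p (src G e))" using e D(3) by simp
    finally show ?thesis using f[OF c(1)] by simp
  qed
  then show ?thesis by blast
qed

section \<open>Refinements preserve the genus\<close>

text \<open>Each piece of \<open>R\<close> is sent to the position of its upper end in
  \<open>G\<close>. This is a bijection onto the positions of vertices of \<open>R\<close> in the
  half-open edges of \<open>G\<close>; the position \<open>len G e\<close> accounts for the edges of
  \<open>G\<close>, the remaining ones for the new vertices. So edges and vertices grow by the same
  number.\<close>

lemma genus_refines:
  assumes R: "tropical_curve R" and G: "tropical_curve G" and ref: "refines R G"
  shows "genus R = genus G"
proof -
  note DG = tropical_curveD[OF G] and DR = tropical_curveD[OF R]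
  have pts: "points R = points G" and VV: "verts G \<subseteq> verts R" using ref by (auto simp: refines_def)
  \<comment> \<open>Only the open image and its upper end are recorded, so reversed pieces need no
    separate treatment afterwards.\<close>
  define Q where "Q e' e a \<longleftrightarrow> e \<in> edges G \<and> 0 \<le> a \<and> a + len R e' \<le> len G e \<and>
      open_edge R e' = par G e ` {a<..<a + len R e'} \<and> par G e (a + len R e') \<in> verts R" for e' e a
  have "\<exists>e a. Q e' e a"
    if e': "e' \<in> edges R" for e'
  proof -
    obtain e a where ea: "e \<in> edges G" "0 \<le> a" "a + len R e' \<le> len G e"
      and par: "(\<forall>t\<in>{0..len R e'}. par R e' t = par G e (a + t)) \<or>
         (\<forall>t\<in>{0..len R e'}. par R e' t = par G e (a + len R e' - t))"
      using ref e' unfolding refines_def by blast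
    have l: "len R e' > 0" using DR(4) e' .
    have st: "par R e' 0 \<in> verts R" "par R e' (len R e') \<in> verts R"
      using DR(5,6)[OF e'] by (simp_all add: src_def tgt_def)
    from par have "open_edge R e' = par G e ` {a<..<a + len R e'} \<and> par G e (a + len R e') \<in> verts R"
    proof
      assume *: "\<forall>t\<in>{0..len R e'}. par R e' t = par G e (a + t)"
      have "open_edge R e' = (\<lambda>t. par G e (a + t)) ` {0<..<len R e'}"
        unfolding open_edge_def using * by (intro image_cong) auto
      also have "\<dots> = par G e ` ((+) a ` {0<..<len R e'})" by (simp add: image_image)
      also have "(+) a ` {0<..<len R e'} = {a<..<a + len R e'}"
        by (auto intro!: image_eqI[of x _ "x - a" for x])
      finally show ?thesis using st(2) * l by simp
    next
      assume *: "\<forall>t\<in>{0..len R e'}. par R e' t = par G e (a + len R e' - t)"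
      have "open_edge R e' = (\<lambda>t. par G e (a + len R e' - t)) ` {0<..<len R e'}"
        unfolding open_edge_def using * by (intro image_cong) auto
      also have "\<dots> = par G e ` ((\<lambda>t. a + len R e' - t) ` {0<..<len R e'})" by (simp add: image_image)
      also have "(\<lambda>t. a + len R e' - t) ` {0<..<len R e'} = {a<..<a + len R e'}"
        by (auto intro!: image_eqI[of x _ "a + len R e' - x" for x])
      finally show ?thesis using st(1) * l by simp
    qed
    with ea show ?thesis unfolding Q_def by blast
  qed
  then obtain fe fa where "\<And>e'. e' \<in> edges R \<Longrightarrow> Q e' (fe e') (fa e')"
    by metis
  then have over: "\<And>e'. e' \<in> edges R \<Longrightarrow> fe e' \<in> edges G \<and> 0 \<le> fa e' \<and>
      fa e' + len R e' \<le> len G (fe e') \<and> open_edge R e' = par G (fe e') ` {fa e'<..<fa e' + len R e'} \<and>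
      par G (fe e') (fa e' + len R e') \<in> verts R"
    unfolding Q_def .
  define S where "S = {(e, t). e \<in> edges G \<and> 0 < t \<and> t \<le> len G e \<and> par G e t \<in> verts R}"
  define S' where "S' = {(e, t). e \<in> edges G \<and> 0 < t \<and> t < len G e \<and> par G e t \<in> verts R}"
  note uniq = open_edge_unique[OF G]
  have "bij_betw (\<lambda>e'. (fe e', fa e' + len R e')) (edges R) S"
    unfolding bij_betw_def
  proof
    show "inj_on (\<lambda>e'. (fe e', fa e' + len R e')) (edges R)"
    proof (rule inj_onI)
      fix e1 e2 assume e: "e1 \<in> edges R" "e2 \<in> edges R"
        and eq: "(fe e1, fa e1 + len R e1) = (fe e2, fa e2 + len R e2)"
      \<comment> \<open>A point just below the common upper end, near enough to lie in both
        pieces.\<close>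
      define u where "u = fa e1 + len R e1 - min (len R e1) (len R e2) / 2"
      have "0 < len R e1" "0 < len R e2" using e DR(4) by auto
      then have "u \<in> {fa e1<..<fa e1 + len R e1}" "u \<in> {fa e2<..<fa e2 + len R e2}"
        using eq by (auto simp: u_def min_def field_simps)
      then have "par G (fe e1) u \<in> open_edge R e1" "par G (fe e1) u \<in> open_edge R e2"
        using over[OF e(1)] over[OF e(2)] eq by auto
      then show "e1 = e2" using DR(9)[OF e] by blast
    qed
    show "(\<lambda>e'. (fe e', fa e' + len R e')) ` edges R = S"
    proof
      show "(\<lambda>e'. (fe e', fa e' + len R e')) ` edges R \<subseteq> S"
      proof
        fix z assume "z \<in> (\<lambda>e'. (fe e', fa e' + len R e')) ` edges R"
        then obtain e' where "e' \<in> edges R" "z = (fe e', fa e' + len R e')" by blast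
        then show "z \<in> S" using over[of e'] DR(4)[of e'] by (auto simp: S_def)
      qed
      show "S \<subseteq> (\<lambda>e'. (fe e', fa e' + len R e')) ` edges R"
      proof
        fix z assume "z \<in> S"
        then obtain e t where z: "z = (e, t)" and e: "e \<in> edges G" "0 < t" "t \<le> len G e"
          "par G e t \<in> verts R" by (auto simp: S_def)
        \<comment> \<open>The maximum \<open>s\<close> taken from \<open>F\<close> is the last
          vertex position before \<open>t\<close>, or 0 if there is none. The piece of
          \<open>R\<close> through the midpoint of \<open>s\<close> and \<open>t\<close> can end
          neither before \<open>t\<close>, by maximality, nor after \<open>t\<close>, as no vertex
          lies inside an open edge.\<close>
        define F where "F = {s \<in> {0<..<t}. par G e s \<in> verts R}"
        have "inj_on (par G e) F"
          by (rule inj_on_subset[OF DG(7)[OF e(1)]]) (use e in \<open>auto simp: F_def\<close>)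
        moreover have "par G e ` F \<subseteq> verts R" by (auto simp: F_def)
        ultimately have "finite F" using DR(1) finite_subset finite_imageD by metis
        define s where "s = Max (insert 0 F)"
        have s: "s \<in> insert 0 F" "\<And>x. x \<in> F \<Longrightarrow> x \<le> s" "0 \<le> s"
          using \<open>finite F\<close> Max_in[of "insert 0 F"] Max_ge[of "insert 0 F"]
          unfolding s_def by blast+
        have st: "s < t" using s(1) e(2) by (auto simp: F_def)
        define m where "m = (s + t) / 2"
        have m: "s < m" "m < t" "0 < m" "m < len G e" using st s(3) e(3) by (auto simp: m_def field_simps)
        have "par G e m \<notin> verts R" using s(2)[of m] m by (auto simp: F_def)
        moreover have "par G e m \<in> points R"
          unfolding pts using open_edgeI[OF m(3,4)] e(1) by (auto simp: points_def)
        ultimately obtain e' where e': "e' \<in> edges R" "par G e m \<in> open_edge R e'"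
          by (auto simp: points_def)
        note O = over[OF e'(1)]
        obtain u where u: "fa e' < u" "u < fa e' + len R e'" "par G e m = par G (fe e') u"
          using e'(2) O by auto
        have eu: "e = fe e'" "m = u" using uniq[of e "fe e'" m u] u O m e(1) by auto
        have "\<not> fa e' + len R e' < t"
        proof
          assume "fa e' + len R e' < t"
          then have "fa e' + len R e' \<in> F" using O u eu m by (auto simp: F_def)
          then show False using s(2) u eu m by force
        qed
        moreover have "\<not> fa e' + len R e' > t"
        proof
          assume "fa e' + len R e' > t"
          then have "par G e t \<in> open_edge R e'" using O u eu m by auto
          then show False using DR(8)[OF e'(1)] e(4) by blast
        qed
        ultimately show "z \<in> (\<lambda>e'. (fe e', fa e' + len R e')) ` edges R"
          using z eu e'(1) by force
      qed
    qed
  qed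
  then have cR: "card (edges R) = card S" by (rule bij_betw_same_card)
  have bS': "bij_betw (\<lambda>(e, t). par G e t) S' (verts R - verts G)"
    unfolding bij_betw_def
  proof
    show "inj_on (\<lambda>(e, t). par G e t) S'"
      using uniq by (auto simp: inj_on_def S'_def)
    show "(\<lambda>(e, t). par G e t) ` S' = verts R - verts G"
    proof
      show "(\<lambda>(e, t). par G e t) ` S' \<subseteq> verts R - verts G"
      proof
        fix P assume "P \<in> (\<lambda>(e, t). par G e t) ` S'"
        then obtain e t where "e \<in> edges G" "0 < t" "t < len G e" "par G e t \<in> verts R" "P = par G e t"
          by (auto simp: S'_def)
        moreover from this have "par G e t \<in> open_edge G e" by (auto simp: open_edge_def)
        ultimately show "P \<in> verts R - verts G" using DG(8) by blast
      qed
      show "verts R - verts G \<subseteq> (\<lambda>(e, t). par G e t) ` S'"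
      proof
        fix P assume P: "P \<in> verts R - verts G"
        then have "P \<in> points G" unfolding pts[symmetric] by (simp add: points_def)
        then obtain e t where "e \<in> edges G" "0 < t" "t < len G e" "P = par G e t"
          using P by (auto simp: points_def open_edge_def)
        then show "P \<in> (\<lambda>(e, t). par G e t) ` S'"
          using P by (auto simp: S'_def intro!: image_eqI[of _ _ "(e, t)"])
      qed
    qed
  qed
  have "card S' = card (verts R - verts G)" using bS' by (rule bij_betw_same_card)
  moreover have "finite S'" using bij_betw_finite[OF bS'] DR(1) by simp
  moreover have "S = (\<lambda>e. (e, len G e)) ` edges G \<union> S'"
    using DG(4) DG(6) VV by (auto simp: S_def S'_def tgt_def)
  moreover have "(\<lambda>e. (e, len G e)) ` edges G \<inter> S' = {}" by (auto simp: S'_def)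
  moreover have "card ((\<lambda>e. (e, len G e)) ` edges G) = card (edges G)"
    by (rule card_image) (auto simp: inj_on_def)
  ultimately have "card S = card (edges G) + card (verts R - verts G)"
    using DG(3) by (simp add: card_Un_disjoint)
  moreover have "card (verts R) = card (verts G) + card (verts R - verts G)"
    using VV DR(1) DG(1) by (simp add: card_Diff_subset card_mono)
  ultimately show ?thesis using cR by (simp add: genus_def)
qed

lemma model_of_points: "model_of G \<Gamma> \<Longrightarrow> points G = points \<Gamma>"
  by (auto simp: model_of_def refines_def)

lemma model_of_genus: "model_of G \<Gamma> \<Longrightarrow> tropical_curve \<Gamma> \<Longrightarrow> genus G = genus \<Gamma>"
  by (metis genus_refines model_of_def)

lemma model_of_refl: "tropical_curve G \<Longrightarrow> model_of G G"
  by (force simp: model_of_def refines_def)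

section \<open>Edges under a morphism of models\<close>

lemma edge_over_mem:
  assumes "edge_over G H \<phi> e e' s k" "0 < t" "t < len G e"
  shows "\<phi> (par G e t) = par H e' (if s then real k * t else len H e' - real k * t)"
    "0 < real k * t" "real k * t < len H e'" "\<phi> (par G e t) \<in> open_edge H e'"
proof -
  show eq: "\<phi> (par G e t) = par H e' (if s then real k * t else len H e' - real k * t)"
    using assms by (simp add: edge_over_def)
  show 1: "0 < real k * t" using assms by (simp add: edge_over_def)
  show 2: "real k * t < len H e'" using assms by (simp add: edge_over_def)
  show "\<phi> (par G e t) \<in> open_edge H e'" unfolding eq using 1 2 by (auto intro: open_edgeI)
qed

lemma edge_over_unique:
  assumes G: "tropical_curve G" and H: "tropical_curve H" and e: "e \<in> edges G"
    and o1: "edge_over G H \<phi> e e1 s1 k1" and o2: "edge_over G H \<phi> e e2 s2 k2"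
  shows "e1 = e2" "s1 = s2" "k1 = k2"
proof -
  note DG = tropical_curveD[OF G] and DH = tropical_curveD[OF H]
  have l: "0 < len G e" using DG(4) e .
  \<comment> \<open>One third rather than one half: the midpoint is fixed by reversal and would not
    reveal the orientation.\<close>
  have t: "0 < len G e / 3" "len G e / 3 < len G e" using l by auto
  note a = edge_over_mem[OF o1 t] and b = edge_over_mem[OF o2 t]
  have e': "e1 \<in> edges H" "e2 \<in> edges H" using o1 o2 by (auto simp: edge_over_def)
  show e12: "e1 = e2" using DH(9)[OF e'] a(4) b(4) by blast
  have "real k1 * len G e = real k2 * len G e" using o1 o2 e12 by (simp add: edge_over_def)
  then show k12: "k1 = k2" using l by simp
  have "(if s1 then real k1 * (len G e / 3) else len H e1 - real k1 * (len G e / 3)) =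
        (if s2 then real k1 * (len G e / 3) else len H e1 - real k1 * (len G e / 3))"
  proof (rule inj_onD[OF DH(7)[OF e'(1)]])
    show "par H e1 (if s1 then real k1 * (len G e / 3) else len H e1 - real k1 * (len G e / 3)) =
        par H e1 (if s2 then real k1 * (len G e / 3) else len H e1 - real k1 * (len G e / 3))"
      by (metis a(1) b(1) e12 k12)
  qed (use a(2,3) in auto)
  moreover have "len H e1 = real k1 * len G e" "real k1 * len G e > 0"
    using o1 l by (auto simp: edge_over_def)
  ultimately show "s1 = s2" by (auto split: if_splits)
qed

lemma edge_over_not_contracted:
  assumes G: "tropical_curve G" and H: "tropical_curve H" and e: "e \<in> edges G"
    and o1: "edge_over G H \<phi> e e' s k" and c: "edge_contracted G H \<phi> e"
  shows False
proof -
  have l: "0 < len G e" using tropical_curveD(4)[OF G e] .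
  then have t: "0 < len G e / 2" "len G e / 2 < len G e" by auto
  have "\<phi> (par G e (len G e / 2)) \<in> open_edge H e'" using edge_over_mem(4)[OF o1 t] .
  moreover have "\<phi> (par G e (len G e / 2)) \<in> verts H"
    using c l by (auto simp: edge_contracted_def)
  moreover have "e' \<in> edges H" using o1 by (simp add: edge_over_def)
  ultimately show False using tropical_curveD(8)[OF H] by blast
qed

lemma slope_over:
  assumes "tropical_curve G" "tropical_curve H" "e \<in> edges G" "edge_over G H \<phi> e e' s k"
  shows "slope G H \<phi> e = k"
  unfolding slope_def
proof (rule the_equality)
  show "(\<exists>e' s. edge_over G H \<phi> e e' s k) \<or> k = 0 \<and> edge_contracted G H \<phi> e"
    using assms(4) by blast
  fix k' assume "(\<exists>e' s. edge_over G H \<phi> e e' s k') \<or> k' = 0 \<and> edge_contracted G H \<phi> e"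
  then show "k' = k"
    using edge_over_unique(3)[OF assms(1-3) _ assms(4)] edge_over_not_contracted[OF assms] by blast
qed

lemma edge_sign_over:
  assumes "tropical_curve G" "tropical_curve H" "e \<in> edges G" "edge_over G H \<phi> e e' s k"
  shows "edge_sign G H \<phi> e e1 = (if e1 = e' then if s then 1 else - 1 else 0)"
proof -
  have iff: "(\<exists>k. edge_over G H \<phi> e e1 s' k) \<longleftrightarrow> e1 = e' \<and> s' = s" for s'
    using edge_over_unique(1,2)[OF assms(1-3) _ assms(4)] assms(4) by blast
  show ?thesis unfolding edge_sign_def iff by auto
qed

lemma edge_sign_contracted:
  assumes "tropical_curve G" "tropical_curve H" "e \<in> edges G" "edge_contracted G H \<phi> e"
  shows "edge_sign G H \<phi> e e1 = 0"
  using edge_over_not_contracted[OF assms(1-3) _ assms(4)]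
  unfolding edge_sign_def by auto

subsection \<open>Tangent directions\<close>

lemma finite_tangents:
  assumes G: "tropical_curve G"
  shows "finite (tangents G P)"
proof -
  note D = tropical_curveD[OF G]
  have "finite {t \<in> {0<..<len G e}. par G e t = P}" if "e \<in> edges G" for e
  proof -
    have "par G e ` {t \<in> {0<..<len G e}. par G e t = P} \<subseteq> {P}" by auto
    moreover have "inj_on (par G e) {t \<in> {0<..<len G e}. par G e t = P}"
      by (rule inj_on_subset[OF D(7)[OF that]]) auto
    ultimately show ?thesis by (meson finite.emptyI finite.insertI finite_imageD finite_subset)
  qed
  then have "finite (\<Union>e\<in>edges G. {e} \<times> (({0, len G e} \<union> {t \<in> {0<..<len G e}. par G e t = P}) \<times> (UNIV :: bool set)))"
    using D(3) by auto
  then show ?thesis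
    by (rule rev_finite_subset) (auto simp: tangents_def)
qed

lemma tangents_vertex:
  assumes G: "tropical_curve G" and v: "v \<in> verts G"
  shows "tangents G v =
    (\<lambda>e. (e, 0, True)) ` {e \<in> edges G. src G e = v} \<union>
    (\<lambda>e. (e, len G e, False)) ` {e \<in> edges G. tgt G e = v}"
proof -
  note D = tropical_curveD[OF G]
  have "\<not> (0 < t \<and> t < len G e)" if "e \<in> edges G" "par G e t = v" for e t
    using open_edgeI[of t G e] D(8)[OF that(1)] that v by auto
  then show ?thesis
    using D(4) by (fastforce simp: tangents_def src_def tgt_def split: if_splits)
qed

lemma sum_tangents_vertex:
  assumes G: "tropical_curve G" and v: "v \<in> verts G"
  shows "(\<Sum>\<tau>\<in>tangents G v. g \<tau>) =
    (\<Sum>e\<in>edges G. (if src G e = v then g (e, 0, True) else 0) +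
                   (if tgt G e = v then g (e, len G e, False) else 0))"
proof -
  have fin: "finite (edges G)" using tropical_curveD(3)[OF G] .
  have "(\<Sum>\<tau>\<in>tangents G v. g \<tau>) =
      (\<Sum>\<tau>\<in>(\<lambda>e. (e, 0, True)) ` {e \<in> edges G. src G e = v}. g \<tau>) +
      (\<Sum>\<tau>\<in>(\<lambda>e. (e, len G e, False)) ` {e \<in> edges G. tgt G e = v}. g \<tau>)"
    unfolding tangents_vertex[OF assms] using fin by (intro sum.union_disjoint) auto
  also have "\<dots> = (\<Sum>e\<in>{e \<in> edges G. src G e = v}. g (e, 0, True)) +
      (\<Sum>e\<in>{e \<in> edges G. tgt G e = v}. g (e, len G e, False))"
    by (subst (1 2) sum.reindex) (auto simp: inj_on_def)
  finally show ?thesis using fin by (simp add: sum.inter_filter sum.distrib)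
qed

text \<open>Rewrites the boundary as a sum of outgoing values over tangent directions, where the two
  directions of a loop cancel. Local degrees are also counted over directions, so harmonicity can be
  applied to this sum.\<close>

lemma boundary_tangents:
  assumes G: "tropical_curve G" and v: "v \<in> verts G"
  shows "(\<Sum>(e, t, s)\<in>tangents G v. if s then a e else - a e) = - boundary G a v"
proof -
  have "(\<Sum>(e, t, s)\<in>tangents G v. if s then a e else - a e) =
     (\<Sum>e\<in>edges G. - (a e * ((if tgt G e = v then 1 else 0) - (if src G e = v then 1 else 0))))"
    unfolding sum_tangents_vertex[OF assms] by (intro sum.cong) auto
  then show ?thesis by (simp add: boundary_def sum_negf)
qed

section \<open>Push-forward and pull-back for a harmonic morphism\<close>

text \<open>The content of \<open>has_degree\<close> for one fixed pair of models, which is all that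
  the edgewise arguments use.\<close>

definition fibre_degree :: "'p mgraph \<Rightarrow> 'q mgraph \<Rightarrow> ('p \<Rightarrow> 'q) \<Rightarrow> nat \<Rightarrow> bool" where
  "fibre_degree G H \<phi> d \<longleftrightarrow> (\<forall>Q\<in>points H. \<forall>w\<in>tangents H Q.
     (\<Sum>P | P \<in> points G \<and> \<phi> P = Q \<and> local_degree G H \<phi> P w \<noteq> 0. local_degree G H \<phi> P w) = d)"

lemma has_degree_fibre_degree:
  assumes "has_degree \<Gamma> \<Delta> \<phi> d" "model_of G \<Gamma>" "model_of H \<Delta>" "harmonic_on G H \<phi>"
  shows "fibre_degree G H \<phi> d"
  using assms unfolding has_degree_def fibre_degree_def by blast

locale cover_model =
  fixes G :: "'p mgraph" and H :: "'q mgraph" and \<phi> :: "'p \<Rightarrow> 'q"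
  assumes G: "tropical_curve G" and H: "tropical_curve H" and harm: "harmonic_on G H \<phi>"
begin

lemmas DG = tropical_curveD[OF G]
lemmas DH = tropical_curveD[OF H]

lemmas over_unique = edge_over_unique[OF G H]
lemmas over_slope = slope_over[OF G H]
lemmas over_sign = edge_sign_over[OF G H]
lemmas contracted_sign = edge_sign_contracted[OF G H]

lemma edge_cases:
  assumes "e \<in> edges G"
  obtains (over) e' s k where "edge_over G H \<phi> e e' s k" "e' \<in> edges H"
  | (contracted) "edge_contracted G H \<phi> e"
proof -
  have "(\<exists>e' s k. edge_over G H \<phi> e e' s k) \<or> edge_contracted G H \<phi> e"
    using harm assms by (simp add: harmonic_on_def)
  then show ?thesis using over contracted by (auto simp: edge_over_def)
qed

lemma phi_vert: "v \<in> verts G \<Longrightarrow> \<phi> v \<in> verts H"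
  using harm by (auto simp: harmonic_on_def)

text \<open>The dual form of the fact that push-forward commutes with the boundary. Along a
  contracted edge both sides are 0.\<close>

lemma edge_sign_potential:
  fixes p :: "'q \<Rightarrow> int"
  assumes e: "e \<in> edges G"
  shows "(\<Sum>e'\<in>edges H. edge_sign G H \<phi> e e' * (p (tgt H e') - p (src H e'))) =
    p (\<phi> (tgt G e)) - p (\<phi> (src G e))"
proof -
  have l: "0 < len G e" using DG(4) e .
  show ?thesis
    using e
  proof (cases rule: edge_cases)
    case (over e' s k)
    have st: "\<phi> (src G e) = (if s then src H e' else tgt H e')"
      "\<phi> (tgt G e) = (if s then tgt H e' else src H e')"
      using over(1) l by (auto simp: edge_over_def src_def tgt_def)
    have "(\<Sum>e'\<in>edges H. edge_sign G H \<phi> e e' * (p (tgt H e') - p (src H e'))) =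
       (\<Sum>e1\<in>edges H. if e1 = e' then (if s then 1 else - 1) * (p (tgt H e') - p (src H e')) else 0)"
      by (intro sum.cong) (auto simp: over_sign[OF e over(1)])
    then show ?thesis using st over(2) DH(3) by simp
  next
    case contracted
    then obtain w where w: "\<forall>t\<in>{0..len G e}. \<phi> (par G e t) = w" by (auto simp: edge_contracted_def)
    then have "\<phi> (tgt G e) = w" "\<phi> (src G e) = w" using l by (auto simp: src_def tgt_def)
    then show ?thesis by (simp add: contracted_sign[OF e contracted])
  qed
qed

lemma pushforward_closed:
  assumes a: "a \<in> carrier (cycles G)"
  shows "pushforward_cycle G H \<phi> a \<in> carrier (cycles H)"
  unfolding cycles_iff
proof (intro conjI allI impI ballI)
  fix w assume "w \<in> verts H"
  \<comment> \<open>Pairing with the coboundary of the indicator of \<open>w\<close> extracts the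
    boundary at \<open>w\<close>.\<close>
  define p :: "'q \<Rightarrow> int" where "p v = (if v = w then 1 else 0)" for v
  have "boundary H (pushforward_cycle G H \<phi> a) w =
      (\<Sum>e'\<in>edges H. (\<Sum>e\<in>edges G. edge_sign G H \<phi> e e' * a e) * (p (tgt H e') - p (src H e')))"
    unfolding boundary_def pushforward_cycle_def p_def by (intro sum.cong) auto
  also have "\<dots> = (\<Sum>e'\<in>edges H. \<Sum>e\<in>edges G.
      a e * (edge_sign G H \<phi> e e' * (p (tgt H e') - p (src H e'))))"
    unfolding sum_distrib_right by (intro sum.cong refl) (simp add: mult_ac)
  also have "\<dots> = (\<Sum>e\<in>edges G. a e *
      (\<Sum>e'\<in>edges H. edge_sign G H \<phi> e e' * (p (tgt H e') - p (src H e'))))"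
    by (subst sum.swap) (simp add: sum_distrib_left)
  also have "\<dots> = (\<Sum>e\<in>edges G. a e * (p (\<phi> (tgt G e)) - p (\<phi> (src G e))))"
    by (intro sum.cong) (auto simp: edge_sign_potential)
  also have "\<dots> = (\<Sum>v\<in>verts G. p (\<phi> v) * boundary G a v)"
    by (rule sum_potential_boundary[OF G, symmetric])
  also have "\<dots> = 0" using a by (simp add: cycles_iff)
  finally show "boundary H (pushforward_cycle G H \<phi> a) w = 0" .
qed (simp add: pushforward_cycle_def)

text \<open>A direction along a contracted edge lies over no direction of \<open>H\<close>, and any
  other lies over exactly one, so at most one summand survives; it is the outgoing value of the
  pulled-back form.\<close>

lemma tangent_sum_over:
  fixes \<omega> :: "nat \<Rightarrow> int"
  assumes \<tau>: "(e, t, s) \<in> tangents G P"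
  shows "(\<Sum>w\<in>tangents H (\<phi> P). if tangent_over G H \<phi> (e, t, s) w
      then int (slope G H \<phi> e) * (if snd (snd w) then \<omega> (fst w) else - \<omega> (fst w)) else 0) =
    (if s then pullback_form G H \<phi> \<omega> e else - pullback_form G H \<phi> \<omega> e)"
proof -
  have e: "e \<in> edges G" and t: "0 \<le> t" "t \<le> len G e" "par G e t = P"
    and ts: "if s then t < len G e else 0 < t"
    using \<tau> by (auto simp: tangents_def)
  show ?thesis
    using e
  proof (cases rule: edge_cases)
    case (over e1 r k)
    define t1 where "t1 = (if r then real k * t else len H e1 - real k * t)"
    define w where "w = (e1, t1, s = r)"
    have k: "k > 0" "len H e1 = real k * len G e" "\<phi> P = par H e1 t1"
      using over(1) t by (auto simp: edge_over_def t1_def)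
    have kt: "0 \<le> real k * t" "real k * t \<le> len H e1"
      using k t by (auto intro: mult_left_mono)
    have kt': "real k * t < len H e1 \<longleftrightarrow> t < len G e" "0 < real k * t \<longleftrightarrow> 0 < t"
      using k by (auto simp: zero_less_mult_iff)
    have w: "w \<in> tangents H (\<phi> P)"
      using over(2) k(3) kt kt' ts unfolding w_def tangents_def t1_def by (cases r; cases s) auto
    have iff: "tangent_over G H \<phi> (e, t, s) w' \<longleftrightarrow> w' = w" for w'
    proof
      assume *: "tangent_over G H \<phi> (e, t, s) w'"
      obtain e' t' s' where w': "w' = (e', t', s')" by (cases w')
      obtain r' k' where o': "edge_over G H \<phi> e e' r' k'"
        and t': "t' = (if r' then real k' * t else len H e' - real k' * t)" "s' = (s = r')"
        using * unfolding w' tangent_over.simps by blast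
      show "w' = w"
        using over_unique[OF e o' over(1)] t' unfolding w' w_def t1_def by simp
    next
      assume w': "w' = w"
      show "tangent_over G H \<phi> (e, t, s) w'"
        using over(1) unfolding w' w_def t1_def tangent_over.simps by blast
    qed
    have "(\<Sum>w\<in>tangents H (\<phi> P). if tangent_over G H \<phi> (e, t, s) w
        then int (slope G H \<phi> e) * (if snd (snd w) then \<omega> (fst w) else - \<omega> (fst w)) else 0) =
      (\<Sum>w'\<in>tangents H (\<phi> P). if w' = w
        then int k * (if s = r then \<omega> e1 else - \<omega> e1) else 0)"
      unfolding iff over_slope[OF e over(1)] by (intro sum.cong refl if_cong) (simp_all add: w_def)
    also have "\<dots> = int k * (if s = r then \<omega> e1 else - \<omega> e1)"
      using w finite_tangents[OF H] by simp
    also have "\<dots> = (if s then pullback_form G H \<phi> \<omega> e else - pullback_form G H \<phi> \<omega> e)"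
    proof -
      have "(\<Sum>e'\<in>edges H. edge_sign G H \<phi> e e' * \<omega> e') =
          (\<Sum>e'\<in>edges H. if e' = e1 then (if r then 1 else - 1) * \<omega> e1 else 0)"
        by (intro sum.cong) (auto simp: over_sign[OF e over(1)])
      also have "\<dots> = (if r then 1 else - 1) * \<omega> e1" using over(2) DH(3) by simp
      finally show ?thesis
        using e by (auto simp: pullback_form_def over_slope[OF e over(1)])
    qed
    finally show ?thesis .
  next
    case contracted
    then have no: "\<not> edge_over G H \<phi> e e' r k" for e' r k
      using edge_over_not_contracted[OF G H e] by blast
    have "pullback_form G H \<phi> \<omega> e = 0"
      by (simp add: pullback_form_def contracted_sign[OF e contracted])
    moreover have "\<not> tangent_over G H \<phi> (e, t, s) w" for w
      using no by (cases w) simp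
    ultimately show ?thesis by simp
  qed
qed

text \<open>Sorts the outgoing values at \<open>v\<close> by the direction below. By harmonicity all
  these directions have the same local degree, which factors out and leaves a multiple of the
  boundary of \<open>\<omega>\<close> at \<open>\<phi> v\<close>.\<close>

lemma pullback_closed:
  assumes \<omega>: "\<omega> \<in> carrier (cycles H)"
  shows "pullback_form G H \<phi> \<omega> \<in> carrier (cycles G)"
  unfolding cycles_iff
proof (intro conjI allI impI ballI)
  fix v assume v: "v \<in> verts G"
  have vP: "v \<in> points G" using v by (simp add: points_def)
  define dg where "dg = local_degree G H \<phi> v"
  have const: "dg w = dg w'" if "w \<in> tangents H (\<phi> v)" "w' \<in> tangents H (\<phi> v)" for w w'
    using harm vP that unfolding harmonic_on_def dg_def by blast
  have "- boundary G (pullback_form G H \<phi> \<omega>) v =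
      (\<Sum>(e, t, s)\<in>tangents G v. if s then pullback_form G H \<phi> \<omega> e else - pullback_form G H \<phi> \<omega> e)"
    by (rule boundary_tangents[OF G v, symmetric])
  also have "\<dots> = (\<Sum>\<tau>\<in>tangents G v. \<Sum>w\<in>tangents H (\<phi> v). if tangent_over G H \<phi> \<tau> w
      then int (slope G H \<phi> (fst \<tau>)) * (if snd (snd w) then \<omega> (fst w) else - \<omega> (fst w)) else 0)"
  proof (intro sum.cong refl)
    fix \<tau> assume "\<tau> \<in> tangents G v"
    then show "(case \<tau> of (e, t, s) \<Rightarrow> if s then pullback_form G H \<phi> \<omega> e else - pullback_form G H \<phi> \<omega> e) =
       (\<Sum>w\<in>tangents H (\<phi> v). if tangent_over G H \<phi> \<tau> w
      then int (slope G H \<phi> (fst \<tau>)) * (if snd (snd w) then \<omega> (fst w) else - \<omega> (fst w)) else 0)"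
      using tangent_sum_over[of "fst \<tau>" "fst (snd \<tau>)" "snd (snd \<tau>)" v \<omega>]
      by (simp add: case_prod_beta del: tangent_over.simps)
  qed
  also have "\<dots> = (\<Sum>w\<in>tangents H (\<phi> v). \<Sum>\<tau>\<in>tangents G v. if tangent_over G H \<phi> \<tau> w
      then int (slope G H \<phi> (fst \<tau>)) * (if snd (snd w) then \<omega> (fst w) else - \<omega> (fst w)) else 0)"
    by (rule sum.swap)
  also have "\<dots> = (\<Sum>w\<in>tangents H (\<phi> v). int (dg w) * (if snd (snd w) then \<omega> (fst w) else - \<omega> (fst w)))"
  proof (intro sum.cong refl)
    fix w
    have dgw: "int (dg w) = (\<Sum>\<tau>\<in>tangents G v. if tangent_over G H \<phi> \<tau> w then int (slope G H \<phi> (fst \<tau>)) else 0)"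
      using finite_tangents[OF G, of v] unfolding dg_def local_degree_def
      by (simp add: sum.inter_filter) (rule sum.cong, auto)
    show "(\<Sum>\<tau>\<in>tangents G v. if tangent_over G H \<phi> \<tau> w
      then int (slope G H \<phi> (fst \<tau>)) * (if snd (snd w) then \<omega> (fst w) else - \<omega> (fst w)) else 0) =
      int (dg w) * (if snd (snd w) then \<omega> (fst w) else - \<omega> (fst w))"
      unfolding dgw sum_distrib_right by (intro sum.cong refl) simp
  qed
  also have "\<dots> = 0"
  proof (cases "tangents H (\<phi> v) = {}")
    case False
    then obtain w0 where w0: "w0 \<in> tangents H (\<phi> v)" by blast
    have "(\<Sum>w\<in>tangents H (\<phi> v). int (dg w) * (if snd (snd w) then \<omega> (fst w) else - \<omega> (fst w))) =
       int (dg w0) * (\<Sum>(e, t, s)\<in>tangents H (\<phi> v). if s then \<omega> e else - \<omega> e)"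
      unfolding sum_distrib_left using const[OF _ w0]
      by (intro sum.cong refl) (auto simp: case_prod_beta)
    also have "(\<Sum>(e, t, s)\<in>tangents H (\<phi> v). if s then \<omega> e else - \<omega> e) = - boundary H \<omega> (\<phi> v)"
      by (rule boundary_tangents[OF H phi_vert[OF v]])
    also have "boundary H \<omega> (\<phi> v) = 0" using \<omega> phi_vert[OF v] by (simp add: cycles_iff)
    finally show ?thesis by simp
  qed simp
  finally show "boundary G (pullback_form G H \<phi> \<omega>) v = 0" by simp
qed (simp add: pullback_form_def)

lemma sum_sign_over:
  fixes x :: "nat \<Rightarrow> int"
  assumes "e \<in> edges G" "edge_over G H \<phi> e e' s k"
  shows "(\<Sum>e''\<in>edges H. edge_sign G H \<phi> e e'' * x e'') = (if s then x e' else - x e')"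
proof -
  have "(\<Sum>e''\<in>edges H. edge_sign G H \<phi> e e'' * x e'') =
     (\<Sum>e''\<in>edges H. if e'' = e' then if s then x e' else - x e' else 0)"
    by (intro sum.cong) (auto simp: over_sign[OF assms])
  moreover have "e' \<in> edges H" using assms by (simp add: edge_over_def)
  ultimately show ?thesis using DH(3) by simp
qed

text \<open>The degree is read off over the midpoint of \<open>e'\<close>: the points above it of
  non-zero local degree are the midpoints of the edges over \<open>e'\<close>, and each has a single
  direction over \<open>w\<close>.\<close>

lemma sum_slopes:
  assumes deg: "fibre_degree G H \<phi> d"
    and e': "e' \<in> edges H"
  shows "(\<Sum>e | e \<in> edges G \<and> (\<exists>s k. edge_over G H \<phi> e e' s k). slope G H \<phi> e) = d"
proof -
  define m where "m e = par G e (len G e / 2)" for e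
  define Q where "Q = par H e' (len H e' / 2)"
  define w where "w = (e', len H e' / 2, True)"
  have l': "0 < len H e'" using DH(4) e' .
  have mo: "m e \<in> open_edge G e" if "e \<in> edges G" for e
    using DG(4)[OF that] by (auto simp: m_def intro: open_edgeI)
  have Q: "Q \<in> open_edge H e'" using l' by (auto simp: Q_def intro: open_edgeI)
  have w: "w \<in> tangents H Q" using l' e' by (auto simp: w_def Q_def tangents_def)
  have m_inj: "e = e1" if "e \<in> edges G" "e1 \<in> edges G" "m e = m e1" for e e1
    using DG(9)[OF that(1,2)] mo that by force
  \<comment> \<open>An affine map of one edge onto another preserves midpoints under either
    orientation, which is why midpoints serve as test points.\<close>
  have half: "t = len G e / 2 \<and> s = r" if "edge_over G H \<phi> e e' r k"
    "len H e' / 2 = (if r then real k * t else len H e' - real k * t)" "True = (s = r)" for e t s r k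
  proof -
    have "real k * t = real k * (len G e / 2)" "k > 0"
      using that by (auto simp: edge_over_def split: if_splits)
    then show ?thesis using that by simp
  qed
  have dirs: "{\<tau> \<in> tangents G (m e). tangent_over G H \<phi> \<tau> w} = {(e, len G e / 2, r)}"
    if e: "e \<in> edges G" "edge_over G H \<phi> e e' r k" for e r k
  proof -
    have l: "0 < len G e" using DG(4) e(1) .
    have "\<tau> = (e, len G e / 2, r)" if \<tau>: "\<tau> \<in> tangents G (m e)" "tangent_over G H \<phi> \<tau> w" for \<tau>
    proof -
      obtain e1 t1 s1 where tau: "\<tau> = (e1, t1, s1)" by (cases \<tau>)
      obtain r1 k1 where r1: "edge_over G H \<phi> e1 e' r1 k1"
        "len H e' / 2 = (if r1 then real k1 * t1 else len H e' - real k1 * t1)" "True = (s1 = r1)"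
        using \<tau>(2) by (auto simp: tau w_def)
      have e1: "e1 \<in> edges G" "par G e1 t1 = m e" using \<tau>(1) by (auto simp: tau tangents_def)
      have h: "t1 = len G e1 / 2" "s1 = r1" using half[OF r1] by auto
      have "m e1 = m e" using e1(2) unfolding h(1) m_def .
      then have "e1 = e" using m_inj[OF e1(1) e(1)] by blast
      moreover from this have "r1 = r" using over_unique(2)[OF e(1) _ e(2)] r1(1) by blast
      ultimately show ?thesis using h by (simp add: tau)
    qed
    moreover have "(e, len G e / 2, r) \<in> tangents G (m e)" using l e(1) by (auto simp: tangents_def m_def)
    moreover have "tangent_over G H \<phi> (e, len G e / 2, r) w"
      using e(2) by (auto simp: w_def edge_over_def intro!: exI[of _ r] exI[of _ k])
    ultimately show ?thesis by blast
  qed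
  have ld: "local_degree G H \<phi> (m e) w = slope G H \<phi> e \<and> slope G H \<phi> e \<noteq> 0 \<and> \<phi> (m e) = Q"
    if e: "e \<in> edges G" "edge_over G H \<phi> e e' r k" for e r k
  proof -
    have l: "0 < len G e" using DG(4) e(1) .
    have "\<phi> (m e) = Q" using e(2) l by (auto simp: edge_over_def m_def Q_def)
    moreover have "k > 0" using e(2) by (simp add: edge_over_def)
    ultimately show ?thesis
      unfolding local_degree_def dirs[OF e] by (simp add: over_slope[OF e])
  qed
  have ms: "{P. P \<in> points G \<and> \<phi> P = Q \<and> local_degree G H \<phi> P w \<noteq> 0} =
      m ` {e \<in> edges G. \<exists>s k. edge_over G H \<phi> e e' s k}"
  proof
    show "m ` {e \<in> edges G. \<exists>s k. edge_over G H \<phi> e e' s k} \<subseteq>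
        {P. P \<in> points G \<and> \<phi> P = Q \<and> local_degree G H \<phi> P w \<noteq> 0}"
      using mo ld by (fastforce simp: points_def)
    show "{P. P \<in> points G \<and> \<phi> P = Q \<and> local_degree G H \<phi> P w \<noteq> 0} \<subseteq>
        m ` {e \<in> edges G. \<exists>s k. edge_over G H \<phi> e e' s k}"
    proof
      fix P assume "P \<in> {P. P \<in> points G \<and> \<phi> P = Q \<and> local_degree G H \<phi> P w \<noteq> 0}"
      then have "local_degree G H \<phi> P w \<noteq> 0" by simp
      then have "{\<tau> \<in> tangents G P. tangent_over G H \<phi> \<tau> w} \<noteq> {}"
        unfolding local_degree_def by (metis sum.empty)
      then obtain \<tau> where \<tau>: "\<tau> \<in> tangents G P" "tangent_over G H \<phi> \<tau> w" by blast
      obtain e1 t1 s1 where tau: "\<tau> = (e1, t1, s1)" by (cases \<tau>)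
      obtain r1 k1 where r1: "edge_over G H \<phi> e1 e' r1 k1"
        "len H e' / 2 = (if r1 then real k1 * t1 else len H e' - real k1 * t1)" "True = (s1 = r1)"
        using \<tau>(2) by (auto simp: tau w_def)
      have "e1 \<in> edges G" "par G e1 t1 = P" using \<tau>(1) by (auto simp: tau tangents_def)
      moreover have "t1 = len G e1 / 2" using half[OF r1] by auto
      ultimately show "P \<in> m ` {e \<in> edges G. \<exists>s k. edge_over G H \<phi> e e' s k}"
        using r1(1) by (auto simp: m_def)
    qed
  qed
  have "Q \<in> points H" using Q e' by (auto simp: points_def)
  then have "d = (\<Sum>P | P \<in> points G \<and> \<phi> P = Q \<and> local_degree G H \<phi> P w \<noteq> 0. local_degree G H \<phi> P w)"
    using deg w by (simp add: fibre_degree_def)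
  also have "\<dots> = (\<Sum>e\<in>{e \<in> edges G. \<exists>s k. edge_over G H \<phi> e e' s k}. local_degree G H \<phi> (m e) w)"
    unfolding ms using m_inj by (subst sum.reindex) (auto simp: inj_on_def)
  also have "\<dots> = (\<Sum>e\<in>{e \<in> edges G. \<exists>s k. edge_over G H \<phi> e e' s k}. slope G H \<phi> e)"
    using ld by (intro sum.cong) auto
  finally show ?thesis by simp
qed

text \<open>Evaluates surjectivity of \<open>\<phi>\<close> at the midpoint of \<open>e'\<close>. It
  is no vertex, so its preimage lies inside an edge that is not contracted.\<close>

lemma edge_hit:
  assumes e': "e' \<in> edges H"
  shows "\<exists>e\<in>edges G. \<exists>s k. edge_over G H \<phi> e e' s k"
proof -
  have l': "0 < len H e'" using DH(4) e' .
  define Q where "Q = par H e' (len H e' / 2)"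
  have Q: "Q \<in> open_edge H e'" using l' by (auto simp: Q_def intro: open_edgeI)
  then have "Q \<in> \<phi> ` points G" using harm e' by (auto simp: harmonic_on_def points_def)
  then obtain P where P: "P \<in> points G" "\<phi> P = Q" by blast
  have Qv: "Q \<notin> verts H" using Q DH(8)[OF e'] by blast
  then have "P \<notin> verts G" using P phi_vert by blast
  then obtain e t where e: "e \<in> edges G" "0 < t" "t < len G e" "P = par G e t"
    using P(1) by (auto simp: points_def open_edge_def)
  from e(1) show ?thesis
  proof (cases rule: edge_cases)
    case (over e1 s k)
    have "Q \<in> open_edge H e1" using edge_over_mem(4)[OF over(1) e(2,3)] e(4) P(2) by simp
    then have "e1 = e'" using Q DH(9)[OF over(2) e'] by blast
    then show ?thesis using over(1) e(1) by blast
  next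
    case contracted
    then have "Q \<in> verts H" using e P by (auto simp: edge_contracted_def)
    then show ?thesis using Qv by blast
  qed
qed

text \<open>The signs occur twice and cancel, which leaves the sum of the slopes over each edge,
  that is \<open>d\<close>.\<close>

lemma pushforward_pullback:
  assumes deg: "fibre_degree G H \<phi> d"
    and \<omega>: "\<omega> \<in> carrier (cycles H)"
  shows "pushforward_cycle G H \<phi> (pullback_form G H \<phi> \<omega>) = (\<lambda>e. int d * \<omega> e)"
proof
  fix e'
  show "pushforward_cycle G H \<phi> (pullback_form G H \<phi> \<omega>) e' = int d * \<omega> e'"
  proof (cases "e' \<in> edges H")
    case False
    then show ?thesis using \<omega> by (simp add: pushforward_cycle_def cycles_iff)
  next
    case True
    have "edge_sign G H \<phi> e e' * pullback_form G H \<phi> \<omega> e =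
        (if \<exists>s k. edge_over G H \<phi> e e' s k then int (slope G H \<phi> e) * \<omega> e' else 0)"
      if e: "e \<in> edges G" for e
    proof (cases "\<exists>s k. edge_over G H \<phi> e e' s k")
      case False
      then show ?thesis by (auto simp: edge_sign_def)
    next
      case True
      then obtain s k where o: "edge_over G H \<phi> e e' s k" by blast
      have "pullback_form G H \<phi> \<omega> e = int (slope G H \<phi> e) * (if s then \<omega> e' else - \<omega> e')"
        using e by (simp add: pullback_form_def sum_sign_over[OF e o])
      then show ?thesis
        using True by (simp add: over_sign[OF e o])
    qed
    then have "pushforward_cycle G H \<phi> (pullback_form G H \<phi> \<omega>) e' =
       (\<Sum>e\<in>edges G. if \<exists>s k. edge_over G H \<phi> e e' s k then int (slope G H \<phi> e) * \<omega> e' else 0)"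
      using True by (simp add: pushforward_cycle_def)
    also have "\<dots> = (\<Sum>e | e \<in> edges G \<and> (\<exists>s k. edge_over G H \<phi> e e' s k). int (slope G H \<phi> e) * \<omega> e')"
      using DG(3) by (simp add: sum.inter_filter)
    also have "\<dots> = int (\<Sum>e | e \<in> edges G \<and> (\<exists>s k. edge_over G H \<phi> e e' s k). slope G H \<phi> e) * \<omega> e'"
      by (simp add: sum_distrib_right)
    finally show ?thesis using sum_slopes[OF deg True] by simp
  qed
qed

lemma degree_pos:
  assumes deg: "fibre_degree G H \<phi> d"
    and "edges H \<noteq> {}"
  shows "d > 0"
proof -
  obtain e' where e': "e' \<in> edges H" using assms by blast
  obtain e s k where e: "e \<in> edges G" "edge_over G H \<phi> e e' s k" using edge_hit[OF e'] by blast
  have "0 < slope G H \<phi> e" using over_slope[OF e] e(2) by (simp add: edge_over_def)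
  also have "\<dots> \<le> (\<Sum>e | e \<in> edges G \<and> (\<exists>s k. edge_over G H \<phi> e e' s k). slope G H \<phi> e)"
    using e DG(3) by (intro member_le_sum) auto
  finally show ?thesis using sum_slopes[OF deg e'] by simp
qed

text \<open>An edge over \<open>e'\<close> with slope \<open>k\<close> has length
  \<open>len H e'\<close> divided by \<open>k\<close>; the slope in the pull-back makes up for this
  change of length.\<close>

lemma adjoint:
  "pairing (Jac G) (pullback_form G H \<phi> \<omega>) a = pairing (Jac H) \<omega> (pushforward_cycle G H \<phi> a)"
proof -
  have "pairing (Jac H) \<omega> (pushforward_cycle G H \<phi> a) =
      (\<Sum>e'\<in>edges H. \<Sum>e\<in>edges G. of_int (\<omega> e' * edge_sign G H \<phi> e e' * a e) * len H e')"
    unfolding Jac_def pushforward_cycle_def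
    by (auto intro!: sum.cong simp: sum_distrib_left sum_distrib_right mult_ac)
  also have "\<dots> = (\<Sum>e\<in>edges G. \<Sum>e'\<in>edges H. of_int (\<omega> e' * edge_sign G H \<phi> e e' * a e) * len H e')"
    by (rule sum.swap)
  also have "\<dots> = (\<Sum>e\<in>edges G. \<Sum>e'\<in>edges H.
      of_int (int (slope G H \<phi> e) * (edge_sign G H \<phi> e e' * \<omega> e') * a e) * len G e)"
  proof (intro sum.cong refl)
    fix e e' assume e: "e \<in> edges G" "e' \<in> edges H"
    show "of_int (\<omega> e' * edge_sign G H \<phi> e e' * a e) * len H e' =
      of_int (int (slope G H \<phi> e) * (edge_sign G H \<phi> e e' * \<omega> e') * a e) * len G e"
    proof (cases "\<exists>s k. edge_over G H \<phi> e e' s k")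
      case True
      then obtain s k where o: "edge_over G H \<phi> e e' s k" by blast
      then have "len H e' = real k * len G e" by (simp add: edge_over_def)
      then show ?thesis by (simp add: over_slope[OF e(1) o])
    next
      case False
      then have "edge_sign G H \<phi> e e' = 0" by (auto simp: edge_sign_def)
      then show ?thesis by simp
    qed
  qed
  also have "\<dots> = pairing (Jac G) (pullback_form G H \<phi> \<omega>) a"
    unfolding Jac_def pullback_form_def
    by (auto intro!: sum.cong simp: sum_distrib_left sum_distrib_right mult_ac)
  finally show ?thesis by simp
qed

end

section \<open>Maps defined edge by edge\<close>

lemma par_points:
  assumes G: "tropical_curve G" and "e \<in> edges G" "0 \<le> t" "t \<le> len G e"
  shows "par G e t \<in> points G"
proof (cases "t = 0 \<or> t = len G e")
  case True
  then show ?thesis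
    using tropical_curveD(5,6)[OF G assms(2)] by (auto simp: points_def src_def tgt_def)
next
  case False
  then show ?thesis using assms open_edgeI[of t G e] by (auto simp: points_def)
qed

lemma par_vertex:
  assumes G: "tropical_curve G" and "e \<in> edges G" "0 \<le> t" "t \<le> len G e" "par G e t \<in> verts G"
  shows "t = 0 \<or> t = len G e"
  using assms open_edgeI[of t G e] tropical_curveD(8)[OF G assms(2)] by force

text \<open>An interior point has one edge and one parameter, so the formulas on the edges can clash
  only at vertices, where both hypotheses prescribe the value \<open>g0\<close>.\<close>

lemma glue_edges:
  assumes G: "tropical_curve G"
    and g: "\<And>e. e \<in> edges G \<Longrightarrow> g e 0 = g0 (src G e)"
      "\<And>e. e \<in> edges G \<Longrightarrow> g e (len G e) = g0 (tgt G e)"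
  shows "\<exists>\<phi>. (\<forall>v\<in>verts G. \<phi> v = g0 v) \<and> (\<forall>e\<in>edges G. \<forall>t\<in>{0..len G e}. \<phi> (par G e t) = g e t)"
proof -
  define Q where "Q P z \<longleftrightarrow> fst z \<in> edges G \<and> 0 < snd z \<and> snd z < len G (fst z) \<and> par G (fst z) (snd z) = P"
    for P and z :: "nat \<times> real"
  define \<phi> where "\<phi> P = (if P \<in> verts G then g0 P else (\<lambda>z. g (fst z) (snd z)) (SOME z. Q P z))" for P
  have v: "\<phi> v = g0 v" if "v \<in> verts G" for v using that by (simp add: \<phi>_def)
  have "\<phi> (par G e t) = g e t" if e: "e \<in> edges G" and t: "0 \<le> t" "t \<le> len G e" for e t
  proof (cases "t = 0 \<or> t = len G e")
    case True
    then show ?thesis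
      using v tropical_curveD(5,6)[OF G e] g[OF e] by (auto simp: src_def tgt_def)
  next
    case False
    then have nv: "par G e t \<notin> verts G" using par_vertex[OF G e t] by blast
    have Q: "Q (par G e t) (e, t)" using False e t by (simp add: Q_def)
    have "z = (e, t)" if "Q (par G e t) z" for z
      using that Q open_edge_unique[OF G, of "fst z" e "snd z" t] by (simp add: Q_def prod_eq_iff)
    then have "(SOME z. Q (par G e t) z) = (e, t)" using Q by (rule some_equality[rotated])
    then show ?thesis using nv by (simp add: \<phi>_def)
  qed
  with v show ?thesis by (intro exI[of _ \<phi>]) auto
qed

lemma topspace_realization_top:
  assumes G: "tropical_curve G"
  shows "topspace (realization_top G) = points G"
proof
  show "topspace (realization_top G) \<subseteq> points G"
    using openin_realization_top[of G "topspace (realization_top G)"] by simp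
  have "{t \<in> {0..len G e}. par G e t \<in> points G} = {0..len G e}" if "e \<in> edges G" for e
    using par_points[OF G that] by auto
  then have "openin (realization_top G) (points G)"
    by (simp add: openin_realization_top)
  then show "points G \<subseteq> topspace (realization_top G)" by (rule openin_subset)
qed

text \<open>Open sets are tested edge by edge, so continuity reduces to affine or constant maps on
  parameter intervals.\<close>

lemma continuous_edgewise:
  assumes G: "tropical_curve G" and H: "tropical_curve H"
    and pts: "\<And>P. P \<in> points G \<Longrightarrow> \<phi> P \<in> points H"
    and edge: "\<And>e. e \<in> edges G \<Longrightarrow> (\<exists>e' s k. edge_over G H \<phi> e e' s k) \<or> edge_contracted G H \<phi> e"
  shows "continuous_map (realization_top G) (realization_top H) \<phi>"
  unfolding continuous_map_def topspace_realization_top[OF G] topspace_realization_top[OF H]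
proof (intro conjI allI impI)
  show "\<phi> \<in> points G \<rightarrow> points H" using pts by blast
  fix U assume U: "openin (realization_top H) U"
  show "openin (realization_top G) {P \<in> points G. \<phi> P \<in> U}"
    unfolding openin_realization_top
  proof (intro conjI ballI)
    fix e assume e: "e \<in> edges G"
    have eq: "{t \<in> {0..len G e}. par G e t \<in> {P \<in> points G. \<phi> P \<in> U}} =
        {t \<in> {0..len G e}. \<phi> (par G e t) \<in> U}"
      using par_points[OF G e] by auto
    show "openin (top_of_set {0..len G e}) {t \<in> {0..len G e}. par G e t \<in> {P \<in> points G. \<phi> P \<in> U}}"
      unfolding eq
    proof (cases "edge_contracted G H \<phi> e")
      case True
      then obtain w where "\<forall>t\<in>{0..len G e}. \<phi> (par G e t) = w" by (auto simp: edge_contracted_def)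
      then have "{t \<in> {0..len G e}. \<phi> (par G e t) \<in> U} = (if w \<in> U then {0..len G e} else {})" by auto
      then show "openin (top_of_set {0..len G e}) {t \<in> {0..len G e}. \<phi> (par G e t) \<in> U}" by simp
    next
      case False
      then obtain e' s k where o: "edge_over G H \<phi> e e' s k" using edge[OF e] by blast
      define f where "f t = (if s then real k * t else len H e' - real k * t)" for t
      define W where "W = {t \<in> {0..len H e'}. par H e' t \<in> U}"
      have "openin (top_of_set {0..len H e'}) W"
        using U o unfolding openin_realization_top W_def edge_over_def by blast
      moreover have "continuous_on {0..len G e} f"
        unfolding f_def by (cases s) (auto intro!: continuous_intros)
      moreover have f: "f \<in> {0..len G e} \<rightarrow> {0..len H e'}"
        using o by (auto simp: edge_over_def f_def intro: mult_left_mono)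
      ultimately have "openin (top_of_set {0..len G e}) ({0..len G e} \<inter> f -` W)"
        by (intro continuous_openin_preimage)
      moreover have "{0..len G e} \<inter> f -` W = {t \<in> {0..len G e}. \<phi> (par G e t) \<in> U}"
      proof -
        have "\<phi> (par G e t) = par H e' (f t)" if "t \<in> {0..len G e}" for t
          using o that by (simp add: edge_over_def f_def)
        then show ?thesis using f by (auto simp: W_def)
      qed
      ultimately show "openin (top_of_set {0..len G e}) {t \<in> {0..len G e}. \<phi> (par G e t) \<in> U}" by simp
    qed
  qed auto
qed

section \<open>The cyclic cover of a curve of genus one\<close>

text \<open>The \<open>k\<close>-fold cyclic cover of \<open>H\<close> with voltage 1 on the edge \<open>e0\<close> outside the spanning tree \<open>T\<close>
  and voltage 0 elsewhere. The sheets over the edge \<open>e\<close> are numbered \<open>e * k + i\<close> with \<open>i < k\<close>, and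
  sheet \<open>i\<close> over a vertex \<open>v\<close> is the point \<open>(0, ix v * k + i)\<close>.\<close>

locale cyclic_cover =
  fixes H :: "'q mgraph" and T :: "nat set" and e0 k :: nat and ix :: "'q \<Rightarrow> nat"
  assumes H: "tropical_curve H" and T: "spanning_tree H T" and e0: "edges H - T = {e0}"
    and k: "k > 0" and ix: "inj_on ix (verts H)"
begin

lemmas DH = tropical_curveD[OF H]

definition volt :: "nat \<Rightarrow> int" where "volt e = (if e = e0 then 1 else 0)"

definition cvert :: "'q \<Rightarrow> int \<Rightarrow> nat \<times> real" where
  "cvert v i = (0, real (ix v * k + nat (i mod int k)))"

definition cedge :: "nat \<Rightarrow> int \<Rightarrow> nat" where
  "cedge e i = e * k + nat (i mod int k)"

text \<open>Sheet \<open>i\<close> over \<open>e\<close> starts in sheet \<open>i\<close> and ends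
  in sheet \<open>i + volt e\<close>; \<open>cvert\<close> reduces modulo \<open>k\<close>, so
  wrapping round needs no case distinction. The type of the points is the one over which
  \<open>optimal_cover\<close> quantifies.\<close>

definition C :: "(nat \<times> real) mgraph" where
  "C = \<lparr>verts = {cvert v i | v i. v \<in> verts H}, edges = {n. n div k \<in> edges H},
        len = (\<lambda>n. len H (n div k)),
        par = (\<lambda>n t. if t \<le> 0 then cvert (src H (n div k)) (int (n mod k))
                     else if len H (n div k) \<le> t
                     then cvert (tgt H (n div k)) (int (n mod k) + volt (n div k)) else (Suc n, t))\<rparr>"

text \<open>Vertex points store a natural number as a real, hence the floor; dividing by
  \<open>k\<close> forgets the sheet.\<close>

definition \<psi> :: "nat \<times> real \<Rightarrow> 'q" where
  "\<psi> P = (case fst P of 0 \<Rightarrow> inv_into (verts H) ix (nat \<lfloor>snd P\<rfloor> div k)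
                       | Suc n \<Rightarrow> par H (n div k) (snd P))"

lemma nat_mod: "nat (i mod int k) < k"
proof -
  have "0 \<le> i mod int k" "i mod int k < int k" using k by simp_all
  then show ?thesis by (simp add: nat_less_iff)
qed

lemma int_nat_mod: "int (nat (i mod int k)) = i mod int k"
  using k by simp

lemma cedge_div [simp]: "cedge e i div k = e"
  using nat_mod[of i] by (simp add: cedge_def)

lemma cedge_mod: "int (cedge e i mod k) = i mod int k"
  using nat_mod[of i] int_nat_mod[of i] by (simp add: cedge_def)

lemma cedge_self: "cedge (n div k) (int (n mod k)) = n"
  by (simp add: cedge_def flip: of_nat_mod)

lemma cvert_mod: "i mod int k = j mod int k \<Longrightarrow> cvert v i = cvert v j"
  by (simp add: cvert_def)

lemma cvert_eq:
  assumes "v \<in> verts H" "w \<in> verts H" "cvert v i = cvert w j"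
  shows "v = w" "i mod int k = j mod int k"
proof -
  have eq: "ix v * k + nat (i mod int k) = ix w * k + nat (j mod int k)"
    using assms(3) unfolding cvert_def prod.inject of_nat_eq_iff by blast
  from arg_cong[OF this, of "\<lambda>x. x div k"] have "ix v = ix w"
    using nat_mod[of i] nat_mod[of j] by simp
  then show "v = w" using ix assms by (auto dest: inj_onD)
  have "nat (i mod int k) = nat (j mod int k)" using eq \<open>ix v = ix w\<close> by simp
  then show "i mod int k = j mod int k" using int_nat_mod by metis
qed

lemma psi_cvert: "v \<in> verts H \<Longrightarrow> \<psi> (cvert v i) = v"
proof -
  assume v: "v \<in> verts H"
  have "nat \<lfloor>real (ix v * k + nat (i mod int k))\<rfloor> div k = ix v"
    unfolding floor_of_nat nat_int using nat_mod[of i] by simp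
  then show ?thesis using v ix by (simp add: \<psi>_def cvert_def)
qed

lemma C_simps [simp]:
  "verts C = {cvert v i | v i. v \<in> verts H}" "n \<in> edges C \<longleftrightarrow> n div k \<in> edges H"
  "len C n = len H (n div k)"
  by (simp_all add: C_def)

lemma par_C_0: "par C n 0 = cvert (src H (n div k)) (int (n mod k))"
  by (simp add: C_def)

lemma par_C_len:
  "n \<in> edges C \<Longrightarrow> par C n (len H (n div k)) = cvert (tgt H (n div k)) (int (n mod k) + volt (n div k))"
  using DH(4)[of "n div k"] by (simp add: C_def)

lemma par_C_mid: "0 < t \<Longrightarrow> t < len H (n div k) \<Longrightarrow> par C n t = (Suc n, t)"
  by (simp add: C_def)

lemma src_C: "src C n = cvert (src H (n div k)) (int (n mod k))"
  by (simp add: src_def par_C_0)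

lemma tgt_C: "n \<in> edges C \<Longrightarrow> tgt C n = cvert (tgt H (n div k)) (int (n mod k) + volt (n div k))"
  by (simp add: tgt_def par_C_len)

lemma psi_par:
  assumes "n \<in> edges C" "0 \<le> t" "t \<le> len H (n div k)"
  shows "\<psi> (par C n t) = par H (n div k) t"
proof -
  have e: "n div k \<in> edges H" using assms by simp
  consider "t = 0" | "t = len H (n div k)" | "0 < t" "t < len H (n div k)" using assms by linarith
  then show ?thesis
  proof cases
    case 1
    then show ?thesis using psi_cvert[OF DH(5)[OF e]] by (simp add: par_C_0 src_def)
  next
    case 2
    then show ?thesis using psi_cvert[OF DH(6)[OF e]] by (simp add: par_C_len[OF assms(1)] tgt_def)
  next
    case 3
    then show ?thesis by (simp add: par_C_mid \<psi>_def)
  qed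
qed

text \<open>Inside an edge the label \<open>Suc n\<close> tells the sheets apart, at the source
  their number does, and at the target the common voltage cancels modulo \<open>k\<close>. This
  makes lifts of directions unique.\<close>

lemma lift_unique:
  assumes "n \<in> edges C" "n' \<in> edges C" "n div k = n' div k" "0 \<le> t" "t \<le> len H (n div k)"
    and eq: "par C n t = par C n' t"
  shows "n = n'"
proof -
  have e: "n div k \<in> edges H" using assms by simp
  have nn: "n = n'" if "int (n mod k) mod int k = int (n' mod k) mod int k"
    using that assms(3) by (metis cedge_self mod_mod_trivial of_nat_mod)
  consider "t = 0" | "t = len H (n div k)" | "0 < t" "t < len H (n div k)" using assms by linarith
  then show ?thesis
  proof cases
    case 1
    then show ?thesis
      using eq cvert_eq(2)[OF DH(5)[OF e] DH(5)[OF e], of "int (n mod k)" "int (n' mod k)"] nn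
      by (simp add: par_C_0 assms(3))
  next
    case 2
    then have "cvert (tgt H (n div k)) (int (n mod k) + volt (n div k)) =
        cvert (tgt H (n div k)) (int (n' mod k) + volt (n div k))"
      using eq par_C_len[OF assms(1)] par_C_len[OF assms(2)] assms(3) by simp
    from cvert_eq(2)[OF DH(6)[OF e] DH(6)[OF e] this]
    have "(int (n mod k) + volt (n div k) - volt (n div k)) mod int k =
        (int (n' mod k) + volt (n div k) - volt (n div k)) mod int k"
      by (rule mod_diff_cong) simp
    then show ?thesis using nn by simp
  next
    case 3
    then show ?thesis using eq par_C_mid[of t n] par_C_mid[of t n'] assms(3) by simp
  qed
qed

lemma finite_C: "finite (verts C)" "card (verts C) = card (verts H) * k"
  "finite (edges C)" "card (edges C) = card (edges H) * k"
proof -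
  have V: "bij_betw (\<lambda>(v, i). cvert v (int i)) (verts H \<times> {..<k}) (verts C)"
    unfolding bij_betw_def
  proof
    show "inj_on (\<lambda>(v, i). cvert v (int i)) (verts H \<times> {..<k})"
    proof (rule inj_onI)
      fix x y :: "'q \<times> nat"
      assume xy: "x \<in> verts H \<times> {..<k}" "y \<in> verts H \<times> {..<k}"
        "(case x of (v, i) \<Rightarrow> cvert v (int i)) = (case y of (v, i) \<Rightarrow> cvert v (int i))"
      then have "fst x \<in> verts H" "fst y \<in> verts H" "cvert (fst x) (int (snd x)) = cvert (fst y) (int (snd y))"
        by (auto simp: case_prod_beta)
      from cvert_eq[OF this] xy(1,2) show "x = y"
        by (auto simp: prod_eq_iff simp flip: of_nat_mod)
    qed
    show "(\<lambda>(v, i). cvert v (int i)) ` (verts H \<times> {..<k}) = verts C"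
    proof
      show "verts C \<subseteq> (\<lambda>(v, i). cvert v (int i)) ` (verts H \<times> {..<k})"
      proof
        fix x assume "x \<in> verts C"
        then obtain v i where x: "x = cvert v i" "v \<in> verts H" by auto
        have "x = cvert v (int (nat (i mod int k)))" unfolding x int_nat_mod by (rule cvert_mod) simp
        then show "x \<in> (\<lambda>(v, i). cvert v (int i)) ` (verts H \<times> {..<k})"
          using x(2) nat_mod by (intro image_eqI[of _ _ "(v, nat (i mod int k))"]) auto
      qed
    qed auto
  qed
  show "finite (verts C)" using bij_betw_finite[OF V] DH(1) by simp
  show "card (verts C) = card (verts H) * k"
    using bij_betw_same_card[OF V] by (simp add: card_cartesian_product)
  have E: "bij_betw (\<lambda>(e, i). cedge e (int i)) (edges H \<times> {..<k}) (edges C)"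
    unfolding bij_betw_def
  proof
    show "inj_on (\<lambda>(e, i). cedge e (int i)) (edges H \<times> {..<k})"
    proof (rule inj_onI)
      fix x y :: "nat \<times> nat"
      assume xy: "x \<in> edges H \<times> {..<k}" "y \<in> edges H \<times> {..<k}"
        "(case x of (e, i) \<Rightarrow> cedge e (int i)) = (case y of (e, i) \<Rightarrow> cedge e (int i))"
      then have eq: "cedge (fst x) (int (snd x)) = cedge (fst y) (int (snd y))"
        by (simp add: case_prod_beta)
      from arg_cong[OF this, of "\<lambda>n. n div k"] have "fst x = fst y" by simp
      with eq xy(1,2) show "x = y" by (auto simp: cedge_def simp flip: of_nat_mod)
    qed
    show "(\<lambda>(e, i). cedge e (int i)) ` (edges H \<times> {..<k}) = edges C"
    proof
      show "edges C \<subseteq> (\<lambda>(e, i). cedge e (int i)) ` (edges H \<times> {..<k})"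
      proof
        fix n assume "n \<in> edges C"
        then show "n \<in> (\<lambda>(e, i). cedge e (int i)) ` (edges H \<times> {..<k})"
          using cedge_self[of n] k by (intro image_eqI[of _ _ "(n div k, n mod k)"]) auto
      qed
    qed auto
  qed
  show "finite (edges C)" using bij_betw_finite[OF E] DH(3) by simp
  show "card (edges C) = card (edges H) * k"
    using bij_betw_same_card[OF E] by (simp add: card_cartesian_product)
qed

lemma cedge_ends:
  assumes e: "e \<in> edges H"
  shows "src C (cedge e i) = cvert (src H e) i" "tgt C (cedge e i) = cvert (tgt H e) (i + volt e)"
proof -
  show "src C (cedge e i) = cvert (src H e) i"
    unfolding src_C cedge_div cedge_mod by (rule cvert_mod) simp
  have "cedge e i \<in> edges C" using e by simp
  then show "tgt C (cedge e i) = cvert (tgt H e) (i + volt e)"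
    unfolding tgt_C[OF \<open>cedge e i \<in> edges C\<close>] cedge_div cedge_mod by (intro cvert_mod) (simp add: mod_add_left_eq)
qed

lemma sheet_step:
  assumes e: "e \<in> edges H"
  shows "(cvert (src H e) i, cvert (tgt H e) (i + volt e)) \<in> adj C (edges C)"
    "(cvert (tgt H e) (i + volt e), cvert (src H e) i) \<in> adj C (edges C)"
  using e cedge_ends[OF e, of i, symmetric] unfolding adj_def by auto

text \<open>Tree edges have voltage 0, so a path in the tree lifts inside a single sheet.\<close>

lemma sheet_connected:
  assumes "(v, w) \<in> (adj H T)\<^sup>*"
  shows "(cvert v i, cvert w i) \<in> (adj C (edges C))\<^sup>*"
  using assms
proof (induction rule: rtrancl_induct)
  case (step y z)
  from step(2) obtain e where e: "e \<in> T" "(y, z) = (src H e, tgt H e) \<or> (y, z) = (tgt H e, src H e)"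
    by (auto simp: adj_def)
  have eH: "e \<in> edges H" using e(1) T by (auto simp: spanning_tree_def)
  have "volt e = 0" using e(1) e0 by (auto simp: volt_def)
  then have "(cvert y i, cvert z i) \<in> adj C (edges C)"
    using e(2) sheet_step[OF eH, of i] by auto
  with step(3) show ?case by simp
qed simp

text \<open>Walk in sheet \<open>j\<close> to the source of \<open>e0\<close>, cross
  \<open>e0\<close> into the next sheet, and return to \<open>v\<close> inside that sheet. Voltage 1
  on \<open>e0\<close> is thus what connects the cover.\<close>

lemma sheets_connected:
  assumes v: "v \<in> verts H"
  shows "(cvert v 0, cvert v (int j)) \<in> (adj C (edges C))\<^sup>*"
proof (induction j)
  case (Suc j)
  have e: "e0 \<in> edges H" using e0 by blast
  have conn: "(x, y) \<in> (adj H T)\<^sup>*" if "x \<in> verts H" "y \<in> verts H" for x y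
    using T that by (simp add: spanning_tree_def)
  have "(cvert v (int j), cvert (src H e0) (int j)) \<in> (adj C (edges C))\<^sup>*"
    by (rule sheet_connected[OF conn[OF v DH(5)[OF e]]])
  moreover have "(cvert (src H e0) (int j), cvert (tgt H e0) (int (Suc j))) \<in> (adj C (edges C))\<^sup>*"
    using sheet_step(1)[OF e, of "int j"] by (simp add: volt_def add.commute)
  moreover have "(cvert (tgt H e0) (int (Suc j)), cvert v (int (Suc j))) \<in> (adj C (edges C))\<^sup>*"
    by (rule sheet_connected[OF conn[OF DH(6)[OF e] v]])
  ultimately show ?case using Suc by (meson rtrancl_trans)
qed simp

lemma open_edge_C: "open_edge C n = {(Suc n, t) | t. 0 < t \<and> t < len H (n div k)}"
  unfolding open_edge_def using par_C_mid by (auto intro!: image_eqI)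

lemma tropical_C: "tropical_curve C"
proof -
  have sym: "(x, y) \<in> (adj C (edges C))\<^sup>* \<Longrightarrow> (y, x) \<in> (adj C (edges C))\<^sup>*" for x y
  proof -
    have "sym (adj C (edges C))" by (auto simp: sym_def adj_def)
    then show "(x, y) \<in> (adj C (edges C))\<^sup>* \<Longrightarrow> (y, x) \<in> (adj C (edges C))\<^sup>*"
      using sym_rtrancl symD by metis
  qed
  obtain r where r: "r \<in> verts H" using DH(2) by blast
  have root: "(cvert r 0, x) \<in> (adj C (edges C))\<^sup>*" if x: "x \<in> verts C" for x
  proof -
    obtain v i where v: "x = cvert v i" "v \<in> verts H" using x by auto
    have xj: "x = cvert v (int (nat (i mod int k)))" unfolding v int_nat_mod by (rule cvert_mod) simp
    have "(r, v) \<in> (adj H T)\<^sup>*" using T r v(2) by (simp add: spanning_tree_def)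
    from sheet_connected[OF this] sheets_connected[OF r] show ?thesis
      unfolding xj by (meson rtrancl_trans)
  qed
  have conn: "\<forall>v\<in>verts C. \<forall>w\<in>verts C. (v, w) \<in> (adj C (edges C))\<^sup>*"
    using root sym by (meson rtrancl_trans)
  have "open_edge C n \<inter> verts C = {}" for n by (auto simp: open_edge_C cvert_def)
  moreover have "inj_on (par C n) {0<..<len C n}" for n
    by (auto simp: inj_on_def par_C_mid)
  moreover have "open_edge C n \<inter> open_edge C m = {}" if "n \<noteq> m" for n m
    using that by (auto simp: open_edge_C)
  moreover have "src C n \<in> verts C \<and> tgt C n \<in> verts C \<and> len C n > 0" if "n \<in> edges C" for n
    using that DH(4-6) tgt_C[OF that] by (auto simp: src_C)
  moreover have "verts C \<noteq> {}" unfolding C_simps using r by blast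
  ultimately show ?thesis
    unfolding tropical_curve_def using conn finite_C(1,3) unfolding adj_def by blast
qed

text \<open>The numbers of vertices and of edges are both multiplied by \<open>k\<close>, and genus
  one means that they are equal.\<close>

lemma genus_C:
  assumes "genus H = 1"
  shows "genus C = 1"
  using assms finite_C(2,4) by (simp add: genus_def)

lemma psi_edge: "n \<in> edges C \<Longrightarrow> edge_over C H \<psi> n (n div k) True 1"
  by (auto simp: edge_over_def psi_par)

lemma psi_points: "P \<in> points C \<Longrightarrow> \<psi> P \<in> points H"
proof -
  assume "P \<in> points C"
  then consider "P \<in> verts C" | n t where "n \<in> edges C" "0 < t" "t < len C n" "P = par C n t"
    by (auto simp: points_def open_edge_def)
  then show ?thesis
  proof cases
    case 1
    then show ?thesis using psi_cvert by (auto simp: points_def)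
  next
    case 2
    then show ?thesis using psi_par[of n t] par_points[OF H, of "n div k" t] by simp
  qed
qed

text \<open>Lifts a direction from \<open>\<psi> P\<close> to \<open>P\<close>, the existence half
  of \<open>\<psi>\<close> being a local isomorphism; the uniqueness half is
  \<open>lift_unique\<close>.\<close>

lemma psi_fibre:
  assumes P: "P \<in> points C" and w: "(e, t, s) \<in> tangents H (\<psi> P)"
  shows "\<exists>n. n div k = e \<and> par C n t = P"
proof -
  have e: "e \<in> edges H" and t: "0 \<le> t" "t \<le> len H e" "par H e t = \<psi> P"
    using w by (auto simp: tangents_def)
  from P consider v i where "P = cvert v i" "v \<in> verts H"
    | n u where "n \<in> edges C" "0 < u" "u < len H (n div k)" "P = par C n u"
    by (auto simp: points_def open_edge_def)
  then show ?thesis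
  proof cases
    case 1
    then have v: "par H e t = v" using t psi_cvert by simp
    consider "t = 0" | "t = len H e" using par_vertex[OF H e t(1,2)] v 1(2) by blast
    then show ?thesis
    proof cases
      case a: 1
      have "par C (cedge e i) t = P"
        using cedge_ends(1)[OF e, of i] v a by (simp add: 1 src_def)
      then show ?thesis using cedge_div by blast
    next
      case a: 2
      \<comment> \<open>A sheet over \<open>e\<close> that ends in sheet \<open>i\<close> starts in
        sheet \<open>i - volt e\<close>.\<close>
      have "par C (cedge e (i - volt e)) t = P"
        using cedge_ends(2)[OF e, of "i - volt e"] v a by (simp add: 1 tgt_def)
      then show ?thesis using cedge_div by blast
    qed
  next
    case 2
    have eq: "par H (n div k) u = par H e t" using t(3) 2 psi_par[of n u] by simp
    have nv: "par H e t \<notin> verts H"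
      using eq 2 open_edgeI[of u H "n div k"] DH(8)[of "n div k"] by force
    then have "0 < t" "t < len H e"
      using t DH(5,6)[OF e] by (auto simp: src_def tgt_def less_le)
    then have "n div k = e \<and> u = t" using open_edge_unique[OF H, of "n div k" e u t] 2 e eq by simp
    then show ?thesis using 2 by blast
  qed
qed

text \<open>\<open>psi_fibre\<close> and \<open>lift_unique\<close> leave a single direction at
  \<open>P\<close> over \<open>w\<close>, and all slopes of \<open>\<psi>\<close> are 1.\<close>

lemma psi_local_degree:
  assumes P: "P \<in> points C" and w: "w \<in> tangents H (\<psi> P)"
  shows "local_degree C H \<psi> P w = 1"
proof -
  obtain e t s where w_eq: "w = (e, t, s)" by (cases w)
  have e: "e \<in> edges H" and t: "0 \<le> t" "t \<le> len H e" "par H e t = \<psi> P" and ts: "if s then t < len H e else 0 < t"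
    using w by (auto simp: tangents_def w_eq)
  obtain n where n: "n div k = e" "par C n t = P" using psi_fibre[OF P] w w_eq by blast
  have nC: "n \<in> edges C" using n e by simp
  have "{\<tau> \<in> tangents C P. tangent_over C H \<psi> \<tau> w} = {(n, t, s)}"
  proof -
    have "\<tau> = (n, t, s)" if \<tau>: "\<tau> \<in> tangents C P" "tangent_over C H \<psi> \<tau> w" for \<tau>
    proof -
      obtain n1 t1 s1 where tau: "\<tau> = (n1, t1, s1)" by (cases \<tau>)
      have n1: "n1 \<in> edges C" "par C n1 t1 = P" using \<tau>(1) by (auto simp: tau tangents_def)
      obtain r m where o: "edge_over C H \<psi> n1 e r m"
        and tt: "t = (if r then real m * t1 else len H e - real m * t1)" "s = (s1 = r)"
        using \<tau>(2) by (auto simp: tau w_eq)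
      note u = edge_over_unique[OF tropical_C H n1(1) o psi_edge[OF n1(1)]]
      have "t1 = t" "s1 = s" using tt u by simp_all
      moreover have "n1 = n"
      proof (rule lift_unique[OF n1(1) nC])
        show "n1 div k = n div k" using u(1) n(1) by metis
        show "t \<le> len H (n1 div k)" using u(1) t(2) by metis
        show "par C n1 t = par C n t" using n(2) n1(2) \<open>t1 = t\<close> by metis
      qed (rule t(1))
      ultimately show ?thesis by (simp add: tau)
    qed
    moreover have "(n, t, s) \<in> tangents C P" using nC n t ts by (simp add: tangents_def)
    moreover have "tangent_over C H \<psi> (n, t, s) w"
      unfolding w_eq tangent_over.simps using psi_edge[OF nC] n(1)
      by (intro exI[of _ True] exI[of _ 1]) simp
    ultimately show ?thesis by blast
  qed
  then show ?thesis
    unfolding local_degree_def using slope_over[OF tropical_C H nC psi_edge[OF nC]] by simp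
qed

lemma harmonic_psi: "harmonic_on C H \<psi>"
proof -
  have edge: "(\<exists>e' s m. edge_over C H \<psi> n e' s m) \<or> edge_contracted C H \<psi> n" if "n \<in> edges C" for n
    using psi_edge[OF that] by blast
  have "points H \<subseteq> \<psi> ` points C"
  proof
    fix Q assume "Q \<in> points H"
    then consider "Q \<in> verts H" | e t where "e \<in> edges H" "0 < t" "t < len H e" "Q = par H e t"
      by (auto simp: points_def open_edge_def)
    then show "Q \<in> \<psi> ` points C"
    proof cases
      case 1
      then show ?thesis
        using psi_cvert[OF 1, of 0] by (intro image_eqI[of _ _ "cvert Q 0"]) (auto simp: points_def)
    next
      case 2
      then have "cedge e 0 \<in> edges C" by simp
      then show ?thesis
        using psi_par[of "cedge e 0" t] par_points[OF tropical_C, of "cedge e 0" t] 2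
        by (intro image_eqI[of _ _ "par C (cedge e 0) t"]) auto
    qed
  qed
  then have "\<psi> ` points C = points H" using psi_points by blast
  moreover have "\<psi> ` verts C \<subseteq> verts H" using psi_cvert by auto
  moreover have "continuous_map (realization_top C) (realization_top H) \<psi>"
    by (rule continuous_edgewise[OF tropical_C H psi_points edge])
  ultimately show ?thesis
    unfolding harmonic_on_def using edge psi_local_degree by simp
qed

text \<open>Over \<open>e0\<close> lie \<open>k\<close> sheets of slope 1, so the slope sum over
  this one edge already gives the degree.\<close>

lemma psi_degree:
  assumes deg: "fibre_degree C H \<psi> d"
  shows "d = k"
proof -
  interpret c: cover_model C H \<psi> by unfold_locales (rule tropical_C H harmonic_psi)+
  have e: "e0 \<in> edges H" using e0 by blast
  have "{n \<in> edges C. \<exists>s m. edge_over C H \<psi> n e0 s m} = (\<lambda>i. cedge e0 (int i)) ` {..<k}"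
  proof
    show "{n \<in> edges C. \<exists>s m. edge_over C H \<psi> n e0 s m} \<subseteq> (\<lambda>i. cedge e0 (int i)) ` {..<k}"
    proof
      fix n assume "n \<in> {n \<in> edges C. \<exists>s m. edge_over C H \<psi> n e0 s m}"
      then obtain s m where n: "n \<in> edges C" "edge_over C H \<psi> n e0 s m" by blast
      have "e0 = n div k" using edge_over_unique(1)[OF tropical_C H n(1) n(2) psi_edge[OF n(1)]] .
      then have "n = cedge e0 (int (n mod k))" using cedge_self by simp
      then show "n \<in> (\<lambda>i. cedge e0 (int i)) ` {..<k}" using k by (intro image_eqI[of _ _ "n mod k"]) auto
    qed
    show "(\<lambda>i. cedge e0 (int i)) ` {..<k} \<subseteq> {n \<in> edges C. \<exists>s m. edge_over C H \<psi> n e0 s m}"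
    proof clarify
      fix i assume "i < k"
      have "cedge e0 (int i) \<in> edges C" using e by simp
      from psi_edge[OF this] this
      show "cedge e0 (int i) \<in> edges C \<and> (\<exists>s m. edge_over C H \<psi> (cedge e0 (int i)) e0 s m)"
        unfolding cedge_div by blast
    qed
  qed
  moreover have "inj_on (\<lambda>i. cedge e0 (int i)) {..<k}"
    by (auto simp: inj_on_def cedge_def simp flip: of_nat_mod)
  ultimately have "card {n \<in> edges C. \<exists>s m. edge_over C H \<psi> n e0 s m} = k"
    by (simp add: card_image)
  moreover have "(\<Sum>n | n \<in> edges C \<and> (\<exists>s m. edge_over C H \<psi> n e0 s m). slope C H \<psi> n) =
      (\<Sum>n | n \<in> edges C \<and> (\<exists>s m. edge_over C H \<psi> n e0 s m). 1)"
    using slope_over[OF tropical_C H _ psi_edge] by (intro sum.cong) auto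
  ultimately show ?thesis using c.sum_slopes[OF deg e] by simp
qed

end

subsection \<open>Lifting to the cyclic cover\<close>

context cyclic_cover
begin

text \<open>\<open>p v\<close> names the sheet that receives the vertex \<open>v\<close>. An edge
  over \<open>e'\<close> is sent to the sheet that starts where its end over \<open>src H e'\<close>
  was placed, and the divisibility hypothesis says that its other end then fits, so the edges can be
  glued.\<close>

lemma lift_exists:
  fixes G :: "'p mgraph" and p :: "'p \<Rightarrow> int"
  assumes cm: "cover_model G H \<phi>"
    and p: "\<And>e. e \<in> edges G \<Longrightarrow> int k dvd edge_sign G H \<phi> e e0 - (p (tgt G e) - p (src G e))"
  shows "\<exists>\<phi>'. (\<forall>v\<in>verts G. \<phi>' v = cvert (\<phi> v) (p v)) \<and> (\<forall>P\<in>points G. \<psi> (\<phi>' P) = \<phi> P) \<and>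
    (\<forall>e\<in>edges G.
      (\<exists>n s m. n \<in> edges C \<and> edge_over G H \<phi> e (n div k) s m \<and> edge_over G C \<phi>' e n s m) \<or>
      (edge_contracted G H \<phi> e \<and> edge_contracted G C \<phi>' e))"
proof -
  interpret c: cover_model G H \<phi> by (rule cm)
  note DG = tropical_curveD[OF c.G]
  define ov where "ov e g n s m \<longleftrightarrow> n \<in> edges C \<and> edge_over G H \<phi> e (n div k) s m \<and>
      (\<forall>t\<in>{0..len G e}. g t = par C n (if s then real m * t else len C n - real m * t))"
    for e n s m and g :: "real \<Rightarrow> nat \<times> real"
  define con where "con e g \<longleftrightarrow> edge_contracted G H \<phi> e \<and> (\<exists>w\<in>verts C. \<forall>t\<in>{0..len G e}. g t = w)"
    for e and g :: "real \<Rightarrow> nat \<times> real"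
  define R where "R e g \<longleftrightarrow> g 0 = cvert (\<phi> (src G e)) (p (src G e)) \<and>
      g (len G e) = cvert (\<phi> (tgt G e)) (p (tgt G e)) \<and>
      (\<forall>t\<in>{0..len G e}. \<psi> (g t) = \<phi> (par G e t)) \<and> ((\<exists>n s m. ov e g n s m) \<or> con e g)"
    for e and g :: "real \<Rightarrow> nat \<times> real"
  have "\<exists>g. R e g" if e: "e \<in> edges G" for e
    using e
  proof (cases rule: c.edge_cases)
    case (over e' s m)
    \<comment> \<open>Sheets are numbered at the source of \<open>e'\<close>; if the orientation is
      reversed, the end of \<open>e\<close> over that source is its target.\<close>
    define j where "j = (if s then p (src G e) else p (tgt G e))"
    define n where "n = cedge e' j"
    define g where "g t = par C n (if s then real m * t else len C n - real m * t)" for t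
    have l: "0 < len G e" using DG(4)[OF e] .
    have n: "n div k = e'" "n \<in> edges C" using over(2) by (simp_all add: n_def)
    have ml: "len H e' = real m * len G e" using over(1) by (simp add: edge_over_def)
    have st: "\<phi> (src G e) = (if s then src H e' else tgt H e')"
      "\<phi> (tgt G e) = (if s then tgt H e' else src H e')"
      using over(1) l by (auto simp: edge_over_def src_def tgt_def)
    have "edge_sign G H \<phi> e e0 = (if s then volt e' else - volt e')"
      unfolding c.over_sign[OF e over(1)] volt_def by simp
    with p[OF e] have dvd: "int k dvd (if s then volt e' else - volt e') - (p (tgt G e) - p (src G e))" by simp
    have cong: "(j + volt e') mod int k = (if s then p (tgt G e) else p (src G e)) mod int k"
    proof (cases s)
      case True
      then have "int k dvd j + volt e' - p (tgt G e)"
        using dvd by (simp add: j_def algebra_simps)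
      then show ?thesis using True by (simp add: mod_eq_dvd_iff)
    next
      case False
      then have "int k dvd - (j + volt e' - p (src G e))"
        using dvd by (simp add: j_def algebra_simps)
      then show ?thesis using False unfolding dvd_minus_iff by (simp add: mod_eq_dvd_iff)
    qed
    have g0: "g 0 = (if s then src C n else tgt C n)" "g (len G e) = (if s then tgt C n else src C n)"
      using ml n(1) by (simp_all add: g_def src_def tgt_def)
    have ends: "src C n = cvert (src H e') j" "tgt C n = cvert (tgt H e') (j + volt e')"
      unfolding n_def by (rule cedge_ends[OF over(2)])+
    have tg: "cvert (tgt H e') (j + volt e') = cvert (tgt H e') (if s then p (tgt G e) else p (src G e))"
      by (rule cvert_mod[OF cong])
    have 1: "g 0 = cvert (\<phi> (src G e)) (p (src G e))"
      unfolding g0 ends tg st by (simp add: j_def)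
    have 2: "g (len G e) = cvert (\<phi> (tgt G e)) (p (tgt G e))"
      unfolding g0 ends tg st by (simp add: j_def)
    have 3: "\<psi> (g t) = \<phi> (par G e t)" if t: "t \<in> {0..len G e}" for t
    proof -
      have "0 \<le> real m * t" "real m * t \<le> len H e'"
        using t ml by (auto intro: mult_left_mono)
      then show ?thesis
        using over(1) t psi_par[OF n(2)] n(1) unfolding g_def edge_over_def by auto
    qed
    have "ov e g n s m" unfolding ov_def n(1) using n(2) over(1) by (auto simp: g_def n(1))
    with 1 2 3 show ?thesis unfolding R_def by blast
  next
    case contracted
    then obtain w where w: "w \<in> verts H" "\<forall>t\<in>{0..len G e}. \<phi> (par G e t) = w"
      by (auto simp: edge_contracted_def)
    have l: "0 < len G e" using DG(4)[OF e] .
    \<comment> \<open>A contracted edge has sign 0, so the hypothesis puts both of its ends into the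
      same sheet and the lift can be constant on it.\<close>
    have "int k dvd p (src G e) - p (tgt G e)"
      using p[OF e] by (simp add: c.contracted_sign[OF e contracted])
    then have "cvert w (p (src G e)) = cvert w (p (tgt G e))"
      by (intro cvert_mod) (simp add: mod_eq_dvd_iff)
    moreover have "\<phi> (src G e) = w" "\<phi> (tgt G e) = w" using w l by (auto simp: src_def tgt_def)
    moreover have "con e (\<lambda>t. cvert w (p (src G e)))"
      using contracted w(1) unfolding con_def C_simps by blast
    ultimately show ?thesis
      using w unfolding R_def by (intro exI[of _ "\<lambda>t. cvert w (p (src G e))"]) (auto simp: psi_cvert)
  qed
  then obtain g where g: "\<And>e. e \<in> edges G \<Longrightarrow> R e (g e)" by metis
  have "\<exists>\<phi>'. (\<forall>v\<in>verts G. \<phi>' v = cvert (\<phi> v) (p v)) \<and>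
      (\<forall>e\<in>edges G. \<forall>t\<in>{0..len G e}. \<phi>' (par G e t) = g e t)"
  proof (rule glue_edges[OF c.G])
    fix e assume "e \<in> edges G"
    note g[OF this]
    then show "g e 0 = cvert (\<phi> (src G e)) (p (src G e))" "g e (len G e) = cvert (\<phi> (tgt G e)) (p (tgt G e))"
      unfolding R_def by blast+
  qed
  then obtain \<phi>' where v: "\<And>v. v \<in> verts G \<Longrightarrow> \<phi>' v = cvert (\<phi> v) (p v)"
    and par: "\<And>e t. e \<in> edges G \<Longrightarrow> t \<in> {0..len G e} \<Longrightarrow> \<phi>' (par G e t) = g e t"
    by blast
  have "\<psi> (\<phi>' P) = \<phi> P" if P: "P \<in> points G" for P
  proof -
    from P consider "P \<in> verts G" | e t where "e \<in> edges G" "0 < t" "t < len G e" "P = par G e t"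
      by (auto simp: points_def open_edge_def)
    then show ?thesis
    proof cases
      case 1
      then show ?thesis using v psi_cvert c.phi_vert by simp
    next
      case 2
      then show ?thesis using par[of e t] g[of e] by (simp add: R_def)
    qed
  qed
  moreover have "(\<exists>n s m. n \<in> edges C \<and> edge_over G H \<phi> e (n div k) s m \<and> edge_over G C \<phi>' e n s m) \<or>
      (edge_contracted G H \<phi> e \<and> edge_contracted G C \<phi>' e)" if e: "e \<in> edges G" for e
  proof -
    have "(\<exists>n s m. ov e (g e) n s m) \<or> con e (g e)" using g[OF e] by (simp add: R_def)
    then show ?thesis
    proof (elim disjE exE)
      fix n s m assume o: "ov e (g e) n s m"
      then have "edge_over G C \<phi>' e n s m"
        using par[OF e] unfolding ov_def edge_over_def by simp
      then show ?thesis using o unfolding ov_def by blast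
    next
      assume "con e (g e)"
      then show ?thesis using par[OF e] unfolding con_def edge_contracted_def by simp
    qed
  qed
  ultimately show ?thesis using v by blast
qed

text \<open>Since lifts of directions are unique, the directions at \<open>P\<close> over a
  direction of \<open>C\<close> are those over its image in \<open>H\<close>, and the local degrees
  of \<open>\<phi>\<close> carry over. Surjectivity is not inherited in this way; it is spread from
  one edge through the connected curve \<open>C\<close>.\<close>

lemma harmonic_lift:
  fixes G :: "'p mgraph" and p :: "'p \<Rightarrow> int"
  assumes cm: "cover_model G H \<phi>"
    and v: "\<And>v. v \<in> verts G \<Longrightarrow> \<phi>' v = cvert (\<phi> v) (p v)"
    and proj: "\<And>P. P \<in> points G \<Longrightarrow> \<psi> (\<phi>' P) = \<phi> P"
    and edge: "\<And>e. e \<in> edges G \<Longrightarrow>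
      (\<exists>n s m. n \<in> edges C \<and> edge_over G H \<phi> e (n div k) s m \<and> edge_over G C \<phi>' e n s m) \<or>
      (edge_contracted G H \<phi> e \<and> edge_contracted G C \<phi>' e)"
  shows "harmonic_on G C \<phi>'"
proof -
  interpret c: cover_model G H \<phi> by (rule cm)
  note DG = tropical_curveD[OF c.G]
  have vC: "\<phi>' v \<in> verts C" if "v \<in> verts G" for v
    using v[OF that] c.phi_vert[OF that] by auto
  have ptsC: "\<phi>' P \<in> points C" if P: "P \<in> points G" for P
  proof -
    from P consider "P \<in> verts G" | e t where "e \<in> edges G" "0 < t" "t < len G e" "P = par G e t"
      by (auto simp: points_def open_edge_def)
    then show ?thesis
    proof cases
      case 1
      then show ?thesis using vC[OF 1] unfolding points_def by blast
    next
      case 2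
      from edge[OF 2(1)] show ?thesis
      proof (elim disjE exE conjE)
        fix n s m assume n: "n \<in> edges C" "edge_over G C \<phi>' e n s m"
        have "\<phi>' P \<in> open_edge C n" unfolding 2(4) by (rule edge_over_mem(4)[OF n(2) 2(2,3)])
        then show ?thesis using n(1) unfolding points_def by blast
      next
        assume "edge_contracted G C \<phi>' e"
        then obtain w where "w \<in> verts C" "\<forall>t\<in>{0..len G e}. \<phi>' (par G e t) = w"
          unfolding edge_contracted_def by blast
        then show ?thesis using 2 by (simp add: points_def)
      qed
    qed
  qed
  have edge': "(\<exists>n s m. edge_over G C \<phi>' e n s m) \<or> edge_contracted G C \<phi>' e" if "e \<in> edges G" for e
    using edge[OF that] by blast
  have over_iff: "edge_over G H \<phi> e (n div k) s m"
    if e: "e \<in> edges G" "edge_over G C \<phi>' e n s m" for e n s m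
    using edge[OF e(1)]
  proof (elim disjE exE conjE)
    fix n' s' m' assume *: "edge_over G H \<phi> e (n' div k) s' m'" "edge_over G C \<phi>' e n' s' m'"
    have "n = n'" "s = s'" "m = m'"
      by (rule edge_over_unique[OF c.G tropical_C e *(2)])+
    then show ?thesis using *(1) by blast
  next
    assume "edge_contracted G C \<phi>' e"
    then show ?thesis using edge_over_not_contracted[OF c.G tropical_C e] by blast
  qed
  have lift: "\<exists>n'. n' \<in> edges C \<and> n' div k = e' \<and> edge_over G C \<phi>' e n' s m"
    if e: "e \<in> edges G" "edge_over G H \<phi> e e' s m" for e e' s m
    using edge[OF e(1)]
  proof (elim disjE exE conjE)
    fix n' s' m' assume *: "n' \<in> edges C" "edge_over G H \<phi> e (n' div k) s' m'" "edge_over G C \<phi>' e n' s' m'"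
    have "n' div k = e'" "s' = s" "m' = m"
      using edge_over_unique[OF c.G H e(1) *(2) e(2)] by auto
    then show ?thesis using * by blast
  next
    assume "edge_contracted G H \<phi> e"
    then show ?thesis using edge_over_not_contracted[OF c.G H e] by blast
  qed
  have tan: "(n div k, t, s) \<in> tangents H (\<phi> P)"
    if P: "P \<in> points G" and w: "(n, t, s) \<in> tangents C (\<phi>' P)" for P n t s
  proof -
    have "n \<in> edges C" "0 \<le> t" "t \<le> len H (n div k)" "par C n t = \<phi>' P" "if s then t < len H (n div k) else 0 < t"
      using w by (auto simp: tangents_def)
    moreover from this have "par H (n div k) t = \<phi> P" using psi_par[of n t] proj[OF P] by simp
    ultimately show ?thesis by (simp add: tangents_def)
  qed
  have ld: "local_degree G C \<phi>' P (n, t, s) = local_degree G H \<phi> P (n div k, t, s)"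
    if P: "P \<in> points G" and w: "(n, t, s) \<in> tangents C (\<phi>' P)" for P n t s
  proof -
    have nC: "n \<in> edges C" "0 \<le> t" "t \<le> len H (n div k)" "par C n t = \<phi>' P"
      using w by (auto simp: tangents_def)
    have iff: "tangent_over G C \<phi>' \<tau> (n, t, s) \<longleftrightarrow> tangent_over G H \<phi> \<tau> (n div k, t, s)"
      if \<tau>: "\<tau> \<in> tangents G P" for \<tau>
    proof -
      obtain e u r where tau: "\<tau> = (e, u, r)" by (cases \<tau>)
      have e: "e \<in> edges G" "u \<in> {0..len G e}" "par G e u = P"
        using \<tau> by (auto simp: tau tangents_def)
      show ?thesis
      proof
        assume "tangent_over G C \<phi>' \<tau> (n, t, s)"
        then obtain q m where o: "edge_over G C \<phi>' e n q m"
          "t = (if q then real m * u else len C n - real m * u)" "s = (r = q)"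
          unfolding tau tangent_over.simps by blast
        have "t = (if q then real m * u else len H (n div k) - real m * u)" using o(2) by simp
        with over_iff[OF e(1) o(1)] o(3) show "tangent_over G H \<phi> \<tau> (n div k, t, s)"
          unfolding tau tangent_over.simps by blast
      next
        assume "tangent_over G H \<phi> \<tau> (n div k, t, s)"
        then obtain q m where o: "edge_over G H \<phi> e (n div k) q m"
          "t = (if q then real m * u else len H (n div k) - real m * u)" "s = (r = q)"
          unfolding tau tangent_over.simps by blast
        obtain n' where n': "n' \<in> edges C" "n' div k = n div k" "edge_over G C \<phi>' e n' q m"
          using lift[OF e(1) o(1)] by blast
        have t': "t = (if q then real m * u else len C n' - real m * u)" using o(2) n'(2) by simp
        have "par C n' t = \<phi>' P"
          unfolding t' using n'(3) e(2,3) unfolding edge_over_def by metis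
        \<comment> \<open>Both sheets carry the point \<open>\<phi>' P\<close> at the same parameter
          over the same edge.\<close>
        then have "n = n'"
          using lift_unique[OF nC(1) n'(1) n'(2)[symmetric] nC(2,3)] nC(4) by metis
        with n'(3) t' o(3) show "tangent_over G C \<phi>' \<tau> (n, t, s)"
          unfolding tau tangent_over.simps by blast
      qed
    qed
    have sl: "slope G C \<phi>' (fst \<tau>) = slope G H \<phi> (fst \<tau>)"
      if \<tau>: "\<tau> \<in> tangents G P" "tangent_over G C \<phi>' \<tau> (n, t, s)" for \<tau>
    proof -
      obtain e u r where tau: "\<tau> = (e, u, r)" by (cases \<tau>)
      have e: "e \<in> edges G" using \<tau>(1) by (auto simp: tau tangents_def)
      obtain q m where o: "edge_over G C \<phi>' e n q m"
        using \<tau>(2) unfolding tau tangent_over.simps by blast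
      show ?thesis
        using slope_over[OF c.G tropical_C e o] slope_over[OF c.G H e over_iff[OF e o]]
        by (simp add: tau)
    qed
    have "{\<tau> \<in> tangents G P. tangent_over G C \<phi>' \<tau> (n, t, s)} =
        {\<tau> \<in> tangents G P. tangent_over G H \<phi> \<tau> (n div k, t, s)}"
      using iff by blast
    then show ?thesis
      unfolding local_degree_def using sl by (intro sum.cong) auto
  qed
  have ld_const: "local_degree G C \<phi>' P w = local_degree G C \<phi>' P w'"
    if P: "P \<in> points G" and w: "w \<in> tangents C (\<phi>' P)" "w' \<in> tangents C (\<phi>' P)" for P w w'
  proof -
    obtain n t s n' t' s' where eq: "w = (n, t, s)" "w' = (n', t', s')" by (cases w; cases w')
    have "local_degree G H \<phi> P (n div k, t, s) = local_degree G H \<phi> P (n' div k, t', s')"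
      using c.harm P tan[OF P] w unfolding harmonic_on_def eq by blast
    then show ?thesis using ld[OF P] w unfolding eq by simp
  qed
  define hit where "hit n \<longleftrightarrow> (\<exists>e\<in>edges G. \<exists>s m. edge_over G C \<phi>' e n s m)" for n
  \<comment> \<open>Lying in the image is too weak to spread, since a vertex could be hit with local
    degree 0 only. Non-zero local degree in one direction is by harmonicity non-zero in all, so
    every edge at such a vertex has an edge of \<open>G\<close> over it.\<close>
  define X where "X = {x \<in> verts C. \<exists>P\<in>verts G. \<phi>' P = x \<and>
      (\<exists>w\<in>tangents C x. local_degree G C \<phi>' P w \<noteq> 0)}"
  have hit_from: "hit n" if n: "n \<in> edges C" and x: "x \<in> X" and end_: "x = src C n \<or> x = tgt C n" for n x
  proof -
    obtain P w0 where P: "P \<in> verts G" "\<phi>' P = x" "w0 \<in> tangents C x" "local_degree G C \<phi>' P w0 \<noteq> 0"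
      using x unfolding X_def by blast
    have PG: "P \<in> points G" using P(1) by (simp add: points_def)
    have l: "0 < len C n" using tropical_curveD(4)[OF tropical_C n] .
    obtain t s where w: "(n, t, s) \<in> tangents C x"
    proof (cases "x = src C n")
      case True
      then have "(n, 0, True) \<in> tangents C x" using n l by (simp add: tangents_def src_def)
      then show ?thesis by (rule that)
    next
      case False
      then have "(n, len C n, False) \<in> tangents C x" using end_ n l by (simp add: tangents_def tgt_def)
      then show ?thesis by (rule that)
    qed
    have "local_degree G C \<phi>' P (n, t, s) \<noteq> 0"
      using ld_const[OF PG, of w0 "(n, t, s)"] P w by simp
    then have "{\<tau> \<in> tangents G P. tangent_over G C \<phi>' \<tau> (n, t, s)} \<noteq> {}"
      unfolding local_degree_def by (metis sum.empty)
    then obtain \<tau> where \<tau>: "\<tau> \<in> tangents G P" "tangent_over G C \<phi>' \<tau> (n, t, s)" by blast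
    obtain e u r where tau: "\<tau> = (e, u, r)" by (cases \<tau>)
    have "e \<in> edges G" using \<tau>(1) by (auto simp: tau tangents_def)
    moreover obtain q m where "edge_over G C \<phi>' e n q m"
      using \<tau>(2) unfolding tau tangent_over.simps by blast
    ultimately show "hit n" unfolding hit_def by blast
  qed
  have hit_to: "src C n \<in> X \<and> tgt C n \<in> X" if hn: "hit n" for n
  proof -
    obtain e s m where e: "e \<in> edges G" and o: "edge_over G C \<phi>' e n s m"
      using hn unfolding hit_def by blast
    have l: "0 < len G e" using DG(4)[OF e] .
    have n: "n \<in> edges C" "m > 0" "len C n = real m * len G e" using o by (simp_all add: edge_over_def)
    have lC: "0 < len C n" using tropical_curveD(4)[OF tropical_C n(1)] .
    have inX: "\<phi>' P \<in> X"
      if P: "P \<in> verts G" "(e, u, r) \<in> tangents G P" and w: "w \<in> tangents C (\<phi>' P)"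
        "tangent_over G C \<phi>' (e, u, r) w" for P u r w
    proof -
      have "slope G C \<phi>' (fst (e, u, r)) \<le> local_degree G C \<phi>' P w"
        unfolding local_degree_def
        by (rule member_le_sum[where f = "\<lambda>v. slope G C \<phi>' (fst v)"])
          (use that finite_tangents[OF c.G] in auto)
      moreover have "slope G C \<phi>' e = m" by (rule slope_over[OF c.G tropical_C e o])
      ultimately have "local_degree G C \<phi>' P w \<noteq> 0" using n(2) by simp
      then show ?thesis using P(1) w(1) vC[OF P(1)] unfolding X_def by blast
    qed
    have "src G e \<in> verts G" "tgt G e \<in> verts G" using DG(5,6)[OF e] by auto
    have s0: "\<phi>' (src G e) = (if s then src C n else tgt C n)"
      "\<phi>' (tgt G e) = (if s then tgt C n else src C n)"
      using o l n(3) unfolding edge_over_def src_def tgt_def by auto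
    have A: "(e, 0, True) \<in> tangents G (src G e)" "(e, len G e, False) \<in> tangents G (tgt G e)"
      using e l by (auto simp: tangents_def src_def tgt_def)
    have B: "(n, 0, True) \<in> tangents C (src C n)" "(n, len C n, False) \<in> tangents C (tgt C n)"
      using n lC by (auto simp: tangents_def src_def tgt_def)
    have B0: "(if s then (n, 0, True) else (n, len C n, False)) \<in> tangents C (\<phi>' (src G e))"
      "(if s then (n, len C n, False) else (n, 0, True)) \<in> tangents C (\<phi>' (tgt G e))"
      unfolding s0 using B by auto
    have T0: "tangent_over G C \<phi>' (e, 0, True) (if s then (n, 0, True) else (n, len C n, False))"
      using o by (cases s) (auto intro!: exI[of _ s] exI[of _ m] simp del: C_simps)
    have T1: "tangent_over G C \<phi>' (e, len G e, False) (if s then (n, len C n, False) else (n, 0, True))"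
      using o n(3) by (cases s) (auto intro!: exI[of _ s] exI[of _ m] simp del: C_simps)
    have "\<phi>' (src G e) \<in> X" using inX[OF DG(5)[OF e] A(1) B0(1) T0] .
    moreover have "\<phi>' (tgt G e) \<in> X" using inX[OF DG(6)[OF e] A(2) B0(2) T1] .
    ultimately show ?thesis using s0 by (cases s) auto
  qed
  \<comment> \<open>The starting point: some edge of \<open>G\<close> lies over \<open>e0\<close>,
    and its lift shows that \<open>X\<close> is not empty.\<close>
  have e0H: "e0 \<in> edges H" using e0 by blast
  obtain e s m where e: "e \<in> edges G" "edge_over G H \<phi> e e0 s m" using c.edge_hit[OF e0H] by blast
  obtain n0 where n0: "edge_over G C \<phi>' e n0 s m" using lift[OF e] by blast
  then have "hit n0" using e(1) unfolding hit_def by blast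
  then have x0: "src C n0 \<in> X" using hit_to by blast
  have XV: "X \<subseteq> verts C" by (auto simp: X_def)
  have allX: "x \<in> X" if x: "x \<in> verts C" for x
  proof (rule ccontr)
    assume "x \<notin> X"
    then obtain y z where yz: "(y, z) \<in> adj C (edges C)" "y \<in> X" "z \<notin> X"
      using rtrancl_leaves[OF tropical_curve_connected[OF tropical_C _ x] x0] XV x0 by blast
    then obtain n where "n \<in> edges C" "y = src C n \<and> z = tgt C n \<or> y = tgt C n \<and> z = src C n"
      unfolding adj_def by blast
    then show False using hit_from[of n y] hit_to[of n] yz by blast
  qed
  have "points C \<subseteq> \<phi>' ` points G"
  proof
    fix Q assume "Q \<in> points C"
    then consider "Q \<in> verts C" | n t where "n \<in> edges C" "0 < t" "t < len C n" "Q = par C n t"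
      by (auto simp: points_def open_edge_def)
    then show "Q \<in> \<phi>' ` points G"
    proof cases
      case 1
      then show ?thesis using allX[OF 1] unfolding X_def points_def by blast
    next
      case 2
      have "src C n \<in> X" using allX tropical_curveD(5)[OF tropical_C 2(1)] by blast
      then have "hit n" using hit_from[OF 2(1)] by blast
      then obtain e s m where e: "e \<in> edges G" and o: "edge_over G C \<phi>' e n s m"
        unfolding hit_def by blast
      have m: "m > 0" "len C n = real m * len G e" using o by (simp_all add: edge_over_def)
      define u where "u = (if s then t else len C n - t) / real m"
      have mu: "real m * u = (if s then t else len C n - t)" using m(1) by (simp add: u_def)
      have "0 \<le> real m * u" "real m * u \<le> real m * len G e" using mu m(2) 2 by auto
      then have u: "0 \<le> u" "u \<le> len G e" using m(1) by (auto simp: zero_le_mult_iff)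
      have "\<phi>' (par G e u) = par C n (if s then real m * u else len C n - real m * u)"
        using o u unfolding edge_over_def by simp
      also have "\<dots> = Q" using mu 2(4) by (cases s) auto
      finally show ?thesis using par_points[OF c.G e u] by blast
    qed
  qed
  then have "\<phi>' ` points G = points C" using ptsC by blast
  moreover have "continuous_map (realization_top G) (realization_top C) \<phi>'"
    by (rule continuous_edgewise[OF c.G tropical_C ptsC edge'])
  moreover have "\<phi>' ` verts G \<subseteq> verts C" using vC by blast
  ultimately show ?thesis
    unfolding harmonic_on_def using edge' ld_const by blast
qed

end

subsection \<open>Optimal covers are surjective on cycles\<close>

text \<open>The potential modulo \<open>k\<close> factors \<open>\<phi>\<close> through the cyclic
  cover \<open>C\<close>, a curve of genus one. Optimality forces \<open>\<psi>\<close> to have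
  degree 1, while its degree is \<open>k\<close>.\<close>

lemma optimal_no_divisor:
  fixes \<Gamma> G :: "'p mgraph" and TE H :: "'q mgraph"
  assumes opt: "optimal_cover \<Gamma> TE \<phi>" and g1: "genus H = 1"
    and GM: "model_of G \<Gamma>" and HM: "model_of H TE" and harm: "harmonic_on G H \<phi>"
    and T: "spanning_tree H T" and e0: "edges H - T = {e0}"
    and k: "k > 0" and dvd: "\<And>a. a \<in> carrier (cycles G) \<Longrightarrow> int k dvd pushforward_cycle G H \<phi> a e0"
  shows "k = 1"
proof -
  have tG: "tropical_curve G" and tH: "tropical_curve H" using GM HM by (auto simp: model_of_def)
  have cm: "cover_model G H \<phi>" by unfold_locales (rule tG tH harm)+
  obtain ix :: "'q \<Rightarrow> nat" where ix: "inj_on ix (verts H)"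
    using finite_imp_inj_to_nat_seg[OF tropical_curveD(1)[OF tH]] by blast
  interpret cyclic_cover H T e0 k ix
    by unfold_locales (rule tH T e0 k ix)+
  \<comment> \<open>The voltage lives on \<open>e0\<close> alone, so the coefficient at
    \<open>e0\<close> of the push-forward is the total sheet shift along the cycle
    \<open>a\<close>.\<close>
  have "int k dvd (\<Sum>e\<in>edges G. a e * edge_sign G H \<phi> e e0)" if "a \<in> carrier (cycles G)" for a
  proof -
    have "e0 \<in> edges H" using e0 by blast
    then show ?thesis using dvd[OF that] by (simp add: pushforward_cycle_def mult.commute)
  qed
  then obtain p :: "'p \<Rightarrow> int" where
    p: "\<forall>e\<in>edges G. int k dvd edge_sign G H \<phi> e e0 - (p (tgt G e) - p (src G e))"
    using potential_mod[OF tG, of "int k" "\<lambda>e. edge_sign G H \<phi> e e0"] by blast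
  have "\<exists>\<phi>'. (\<forall>v\<in>verts G. \<phi>' v = cvert (\<phi> v) (p v)) \<and> (\<forall>P\<in>points G. \<psi> (\<phi>' P) = \<phi> P) \<and>
    (\<forall>e\<in>edges G.
      (\<exists>n s m. n \<in> edges C \<and> edge_over G H \<phi> e (n div k) s m \<and> edge_over G C \<phi>' e n s m) \<or>
      (edge_contracted G H \<phi> e \<and> edge_contracted G C \<phi>' e))"
    using p by (intro lift_exists[OF cm]) (rule bspec)
  then obtain \<phi>' where v: "\<forall>v\<in>verts G. \<phi>' v = cvert (\<phi> v) (p v)"
      and proj: "\<forall>P\<in>points G. \<psi> (\<phi>' P) = \<phi> P"
      and edge: "\<forall>e\<in>edges G.
        (\<exists>n s m. n \<in> edges C \<and> edge_over G H \<phi> e (n div k) s m \<and> edge_over G C \<phi>' e n s m) \<or>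
        (edge_contracted G H \<phi> e \<and> edge_contracted G C \<phi>' e)"
    by (elim exE conjE)
  have "harmonic_on G C \<phi>'"
    by (rule harmonic_lift[OF cm bspec[OF v] bspec[OF proj] bspec[OF edge]])
  then have "tropical_cover \<Gamma> C \<phi>'"
    using GM model_of_refl[OF tropical_C] unfolding tropical_cover_def by blast
  moreover have "tropical_cover C TE \<psi>"
    using HM model_of_refl[OF tropical_C] harmonic_psi unfolding tropical_cover_def by blast
  moreover have "\<forall>P\<in>points \<Gamma>. \<phi> P = \<psi> (\<phi>' P)" using proj model_of_points[OF GM] by simp
  ultimately have "has_degree C TE \<psi> 1"
    using opt tropical_C genus_C[OF g1] unfolding optimal_cover_def by blast
  then have "fibre_degree C H \<psi> 1"
    by (rule has_degree_fibre_degree[OF _ model_of_refl[OF tropical_C] HM harmonic_psi])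
  from psi_degree[OF this] show ?thesis by simp
qed

text \<open>Division with remainder by the least positive element.\<close>

lemma int_subgroup_generator:
  fixes I :: "int set"
  assumes add: "\<And>x y. x \<in> I \<Longrightarrow> y \<in> I \<Longrightarrow> x + y \<in> I" and neg: "\<And>x. x \<in> I \<Longrightarrow> - x \<in> I"
    and nz: "x0 \<in> I" "x0 \<noteq> 0"
  shows "\<exists>g\<in>I. g > 0 \<and> (\<forall>x\<in>I. g dvd x)"
proof -
  define g where "g = (LEAST n::nat. n > 0 \<and> int n \<in> I)"
  have "nat \<bar>x0\<bar> > 0 \<and> int (nat \<bar>x0\<bar>) \<in> I" using nz neg[OF nz(1)] by (auto simp: abs_if)
  then have g: "g > 0" "int g \<in> I" unfolding g_def using LeastI[of "\<lambda>n. n > 0 \<and> int n \<in> I"] by blast+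
  have least: "g \<le> n" if "n > 0" "int n \<in> I" for n
    unfolding g_def using that by (intro Least_le) auto
  have zero: "0 \<in> I" using add[OF nz(1) neg[OF nz(1)]] by simp
  have natmul: "int n * int g \<in> I" for n
    by (induction n) (use zero add g(2) in \<open>auto simp: distrib_right\<close>)
  have mul: "z * int g \<in> I" for z
    using natmul[of "nat z"] neg[OF natmul[of "nat (- z)"]] by (cases "z \<ge> 0") auto
  have "int g dvd x" if x: "x \<in> I" for x
  proof -
    have r: "x mod int g \<in> I"
      using add[OF x mul[of "- (x div int g)"]] by (simp add: minus_div_mult_eq_mod)
    have "0 \<le> x mod int g" "x mod int g < int g" using g(1) by auto
    then have "x mod int g = 0"
      using least[of "nat (x mod int g)"] r by (cases "x mod int g = 0") auto
    then show ?thesis by (simp add: mod_eq_0_iff_dvd)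
  qed
  then show ?thesis using g by (intro bexI[of _ "int g"]) auto
qed

lemma pushforward_add: "pushforward_cycle G H \<phi> (\<lambda>e. a e + b e) =
    (\<lambda>e. pushforward_cycle G H \<phi> a e + pushforward_cycle G H \<phi> b e)"
  by (auto simp: pushforward_cycle_def fun_eq_iff distrib_left sum.distrib)

lemma pushforward_scale: "pushforward_cycle G H \<phi> (\<lambda>e. c * a e) =
    (\<lambda>e. c * pushforward_cycle G H \<phi> a e)"
  by (auto simp: pushforward_cycle_def fun_eq_iff sum_distrib_left mult.left_commute)

lemma pullback_add: "pullback_form G H \<phi> (\<lambda>e. a e + b e) =
    (\<lambda>e. pullback_form G H \<phi> a e + pullback_form G H \<phi> b e)"
  by (auto simp: pullback_form_def fun_eq_iff distrib_left sum.distrib)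

text \<open>The coefficients at \<open>e0\<close> of push-forwards form a non-zero subgroup of the
  integers. Its positive generator divides all of them and is 1 by
  \<open>optimal_no_divisor\<close>.\<close>

lemma optimal_surjective:
  fixes \<Gamma> G :: "'p mgraph" and TE H :: "'q mgraph"
  assumes opt: "optimal_cover \<Gamma> TE \<phi>" and g1: "genus H = 1"
    and G: "model_of G \<Gamma>" and H: "model_of H TE" and harm: "harmonic_on G H \<phi>"
    and T: "spanning_tree H T" and e0: "edges H - T = {e0}"
    and nz: "a0 \<in> carrier (cycles G)" "pushforward_cycle G H \<phi> a0 e0 \<noteq> 0"
  shows "\<exists>a\<in>carrier (cycles G). pushforward_cycle G H \<phi> a e0 = 1"
proof -
  define I where "I = (\<lambda>a. pushforward_cycle G H \<phi> a e0) ` carrier (cycles G)"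
  have "\<exists>g\<in>I. g > 0 \<and> (\<forall>x\<in>I. g dvd x)"
  proof (rule int_subgroup_generator)
    show "pushforward_cycle G H \<phi> a0 e0 \<in> I" "pushforward_cycle G H \<phi> a0 e0 \<noteq> 0"
      using nz by (auto simp: I_def)
    show "x + y \<in> I" if xy: "x \<in> I" "y \<in> I" for x y
    proof -
      obtain a b where "a \<in> carrier (cycles G)" "b \<in> carrier (cycles G)"
        "x = pushforward_cycle G H \<phi> a e0" "y = pushforward_cycle G H \<phi> b e0"
        using xy unfolding I_def by blast
      then show ?thesis
        unfolding I_def
        by (intro image_eqI[of _ _ "\<lambda>e. a e + b e"]) (auto simp: pushforward_add cycles_add)
    qed
    show "- x \<in> I" if x: "x \<in> I" for x
    proof -
      obtain a where "a \<in> carrier (cycles G)" "x = pushforward_cycle G H \<phi> a e0"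
        using x unfolding I_def by blast
      then show ?thesis
        unfolding I_def using cycles_scale[of a G "- 1"] pushforward_scale[of G H \<phi> "- 1" a]
        by (intro image_eqI[of _ _ "\<lambda>e. - 1 * a e"]) auto
    qed
  qed
  then obtain g where g: "g \<in> I" "g > 0" "\<forall>x\<in>I. g dvd x" by blast
  have "nat g = 1"
    by (rule optimal_no_divisor[OF opt g1 G H harm T e0]) (use g in \<open>auto simp: I_def\<close>)
  then have "g = 1" by simp
  then show ?thesis using g(1) by (auto simp: I_def)
qed

section \<open>Integral tori in coordinates\<close>

text \<open>An isomorphism with the integral vectors of length \<open>n\<close>, given by coordinate
  functions. Only indices below \<open>n\<close> count, so for \<open>n = 1\<close> a function
  constant in the index is allowed.\<close>

definition int_coords :: "nat \<Rightarrow> 'a monoid \<Rightarrow> ('a \<Rightarrow> nat \<Rightarrow> int) \<Rightarrow> bool" where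
  "int_coords n K c \<longleftrightarrow> comm_group K \<and>
     (\<forall>x\<in>carrier K. \<forall>y\<in>carrier K. \<forall>i<n. c (x \<otimes>\<^bsub>K\<^esub> y) i = c x i + c y i) \<and>
     (\<forall>x\<in>carrier K. \<forall>y\<in>carrier K. (\<forall>i<n. c x i = c y i) \<longrightarrow> x = y) \<and>
     (\<forall>f. \<exists>x\<in>carrier K. \<forall>i<n. c x i = f i)"

text \<open>The isomorphism inverts the coordinate map: the chosen \<open>h v\<close> is the only
  element with the coordinates of \<open>v\<close>.\<close>

lemma int_coords_iso:
  assumes c: "int_coords n K c"
  shows "\<exists>h\<in>iso (free_Abelian_group {..<n}) K.
    \<forall>j<n. h (frag_of j) \<in> carrier K \<and> (\<forall>i<n. c (h (frag_of j)) i = (if i = j then 1 else 0))"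
proof -
  have K: "comm_group K"
    and add: "\<And>x y i. x \<in> carrier K \<Longrightarrow> y \<in> carrier K \<Longrightarrow> i < n \<Longrightarrow> c (x \<otimes>\<^bsub>K\<^esub> y) i = c x i + c y i"
    and inj: "\<And>x y. x \<in> carrier K \<Longrightarrow> y \<in> carrier K \<Longrightarrow> (\<And>i. i < n \<Longrightarrow> c x i = c y i) \<Longrightarrow> x = y"
    and surj: "\<And>f. \<exists>x\<in>carrier K. \<forall>i<n. c x i = f i"
    using c unfolding int_coords_def by blast+
  interpret K: comm_group K by (rule K)
  define h :: "(nat \<Rightarrow>\<^sub>0 int) \<Rightarrow> 'a"
    where "h v = (SOME x. x \<in> carrier K \<and> (\<forall>i<n. c x i = Poly_Mapping.lookup v i))" for v
  have h: "h v \<in> carrier K" "i < n \<Longrightarrow> c (h v) i = Poly_Mapping.lookup v i" for v i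
  proof -
    have "\<exists>x. x \<in> carrier K \<and> (\<forall>i<n. c x i = Poly_Mapping.lookup v i)" using surj by blast
    from someI_ex[OF this] show "h v \<in> carrier K" "i < n \<Longrightarrow> c (h v) i = Poly_Mapping.lookup v i"
      unfolding h_def by blast+
  qed
  have hom: "h \<in> hom (free_Abelian_group {..<n}) K"
  proof (rule homI)
    fix v w
    show "h (v \<otimes>\<^bsub>free_Abelian_group {..<n}\<^esub> w) = h v \<otimes>\<^bsub>K\<^esub> h w"
      by (rule inj) (auto simp: h add lookup_add)
  qed (rule h(1))
  have "bij_betw h (carrier (free_Abelian_group {..<n})) (carrier K)"
    unfolding bij_betw_def
  proof
    show "inj_on h (carrier (free_Abelian_group {..<n}))"
    proof (rule inj_onI)
      fix v w assume vw: "v \<in> carrier (free_Abelian_group {..<n})" "w \<in> carrier (free_Abelian_group {..<n})"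
        "h v = h w"
      show "v = w"
      proof (rule poly_mapping_eqI)
        fix i
        show "Poly_Mapping.lookup v i = Poly_Mapping.lookup w i"
        proof (cases "i < n")
          case True
          then show ?thesis using h(2)[of i v] h(2)[of i w] vw(3) by simp
        next
          case False
          then have "i \<notin> Poly_Mapping.keys v" "i \<notin> Poly_Mapping.keys w" using vw(1,2) by auto
          then show ?thesis by (simp add: in_keys_iff)
        qed
      qed
    qed
    show "h ` carrier (free_Abelian_group {..<n}) = carrier K"
    proof
      show "carrier K \<subseteq> h ` carrier (free_Abelian_group {..<n})"
      proof
        fix x assume x: "x \<in> carrier K"
        define v where "v = Poly_Mapping.Abs_poly_mapping (\<lambda>i. if i < n then c x i else 0)"
        have v: "Poly_Mapping.lookup v = (\<lambda>i. if i < n then c x i else 0)"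
          unfolding v_def by (rule lookup_Abs_poly_mapping) simp
        have "v \<in> carrier (free_Abelian_group {..<n})"
          using v by (auto simp: in_keys_iff split: if_splits)
        moreover have "x = h v" by (rule inj[OF x h(1)]) (simp add: h v)
        ultimately show "x \<in> h ` carrier (free_Abelian_group {..<n})" by blast
      qed
    qed (use h(1) in blast)
  qed
  with hom have "h \<in> iso (free_Abelian_group {..<n}) K" by (rule isoI)
  moreover have "\<forall>j<n. h (frag_of j) \<in> carrier K \<and> (\<forall>i<n. c (h (frag_of j)) i = (if i = j then 1 else 0))"
    using h by (auto simp: lookup_single)
  ultimately show ?thesis by blast
qed

definition dual_basis :: "nat \<Rightarrow> 'a monoid \<Rightarrow> ('a \<Rightarrow> nat \<Rightarrow> int) \<Rightarrow> (nat \<Rightarrow> 'a) \<Rightarrow> bool" where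
  "dual_basis n K c b \<longleftrightarrow>
     (\<forall>j<n. b j \<in> carrier K \<and> (\<forall>i<n. c (b j) i = (if i = j then 1 else 0)))"

text \<open>Non-degeneracy is asked for every dual basis, so that no use of this rule has to
  construct the isomorphisms that the definition of a torus requires.\<close>

lemma integral_torus_dimI:
  assumes c: "int_coords n (Lam S) c" and c': "int_coords n (Lam' S) c'" and bil: "bilinear_pairing S"
    and nd: "\<And>b b' r. dual_basis n (Lam S) c b \<Longrightarrow> dual_basis n (Lam' S) c' b' \<Longrightarrow>
      ((\<forall>i<n. (\<Sum>j<n. r j * pairing S (b i) (b' j)) = 0) \<longrightarrow> (\<forall>j<n. r j = 0)) \<and>
      ((\<forall>j<n. (\<Sum>i<n. r i * pairing S (b i) (b' j)) = 0) \<longrightarrow> (\<forall>i<n. r i = (0::real)))"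
  shows "integral_torus_dim n S"
proof -
  obtain h where h: "h \<in> iso (free_Abelian_group {..<n}) (Lam S)" "dual_basis n (Lam S) c (\<lambda>j. h (frag_of j))"
    using int_coords_iso[OF c] unfolding dual_basis_def by blast
  obtain h' where h': "h' \<in> iso (free_Abelian_group {..<n}) (Lam' S)"
    "dual_basis n (Lam' S) c' (\<lambda>j. h' (frag_of j))"
    using int_coords_iso[OF c'] unfolding dual_basis_def by blast
  have "comm_group (Lam S)" "comm_group (Lam' S)" using c c' by (auto simp: int_coords_def)
  then show ?thesis
    unfolding integral_torus_dim_def
    using bil h(1) h'(1) nd[OF h(2) h'(2)] by blast
qed

lemma integral_torus_dim1I:
  assumes "int_coords 1 (Lam S) (\<lambda>x i. c x)" "int_coords 1 (Lam' S) (\<lambda>x i. c' x)" "bilinear_pairing S"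
    and nz: "\<And>x b. x \<in> carrier (Lam S) \<Longrightarrow> b \<in> carrier (Lam' S) \<Longrightarrow> c x = 1 \<Longrightarrow> c' b = 1 \<Longrightarrow>
      pairing S x b \<noteq> 0"
  shows "integral_torus_dim 1 S"
proof (rule integral_torus_dimI[OF assms(1-3)], goal_cases)
  case (1 b b' r)
  then have "pairing S (b 0) (b' 0) \<noteq> 0" by (intro nz) (auto simp: dual_basis_def)
  then show ?case by simp
qed

lemma comm_group_DirProd:
  assumes "comm_group K" "comm_group L"
  shows "comm_group (K \<times>\<times> L)"
proof -
  interpret K: comm_group K by fact
  interpret L: comm_group L by fact
  show ?thesis
    by (rule group.group_comm_groupI[OF DirProd_group[OF K.is_group L.is_group]])
      (auto simp: K.m_comm L.m_comm)
qed

text \<open>In bases dual to the combined coordinates, the matrix of the pairing is diagonal with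
  non-zero entries.\<close>

lemma integral_torus_sum1:
  assumes S: "int_coords 1 (Lam S) (\<lambda>x i. c x)" "int_coords 1 (Lam' S) (\<lambda>x i. c' x)" "bilinear_pairing S"
    and S_nz: "\<And>x b. x \<in> carrier (Lam S) \<Longrightarrow> b \<in> carrier (Lam' S) \<Longrightarrow> c x = 1 \<Longrightarrow> c' b = 1 \<Longrightarrow>
      pairing S x b \<noteq> 0"
    and T: "int_coords 1 (Lam T) (\<lambda>x i. k x)" "int_coords 1 (Lam' T) (\<lambda>x i. k' x)" "bilinear_pairing T"
    and T_nz: "\<And>x b. x \<in> carrier (Lam T) \<Longrightarrow> b \<in> carrier (Lam' T) \<Longrightarrow> k x = 1 \<Longrightarrow> k' b = 1 \<Longrightarrow>
      pairing T x b \<noteq> 0"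
  shows "integral_torus (torus_sum S T)"
proof -
  have lam [simp]: "Lam (torus_sum S T) = Lam S \<times>\<times> Lam T" "Lam' (torus_sum S T) = Lam' S \<times>\<times> Lam' T"
    and pair [simp]: "pairing (torus_sum S T) (x, y) (b, d) = pairing S x b + pairing T y d" for x y b d
    by (simp_all add: torus_sum_def)
  have coords: "int_coords 2 (K \<times>\<times> L) (\<lambda>z i. if i = 0 then c (fst z) else d (snd z))"
    if K: "int_coords 1 K (\<lambda>x i. c x)" and L: "int_coords 1 L (\<lambda>x i. d x)" for K L c d
    unfolding int_coords_def
  proof (intro conjI allI)
    show "comm_group (K \<times>\<times> L)" using K L by (intro comm_group_DirProd) (auto simp: int_coords_def)
    show "\<exists>x\<in>carrier (K \<times>\<times> L). \<forall>i<2::nat. (if i = 0 then c (fst x) else d (snd x)) = f i" for f :: "nat \<Rightarrow> int"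
    proof -
      have "\<exists>x\<in>carrier K. \<forall>i<1::nat. c x = f i" "\<exists>y\<in>carrier L. \<forall>i<1::nat. d y = f (Suc i)"
        using K L by (simp_all only: int_coords_def)
      then obtain x y where "x \<in> carrier K" "c x = f 0" "y \<in> carrier L" "d y = f 1"
        by auto
      then show ?thesis by (intro bexI[of _ "(x, y)"]) (auto simp: less_2_cases_iff)
    qed
  next
    show "\<forall>x\<in>carrier (K \<times>\<times> L). \<forall>y\<in>carrier (K \<times>\<times> L). \<forall>i<2.
       (if i = 0 then c (fst (x \<otimes>\<^bsub>K \<times>\<times> L\<^esub> y)) else d (snd (x \<otimes>\<^bsub>K \<times>\<times> L\<^esub> y))) =
       (if i = 0 then c (fst x) else d (snd x)) + (if i = 0 then c (fst y) else d (snd y))"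
      using K L by (auto simp: int_coords_def)
    show "\<forall>x\<in>carrier (K \<times>\<times> L). \<forall>y\<in>carrier (K \<times>\<times> L).
       (\<forall>i<2::nat. (if i = 0 then c (fst x) else d (snd x)) = (if i = 0 then c (fst y) else d (snd y))) \<longrightarrow> x = y"
    proof (intro ballI impI)
      fix x y assume xy: "x \<in> carrier (K \<times>\<times> L)" "y \<in> carrier (K \<times>\<times> L)"
        and eq: "\<forall>i<2::nat. (if i = 0 then c (fst x) else d (snd x)) = (if i = 0 then c (fst y) else d (snd y))"
      have "c (fst x) = c (fst y)" "d (snd x) = d (snd y)" using eq[rule_format, of 0] eq[rule_format, of 1] by auto
      moreover have "fst x \<in> carrier K" "fst y \<in> carrier K" "snd x \<in> carrier L" "snd y \<in> carrier L"
        using xy by auto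
      ultimately have "fst x = fst y" "snd x = snd y" using K L unfolding int_coords_def by blast+
      then show "x = y" by (simp add: prod_eq_iff)
    qed
  qed
  have all2: "(\<forall>i<2. Q i) \<longleftrightarrow> Q 0 \<and> Q 1" for Q :: "nat \<Rightarrow> bool"
    by (auto simp: less_2_cases_iff)
  have sum2: "(\<Sum>j<2. g j) = g 0 + g 1" for g :: "nat \<Rightarrow> real"
    by (simp add: numeral_2_eq_2)
  have "integral_torus_dim 2 (torus_sum S T)"
  proof (rule integral_torus_dimI)
    show "int_coords 2 (Lam (torus_sum S T)) (\<lambda>z i. if i = 0 then c (fst z) else k (snd z))"
      unfolding lam by (rule coords[OF S(1) T(1)])
    show "int_coords 2 (Lam' (torus_sum S T)) (\<lambda>z i. if i = 0 then c' (fst z) else k' (snd z))"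
      unfolding lam by (rule coords[OF S(2) T(2)])
    show "bilinear_pairing (torus_sum S T)"
      using S(3) T(3) by (auto simp: bilinear_pairing_def torus_sum_def)
    fix b b' and r :: "nat \<Rightarrow> real"
    assume b: "dual_basis 2 (Lam (torus_sum S T)) (\<lambda>z i. if i = 0 then c (fst z) else k (snd z)) b"
      and b': "dual_basis 2 (Lam' (torus_sum S T)) (\<lambda>z i. if i = 0 then c' (fst z) else k' (snd z)) b'"
    obtain x0 y0 x1 y1 x0' y0' x1' y1' where eq: "b 0 = (x0, y0)" "b 1 = (x1, y1)" "b' 0 = (x0', y0')" "b' 1 = (x1', y1')"
      by (metis surj_pair)
    have b0: "x0 \<in> carrier (Lam S)" "y0 \<in> carrier (Lam T)" "c x0 = 1" "k y0 = 0"
      and b1: "x1 \<in> carrier (Lam S)" "y1 \<in> carrier (Lam T)" "c x1 = 0" "k y1 = 1"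
      using b eq unfolding dual_basis_def lam by (force simp: less_2_cases_iff dest: spec[of _ 0] spec[of _ 1])+
    have b0': "x0' \<in> carrier (Lam' S)" "y0' \<in> carrier (Lam' T)" "c' x0' = 1" "k' y0' = 0"
      and b1': "x1' \<in> carrier (Lam' S)" "y1' \<in> carrier (Lam' T)" "c' x1' = 0" "k' y1' = 1"
      using b' eq unfolding dual_basis_def lam by (force simp: less_2_cases_iff dest: spec[of _ 0] spec[of _ 1])+
    \<comment> \<open>In rank one, coordinate 0 forces the neutral element, which pairs to 0; this
      kills the off-diagonal entries.\<close>
    have zero: "z = \<one>\<^bsub>K\<^esub>" if K: "int_coords 1 K (\<lambda>x i. c x)" and z: "z \<in> carrier K" "c z = 0" for z K and c :: "'z \<Rightarrow> int"
    proof -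
      interpret comm_group K using K by (simp add: int_coords_def)
      have "c (\<one>\<^bsub>K\<^esub> \<otimes>\<^bsub>K\<^esub> \<one>\<^bsub>K\<^esub>) = c \<one>\<^bsub>K\<^esub> + c \<one>\<^bsub>K\<^esub>"
        using K one_closed unfolding int_coords_def by blast
      then have "c \<one>\<^bsub>K\<^esub> = 0" by simp
      then show ?thesis using K z one_closed unfolding int_coords_def by auto
    qed
    have z: "x1 = \<one>\<^bsub>Lam S\<^esub>" "y0 = \<one>\<^bsub>Lam T\<^esub>"
      using zero[OF S(1) b1(1,3)] zero[OF T(1) b0(2,4)] by auto
    have pz: "pairing Z \<one>\<^bsub>Lam Z\<^esub> d = 0" if "bilinear_pairing Z" "comm_group (Lam Z)" "d \<in> carrier (Lam' Z)"
      for Z :: "('y, 'z) itorus" and d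
    proof -
      interpret comm_group "Lam Z" by fact
      have "pairing Z (\<one>\<^bsub>Lam Z\<^esub> \<otimes>\<^bsub>Lam Z\<^esub> \<one>\<^bsub>Lam Z\<^esub>) d = pairing Z \<one>\<^bsub>Lam Z\<^esub> d + pairing Z \<one>\<^bsub>Lam Z\<^esub> d"
        using that(1,3) one_closed unfolding bilinear_pairing_def by blast
      then show ?thesis by simp
    qed
    have cg: "comm_group (Lam S)" "comm_group (Lam T)" using S(1) T(1) by (auto simp: int_coords_def)
    have "pairing S x1 x0' = 0" "pairing S x1 x1' = 0" "pairing T y0 y0' = 0" "pairing T y0 y1' = 0"
      unfolding z by (rule pz[OF S(3) cg(1)] pz[OF T(3) cg(2)]; use b0' b1' in blast)+
    moreover have z': "x1' = \<one>\<^bsub>Lam' S\<^esub>" "y0' = \<one>\<^bsub>Lam' T\<^esub>"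
      using zero[OF S(2) b1'(1,3)] zero[OF T(2) b0'(2,4)] by auto
    have pz': "pairing Z d \<one>\<^bsub>Lam' Z\<^esub> = 0" if "bilinear_pairing Z" "comm_group (Lam' Z)" "d \<in> carrier (Lam Z)"
      for Z :: "('y, 'z) itorus" and d
    proof -
      interpret comm_group "Lam' Z" by fact
      have "pairing Z d (\<one>\<^bsub>Lam' Z\<^esub> \<otimes>\<^bsub>Lam' Z\<^esub> \<one>\<^bsub>Lam' Z\<^esub>) = pairing Z d \<one>\<^bsub>Lam' Z\<^esub> + pairing Z d \<one>\<^bsub>Lam' Z\<^esub>"
        using that(1,3) one_closed unfolding bilinear_pairing_def by blast
      then show ?thesis by simp
    qed
    have cg': "comm_group (Lam' S)" "comm_group (Lam' T)" using S(2) T(2) by (auto simp: int_coords_def)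
    have "pairing S x0 x1' = 0" "pairing T y1 y0' = 0"
      unfolding z' by (rule pz'[OF S(3) cg'(1)] pz'[OF T(3) cg'(2)]; use b0 b1 in blast)+
    moreover have "pairing S x0 x0' \<noteq> 0" "pairing T y1 y1' \<noteq> 0"
      using S_nz[OF b0(1) b0'(1) b0(3) b0'(3)] T_nz[OF b1(2) b1'(2) b1(4) b1'(4)] by auto
    ultimately show "((\<forall>i<2. (\<Sum>j<2. r j * pairing (torus_sum S T) (b i) (b' j)) = 0) \<longrightarrow> (\<forall>j<2. r j = 0)) \<and>
      ((\<forall>j<2. (\<Sum>i<2. r i * pairing (torus_sum S T) (b i) (b' j)) = 0) \<longrightarrow> (\<forall>i<2. r i = 0))"
      unfolding all2 sum2 eq by simp
  qed
  then show ?thesis unfolding integral_torus_def by blast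
qed

section \<open>Jacobians of curves of genus one and two\<close>

lemma comm_group_cycles: "comm_group (cycles G)"
proof (rule comm_groupI)
  show "\<exists>y\<in>carrier (cycles G). y \<otimes>\<^bsub>cycles G\<^esub> x = \<one>\<^bsub>cycles G\<^esub>" if "x \<in> carrier (cycles G)" for x
    using cycles_scale[OF that, of "- 1"] by (intro bexI[of _ "\<lambda>e. - 1 * x e"]) auto
qed (auto simp: cycles_add cycles_zero)

lemma cycles_pow: "x [^]\<^bsub>cycles G\<^esub> (n::nat) = (\<lambda>e. int n * x e)"
  by (induction n) (auto simp: algebra_simps cycles_def coefficient_group_def)

lemma cycles_inv: "x \<in> carrier (cycles G) \<Longrightarrow> inv\<^bsub>cycles G\<^esub> x = (\<lambda>e. - x e)"
  using cycles_scale[of x G "- 1"]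
  by (intro group.inv_equality comm_group.axioms(2)[OF comm_group_cycles]) auto

lemma cycles_diff: "x \<in> carrier (cycles G) \<Longrightarrow> y \<in> carrier (cycles G) \<Longrightarrow> (\<lambda>e. x e - y e) \<in> carrier (cycles G)"
  using cycles_add[of x G "\<lambda>e. - 1 * y e"] cycles_scale[of y G "- 1"] by simp

lemma Lam_Jac [simp]: "tropical_curve G \<Longrightarrow> Lam (Jac G) = cycles G" "Lam' (Jac G) = cycles G"
  by (simp_all add: Jac_def harmonic_forms_eq_cycles tropical_curveD)

lemma Jac_pairing:
  "pairing (Jac G) (\<lambda>e. a e + b e) x = pairing (Jac G) a x + pairing (Jac G) b x"
  "pairing (Jac G) x (\<lambda>e. a e + b e) = pairing (Jac G) x a + pairing (Jac G) x b"
  "pairing (Jac G) (\<lambda>e. a e - b e) x = pairing (Jac G) a x - pairing (Jac G) b x"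
  "pairing (Jac G) x (\<lambda>e. a e - b e) = pairing (Jac G) x a - pairing (Jac G) x b"
  "pairing (Jac G) (\<lambda>e. c * a e) x = of_int c * pairing (Jac G) a x"
  "pairing (Jac G) x (\<lambda>e. c * a e) = of_int c * pairing (Jac G) x a"
  "pairing (Jac G) a b = pairing (Jac G) b a"
  by (simp_all add: Jac_def sum.distrib sum_subtractf sum_distrib_left algebra_simps)

lemma Jac_bilinear: "tropical_curve G \<Longrightarrow> bilinear_pairing (Jac G)"
  by (simp add: bilinear_pairing_def Jac_pairing)

lemma Jac_positive:
  assumes G: "tropical_curve G" and a: "a \<in> carrier (cycles G)" and z: "pairing (Jac G) a a = 0"
  shows "a = (\<lambda>_. 0)"
proof -
  have "(\<Sum>e\<in>edges G. of_int (a e * a e) * len G e) = 0" using z by (simp add: Jac_def)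
  then have "\<forall>e\<in>edges G. of_int (a e * a e) * len G e = 0"
    using tropical_curveD(3,4)[OF G] by (subst (asm) sum_nonneg_eq_0_iff) (auto simp: less_imp_le)
  then have "\<forall>e\<in>edges G. a e = 0" using tropical_curveD(4)[OF G] by force
  then show ?thesis using a by (auto simp: cycles_iff fun_eq_iff)
qed

lemma cycles_coords:
  assumes G: "tropical_curve G" and T: "spanning_tree G T" and E: "edges G - T = f ` {..<n}"
    and f: "inj_on f {..<n}"
  shows "int_coords n (cycles G) (\<lambda>x i. x (f i))"
  unfolding int_coords_def
proof (intro conjI ballI allI impI)
  show "comm_group (cycles G)" by (rule comm_group_cycles)
  show "x = y" if "x \<in> carrier (cycles G)" "y \<in> carrier (cycles G)" "\<forall>i<n. x (f i) = y (f i)" for x y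
    using that by (intro cycle_eqI[OF G T]) (auto simp: E)
  show "\<exists>x\<in>carrier (cycles G). \<forall>i<n. x (f i) = g i" for g
  proof -
    obtain x where "x \<in> carrier (cycles G)" "\<forall>e\<in>edges G - T. x e = g (inv_into {..<n} f e)"
      using cycle_extend[OF G T, of "\<lambda>e. g (inv_into {..<n} f e)"] by (elim bexE)
    then show ?thesis using f by (intro bexI[of _ x]) (auto simp: E)
  qed
qed simp

text \<open>Forms and cycles have the same coordinates, hence the same dual basis, and the matrix of
  the pairing is a Gram matrix. The coefficients \<open>r\<close> are real, so
  \<open>Jac_positive\<close>, which concerns integral cycles, does not suffice and a sum of squares
  is expanded afresh.\<close>

lemma Jac_dim:
  assumes G: "tropical_curve G" and T: "spanning_tree G T" and E: "edges G - T = f ` {..<n}"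
    and f: "inj_on f {..<n}"
  shows "integral_torus_dim n (Jac G)"
proof (rule integral_torus_dimI)
  note c = cycles_coords[OF assms]
  show "int_coords n (Lam (Jac G)) (\<lambda>x i. x (f i))" "int_coords n (Lam' (Jac G)) (\<lambda>x i. x (f i))"
    using c G by simp_all
  show "bilinear_pairing (Jac G)" by (rule Jac_bilinear[OF G])
  fix b b' and r :: "nat \<Rightarrow> real"
  assume b: "dual_basis n (Lam (Jac G)) (\<lambda>x i. x (f i)) b" and b': "dual_basis n (Lam' (Jac G)) (\<lambda>x i. x (f i)) b'"
  have "b j = b' j" if "j < n" for j
    using b b' that c G unfolding dual_basis_def int_coords_def by simp
  then have sym: "pairing (Jac G) (b i) (b' j) = pairing (Jac G) (b j) (b' i)" if "i < n" "j < n" for i j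
    using that Jac_pairing(7)[of G "b i" "b' j"] by simp
  have bb: "b i = b' i" if "i < n" for i using \<open>\<And>j. j < n \<Longrightarrow> b j = b' j\<close> that .
  have main: "\<forall>j<n. r j = 0" if z: "\<forall>i<n. (\<Sum>j<n. r j * pairing (Jac G) (b i) (b' j)) = 0"
  proof -
    have "(\<Sum>e\<in>edges G. (\<Sum>i<n. r i * b i e)\<^sup>2 * len G e) =
        (\<Sum>e\<in>edges G. \<Sum>i<n. \<Sum>j<n. r i * (r j * (b i e * b' j e * len G e)))"
      unfolding power2_eq_square sum_distrib_right
      by (intro sum.cong refl) (auto simp: bb sum_distrib_left mult_ac)
    also have "\<dots> = (\<Sum>i<n. r i * (\<Sum>j<n. r j * pairing (Jac G) (b i) (b' j)))"
      unfolding Jac_def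
      by (simp add: sum_distrib_left sum.swap[of _ "edges G"])
    also have "\<dots> = 0" using z by simp
    finally have "\<forall>e\<in>edges G. (\<Sum>i<n. r i * b i e)\<^sup>2 * len G e = 0"
      using tropical_curveD(3,4)[OF G] by (subst (asm) sum_nonneg_eq_0_iff) (auto simp: less_imp_le)
    then have *: "(\<Sum>i<n. r i * b i e) = 0" if "e \<in> edges G" for e
      using tropical_curveD(4)[OF G that] that by force
    show ?thesis
    proof (intro allI impI)
      fix j assume j: "j < n"
      then have "f j \<in> edges G" using E by blast
      \<comment> \<open>The edge \<open>f j\<close> is the coordinate dual to \<open>b j\<close>, so
        evaluating there isolates \<open>r j\<close>.\<close>
      moreover have "(\<Sum>i<n. r i * b i (f j)) = (\<Sum>i<n. if i = j then r j else 0)"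
        using b j by (intro sum.cong) (auto simp: dual_basis_def)
      ultimately show "r j = 0" using * j by simp
    qed
  qed
  moreover have "(\<Sum>i<n. r i * pairing (Jac G) (b i) (b' j)) = (\<Sum>i<n. r i * pairing (Jac G) (b j) (b' i))"
    if "j < n" for j using sym that by (intro sum.cong) auto
  ultimately show "((\<forall>i<n. (\<Sum>j<n. r j * pairing (Jac G) (b i) (b' j)) = 0) \<longrightarrow> (\<forall>j<n. r j = 0)) \<and>
      ((\<forall>j<n. (\<Sum>i<n. r i * pairing (Jac G) (b i) (b' j)) = 0) \<longrightarrow> (\<forall>i<n. r i = 0))"
    by auto
qed

section \<open>Splitting the Jacobian\<close>

text \<open>Collects what the lattice argument uses: genus two as the coordinates \<open>p\<close>,
  \<open>q\<close>, genus one as the coordinate \<open>e0\<close>, the degree as \<open>deg\<close>,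
  and optimality as \<open>surj1\<close>.\<close>

locale split_cover = cover_model G H \<phi>
  for G :: "'p mgraph" and H :: "'q mgraph" and \<phi> :: "'p \<Rightarrow> 'q" +
  fixes d :: nat and TG TH :: "nat set" and p q e0 :: nat
  assumes TG: "spanning_tree G TG" and pq: "edges G - TG = {p, q}" "p \<noteq> q"
    and TH: "spanning_tree H TH" and e0: "edges H - TH = {e0}"
    and deg: "\<And>\<omega>. \<omega> \<in> carrier (cycles H) \<Longrightarrow>
      pushforward_cycle G H \<phi> (pullback_form G H \<phi> \<omega>) = (\<lambda>e. int d * \<omega> e)"
    and d: "d > 0"
    and surj1: "\<exists>a\<in>carrier (cycles G). pushforward_cycle G H \<phi> a e0 = 1"
begin

abbreviation "L \<equiv> carrier (cycles G)"
abbreviation "M \<equiv> carrier (cycles H)"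
abbreviation "push \<equiv> pushforward_cycle G H \<phi>"
abbreviation "pull \<equiv> pullback_form G H \<phi>"
abbreviation "f \<equiv> push_forward G H \<phi>"
abbreviation "ip \<equiv> pairing (Jac G)"
abbreviation "ipH \<equiv> pairing (Jac H)"
definition "N = sat_image (Jac G) (Jac H) f"
abbreviation "Ker \<equiv> {a \<in> L. push a = (\<lambda>_. 0)}"
abbreviation "KT \<equiv> Ker0 (Jac G) (Jac H) f"
abbreviation "cl x \<equiv> N #>\<^bsub>cycles G\<^esub> x"

lemma f_simps [simp]: "fst f = pull" "snd f = push"
  by (simp_all add: push_forward_def)

lemma pull_scale: "pull (\<lambda>e. c * a e) = (\<lambda>e. c * pull a e)"
  by (auto simp: pullback_form_def fun_eq_iff sum_distrib_left mult.left_commute)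

lemma push_zero: "push (\<lambda>_. 0) = (\<lambda>_. 0)"
  by (auto simp: pushforward_cycle_def)

lemma push_diff: "push (\<lambda>e. a e - b e) = (\<lambda>e. push a e - push b e)"
  using pushforward_add[of G H \<phi> a "\<lambda>e. - 1 * b e"] pushforward_scale[of G H \<phi> "- 1" b] by simp

lemma adj_push: "ip (pull y) a = ipH y (push a)"
  by (rule adjoint)

lemma eqG: "x \<in> L \<Longrightarrow> y \<in> L \<Longrightarrow> x p = y p \<Longrightarrow> x q = y q \<Longrightarrow> x = y"
  by (rule cycle_eqI[OF G TG]) (auto simp: pq)

lemma exG: "\<exists>x\<in>L. x p = m \<and> x q = n"
proof -
  obtain x where "x \<in> L" "\<forall>e\<in>edges G - TG. x e = (if e = p then m else n)"
    using cycle_extend[OF G TG, of "\<lambda>e. if e = p then m else n"] by (elim bexE)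
  then show ?thesis using pq by (intro bexI[of _ x]) auto
qed

lemma eqH: "x \<in> M \<Longrightarrow> y \<in> M \<Longrightarrow> x e0 = y e0 \<Longrightarrow> x = y"
  by (rule cycle_eqI[OF H TH]) (auto simp: e0)

section \<open>Generators and determinant coordinates for the lattices of
  \<open>Ker0\<close>\<close>

definition B :: "nat \<Rightarrow> int" where "B = (SOME b. b \<in> M \<and> b e0 = 1)"

lemma B: "B \<in> M" "B e0 = 1"
proof -
  obtain x where "x \<in> M" "\<forall>e\<in>edges H - TH. x e = 1"
    using cycle_extend[OF H TH, of "\<lambda>e. 1"] by (elim bexE)
  then have "\<exists>b. b \<in> M \<and> b e0 = 1" using e0 by auto
  from someI_ex[OF this] show "B \<in> M" "B e0 = 1" unfolding B_def by blast+
qed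

lemma M_eq: "y \<in> M \<Longrightarrow> y = (\<lambda>e. y e0 * B e)"
  by (rule eqH) (auto simp: B cycles_scale)

text \<open>Spans the pulled-back forms, so the saturation \<open>N\<close> consists of the cycles
  proportional to \<open>U\<close>.\<close>

definition U :: "nat \<Rightarrow> int" where "U = pull B"

lemma U: "U \<in> L" "push U = (\<lambda>e. int d * B e)"
  unfolding U_def by (rule pullback_closed[OF B(1)], rule deg[OF B(1)])

lemma pull_eq: "y \<in> M \<Longrightarrow> pull y = (\<lambda>e. y e0 * U e)"
  using pull_scale[of "y e0" B] M_eq[of y] by (simp add: U_def)

lemma push_surj: "y \<in> M \<Longrightarrow> \<exists>a\<in>L. push a = y"
proof -
  assume y: "y \<in> M"
  obtain a where a: "a \<in> L" "push a e0 = 1" using surj1 by blast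
  have "push (\<lambda>e. y e0 * a e) = y"
    by (rule eqH) (use a y pushforward_closed[OF cycles_scale[OF a(1), of "y e0"]] in \<open>auto simp: pushforward_scale\<close>)
  then show ?thesis using cycles_scale[OF a(1)] by blast
qed

text \<open>The two-by-two determinant in the coordinates \<open>p\<close>, \<open>q\<close>. It
  vanishes exactly on linearly dependent pairs and thereby detects saturations.\<close>

definition dtm :: "(nat \<Rightarrow> int) \<Rightarrow> (nat \<Rightarrow> int) \<Rightarrow> int" where
  "dtm x y = x p * y q - x q * y p"

lemma dtm_linear:
  "dtm (\<lambda>e. x e + y e) z = dtm x z + dtm y z" "dtm (\<lambda>e. x e - y e) z = dtm x z - dtm y z"
  "dtm (\<lambda>e. - x e) z = - dtm x z" "dtm (\<lambda>e. c * x e) z = c * dtm x z"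
  by (simp_all add: dtm_def algebra_simps)

lemma U_nz: "U p \<noteq> 0 \<or> U q \<noteq> 0"
proof (rule ccontr)
  assume "\<not> (U p \<noteq> 0 \<or> U q \<noteq> 0)"
  then have "U = (\<lambda>_. 0)" by (intro eqG U cycles_zero) auto
  then have "push U e0 = 0" by (simp add: push_zero)
  then show False using U(2) B(2) d by simp
qed

lemma pow_image: "(\<lambda>e. c * U e) \<in> pull ` M"
  using B(1) by (intro image_eqI[of _ _ "\<lambda>e. c * B e"]) (auto simp: pull_scale U_def cycles_scale)

text \<open>A multiple of \<open>x\<close> is a multiple of \<open>U\<close> exactly when the two
  are linearly dependent, and \<open>U\<close> is not 0.\<close>

lemma N_iff: "x \<in> N \<longleftrightarrow> x \<in> L \<and> dtm x U = 0"
proof -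
  have memN: "x \<in> N \<longleftrightarrow> x \<in> L \<and> (\<exists>n::nat. n > 0 \<and> (\<lambda>e. int n * x e) \<in> pull ` M)"
    using G H by (simp add: N_def saturation_def cycles_pow)
  show ?thesis
  proof
    assume "x \<in> N"
    then obtain n :: nat and y where n: "n > 0" "y \<in> M" "(\<lambda>e. int n * x e) = pull y" and x: "x \<in> L"
      using memN by blast
    have "int n * dtm x U = dtm (\<lambda>e. int n * x e) U" by (simp add: dtm_linear)
    also have "\<dots> = y e0 * dtm U U" unfolding n(3) pull_eq[OF n(2)] by (simp add: dtm_linear)
    also have "dtm U U = 0" by (simp add: dtm_def)
    finally show "x \<in> L \<and> dtm x U = 0" using n(1) x by simp
  next
    assume x: "x \<in> L \<and> dtm x U = 0"
    obtain r where r: "U r \<noteq> 0" "r = p \<or> r = q" using U_nz by blast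
    have rs: "U r * x s = x r * U s" if "s = p \<or> s = q" for s
      using x r(2) that by (auto simp: dtm_def algebra_simps)
    \<comment> \<open>Dependence gives \<open>U r\<close> times \<open>x\<close> equal to
      \<open>x r\<close> times \<open>U\<close>. The exponent in a saturation must be positive, so
      the sign of \<open>U r\<close> moves to the other side.\<close>
    define n where "n = nat \<bar>U r\<bar>"
    have n: "n > 0" "int n = sgn (U r) * U r" using r(1) by (auto simp: n_def sgn_if abs_if)
    have "(\<lambda>e. int n * x e) = (\<lambda>e. (sgn (U r) * x r) * U e)"
      using rs x U(1) n(2) by (intro eqG cycles_scale) (auto simp: mult.assoc)
    then have "(\<lambda>e. int n * x e) \<in> pull ` M" using pow_image by simp
    then show "x \<in> N" using memN x n(1) by blast
  qed
qed

interpretation CG: comm_group "cycles G" by (rule comm_group_cycles)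

lemma N_subgroup: "subgroup N (cycles G)"
proof (rule CG.subgroupI)
  show "N \<subseteq> L" using N_iff by blast
  show "N \<noteq> {}" using N_iff[of "\<lambda>_. 0"] cycles_zero by (auto simp: dtm_def)
  fix a assume a: "a \<in> N"
  then show "inv\<^bsub>cycles G\<^esub> a \<in> N"
    using N_iff[of a] N_iff[of "\<lambda>e. - a e"] CG.inv_closed[of a] by (simp add: cycles_inv dtm_linear)
  fix b assume "b \<in> N"
  with a show "a \<otimes>\<^bsub>cycles G\<^esub> b \<in> N"
    using N_iff[of a] N_iff[of b] N_iff[of "\<lambda>e. a e + b e"] by (simp add: cycles_add dtm_linear)
qed

lemma N_normal: "normal N (cycles G)"
  using CG.normal_iff_subgroup N_subgroup by blast

text \<open>The homomorphism given by the determinant against \<open>U\<close> has kernel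
  \<open>N\<close>, hence it is an injective coordinate on the quotient.\<close>

lemma cl_eq: "x \<in> L \<Longrightarrow> y \<in> L \<Longrightarrow> cl x = cl y \<longleftrightarrow> dtm x U = dtm y U"
  using CG.rcos_eq_iff[OF N_subgroup, of x y] N_iff[of "\<lambda>e. x e - y e"]
  by (simp add: cycles_inv cycles_diff dtm_linear)

lemma cl_add: "x \<in> L \<Longrightarrow> y \<in> L \<Longrightarrow> cl x <#>\<^bsub>cycles G\<^esub> cl y = cl (\<lambda>e. x e + y e)"
  using normal.rcos_sum[OF N_normal, of x y] by simp

lemma N_eq_cl: "N = cl (\<lambda>_. 0)"
  using CG.coset_join2[OF cycles_zero N_subgroup] subgroup.one_closed[OF N_subgroup] by simp

lemma cl_N: "x \<in> N \<Longrightarrow> cl x = N"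
  using CG.coset_join2[OF _ N_subgroup, of x] N_iff by blast

lemma pull_N: "y \<in> M \<Longrightarrow> pull y \<in> N"
proof -
  assume y: "y \<in> M"
  have "dtm (pull y) U = 0" unfolding pull_eq[OF y] dtm_linear by (simp add: dtm_def)
  then show "pull y \<in> N" unfolding N_iff using pullback_closed[OF y] by blast
qed

abbreviation "rep C \<equiv> (SOME x. x \<in> C)"

lemma rep: assumes "x \<in> L" shows "rep (cl x) \<in> L" "cl (rep (cl x)) = cl x"
proof -
  have "x \<in> cl x" by (rule CG.rcos_self[OF assms N_subgroup])
  then have r: "rep (cl x) \<in> cl x" by (rule someI[of "\<lambda>z. z \<in> cl x" x])
  then show "rep (cl x) \<in> L"
    by (rule subgroup.elemrcos_carrier[OF N_subgroup CG.is_group assms])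
  show "cl (rep (cl x)) = cl x"
    by (rule CG.repr_independence[OF r assms N_subgroup, symmetric])
qed

lemma Lam_KT [simp]: "Lam KT = cycles G Mod N" "Lam' KT = (cycles G)\<lparr>carrier := Ker\<rparr>"
  using G H by (simp_all add: Ker0_def kernel_def N_def)

lemma carrier_Lam_KT: "carrier (cycles G Mod N) = cl ` L"
  by (simp add: carrier_FactGroup)

text \<open>\<open>n\<close> is proportional to \<open>U = pull B\<close>, and by adjointness
  \<open>U\<close> pairs with \<open>a\<close> as \<open>B\<close> does with
  \<open>push a = 0\<close>. This is why the induced pairing of \<open>Ker0\<close> does not depend
  on representatives.\<close>

lemma N_perp: assumes "n \<in> N" "a \<in> Ker" shows "ip n a = 0"
proof -
  obtain r where r: "U r \<noteq> 0" "r = p \<or> r = q" using U_nz by blast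
  have n: "n \<in> L" "dtm n U = 0" using N_iff assms(1) by blast+
  have "(\<lambda>e. U r * n e) = (\<lambda>e. n r * U e)"
    using n r(2) U(1) by (intro eqG cycles_scale) (auto simp: dtm_def algebra_simps)
  then have "of_int (U r) * ip n a = of_int (n r) * ip U a"
    using Jac_pairing(5)[of G "U r" n a] Jac_pairing(5)[of G "n r" U a] by simp
  also have "ip U a = ipH B (\<lambda>_. 0)" using assms(2) adj_push[of B a] by (simp add: U_def)
  also have "\<dots> = 0" by (simp add: Jac_def)
  finally show ?thesis using r(1) by simp
qed

lemma pairing_KT:
  assumes "x \<in> L" "a \<in> Ker"
  shows "pairing KT (cl x) a = ip x a"
proof -
  have "(\<lambda>e. rep (cl x) e - x e) \<in> N"
    using rep[OF assms(1)] cl_eq[of "rep (cl x)" x] assms(1) N_iff by (simp add: cycles_diff dtm_linear)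
  from N_perp[OF this assms(2)] have "ip (rep (cl x)) a = ip x a" by (simp add: Jac_pairing)
  then show ?thesis by (simp add: Ker0_def)
qed

definition a1 :: "nat \<Rightarrow> int" where "a1 = (SOME a. a \<in> L \<and> push a e0 = 1)"

lemma a1: "a1 \<in> L" "push a1 e0 = 1"
  using surj1 someI_ex[of "\<lambda>a. a \<in> L \<and> push a e0 = 1"] unfolding a1_def by blast+

lemma push_coords: "\<exists>m n. \<forall>a\<in>L. push a e0 = a p * m + a q * n"
proof -
  obtain b where b: "b \<in> L" "b p = 1" "b q = 0" using exG by blast
  obtain c where c: "c \<in> L" "c p = 0" "c q = 1" using exG by blast
  have "push a e0 = a p * push b e0 + a q * push c e0" if a: "a \<in> L" for a
  proof -
    have "a = (\<lambda>e. a p * b e + a q * c e)"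
      by (rule eqG[OF a]) (auto simp: b c cycles_add cycles_scale)
    then have "push a = push (\<lambda>e. a p * b e + a q * c e)" by simp
    then show ?thesis by (simp add: pushforward_add pushforward_scale)
  qed
  then show ?thesis by blast
qed

lemma Ker_iff: "a \<in> Ker \<longleftrightarrow> a \<in> L \<and> push a e0 = 0"
proof
  assume "a \<in> L \<and> push a e0 = 0"
  then show "a \<in> Ker" using eqH[OF pushforward_closed[of a] cycles_zero] by blast
qed simp

lemma Ker_subgroup: "subgroup Ker (cycles G)"
proof (rule CG.subgroupI)
  show "Ker \<noteq> {}" using cycles_zero push_zero by blast
  fix a assume a: "a \<in> Ker"
  then show "inv\<^bsub>cycles G\<^esub> a \<in> Ker"
    using push_diff[of "\<lambda>_. 0" a] CG.inv_closed[of a] by (simp add: cycles_inv push_zero)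
  fix b assume "b \<in> Ker"
  with a show "a \<otimes>\<^bsub>cycles G\<^esub> b \<in> Ker" by (simp add: cycles_add pushforward_add)
qed auto

lemma comm_group_Ker: "comm_group ((cycles G)\<lparr>carrier := Ker\<rparr>)"
  by (rule group.group_comm_groupI[OF subgroup.subgroup_is_group[OF Ker_subgroup CG.is_group]])
    (auto simp: add.commute)

text \<open>\<open>push a e0\<close> is a linear form \<open>a p * m + a q * n\<close> with value 1
  on \<open>a1\<close>. Hence a generator of its kernel completes \<open>a1\<close> to a basis, and
  the determinant against \<open>a1\<close> is an integral coordinate on the kernel.\<close>

lemma Ker_coords: "int_coords 1 (Lam' KT) (\<lambda>a i. dtm a a1)"
proof -
  obtain m n where mn: "\<And>a. a \<in> L \<Longrightarrow> push a e0 = a p * m + a q * n" using push_coords by blast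
  have one: "a1 p * m + a1 q * n = 1" using mn[OF a1(1)] a1(2) by simp
  have inj: "a = b" if ab: "a \<in> Ker" "b \<in> Ker" "dtm a a1 = dtm b a1" for a b
  proof -
    define x where "x = (\<lambda>e. a e - b e)"
    have x: "x p * m + x q * n = 0" using mn[of a] mn[of b] ab by (simp add: x_def algebra_simps)
    have dx: "dtm x a1 = 0" using ab(3) by (simp add: x_def dtm_linear)
    \<comment> \<open>Cramer's rule for the two linear forms \<open>a p * m + a q * n\<close> and
      \<open>dtm a a1\<close>, whose determinant is 1 up to sign.\<close>
    have "x p = x p * (a1 p * m + a1 q * n)" using one by simp
    also have "\<dots> = n * dtm x a1 + a1 p * (x p * m + x q * n)" by (simp add: dtm_def algebra_simps)
    finally have "x p = 0" using x dx by simp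
    have "x q = x q * (a1 p * m + a1 q * n)" using one by simp
    also have "\<dots> = - m * dtm x a1 + a1 q * (x p * m + x q * n)" by (simp add: dtm_def algebra_simps)
    finally have "x q = 0" using x dx by simp
    then show "a = b" using \<open>x p = 0\<close> ab by (intro eqG) (auto simp: x_def)
  qed
  have surj: "\<exists>a\<in>Ker. dtm a a1 = z" for z
  proof -
    \<comment> \<open>The vector \<open>(n, - m)\<close> is annihilated by the linear form and has
      determinant 1 against \<open>a1\<close>.\<close>
    obtain a where a: "a \<in> L" "a p = z * n" "a q = - z * m" using exG by blast
    have "push a e0 = 0" using mn[OF a(1)] a by (simp add: algebra_simps)
    moreover have "dtm a a1 = z * (a1 p * m + a1 q * n)" using a by (simp add: dtm_def algebra_simps)
    ultimately show ?thesis using a(1) one Ker_iff by auto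
  qed
  show ?thesis
    unfolding int_coords_def Lam_KT
  proof (intro conjI ballI allI impI)
    fix x y assume "x \<in> carrier (cycles G\<lparr>carrier := Ker\<rparr>)" "y \<in> carrier (cycles G\<lparr>carrier := Ker\<rparr>)"
      "\<forall>i<1::nat. dtm x a1 = dtm y a1"
    then show "x = y" using inj[of x y] by simp
  next
    fix h :: "nat \<Rightarrow> int"
    show "\<exists>x\<in>carrier (cycles G\<lparr>carrier := Ker\<rparr>). \<forall>i<1. dtm x a1 = h i"
      using surj[of "h 0"] by simp
  qed (simp_all add: comm_group_Ker dtm_linear)
qed

text \<open>By Bezout the values of \<open>dtm x U\<close> are exactly the multiples of
  \<open>g\<close>, so dividing by \<open>g\<close> makes the determinant onto the integers.\<close>

definition g :: int where "g = gcd (U p) (U q)"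

lemma g: "g > 0" "g dvd dtm x U"
  using U_nz by (auto simp: g_def dtm_def)

lemma KT_coords: "int_coords 1 (Lam KT) (\<lambda>C i. dtm (rep C) U div g)"
proof -
  have rep_dtm: "dtm (rep (cl x)) U = dtm x U" if "x \<in> L" for x
    using rep[OF that] cl_eq[of "rep (cl x)" x] that by simp
  have "\<exists>x\<in>L. dtm x U div g = z" for z
  proof -
    obtain s t where st: "s * U p + t * U q = g" using bezout_int[of "U p" "U q"] by (auto simp: g_def)
    \<comment> \<open>Expanding the determinant of this cycle against \<open>U\<close> gives
      \<open>z\<close> times the Bezout sum.\<close>
    obtain x where x: "x \<in> L" "x p = z * t" "x q = - z * s" using exG by blast
    have "dtm x U = z * (s * U p + t * U q)" using x by (simp add: dtm_def algebra_simps)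
    then have "dtm x U div g = z" using st g(1) by simp
    then show ?thesis using x(1) by blast
  qed
  moreover have "(dtm x U + dtm y U) div g = dtm x U div g + dtm y U div g" for x y
    using g(2) by (simp add: div_plus_div_distrib_dvd_left)
  moreover have "dtm x U div g = dtm y U div g \<longleftrightarrow> dtm x U = dtm y U" for x y
    using g by (metis dvd_div_mult_self)
  ultimately show ?thesis
    unfolding int_coords_def Lam_KT carrier_Lam_KT
    using CG.abelian_FactGroup[OF N_subgroup]
    by (simp add: cl_add rep_dtm cycles_add dtm_linear cl_eq)
qed

lemma KT_bilinear: "bilinear_pairing KT"
  unfolding bilinear_pairing_def Lam_KT carrier_Lam_KT
  using subgroup.m_closed[OF Ker_subgroup]
  by (auto simp: cl_add pairing_KT cycles_add pushforward_add Jac_pairing)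

text \<open>If the pairing vanished, \<open>a\<close> would be orthogonal to a representative
  \<open>x\<close> of \<open>C\<close> and, lying in \<open>Ker\<close>, also to \<open>U\<close>.
  These two span the cycles over the rationals, so \<open>a\<close> would be orthogonal to
  itself.\<close>

lemma KT_nz:
  assumes "C \<in> carrier (Lam KT)" "a \<in> carrier (Lam' KT)" "dtm (rep C) U div g = 1" "dtm a a1 = 1"
  shows "pairing KT C a \<noteq> 0"
proof
  assume z: "pairing KT C a = 0"
  obtain x0 where x0: "x0 \<in> L" "C = cl x0" using assms(1) unfolding Lam_KT carrier_Lam_KT by blast
  define x where "x = rep C"
  have x: "x \<in> L" "C = cl x" using rep[OF x0(1)] x0(2) by (simp_all add: x_def)
  have a: "a \<in> Ker" "a \<in> L" using assms(2) by simp_all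
  have dx: "dtm x U \<noteq> 0" using assms(3) by (auto simp: x_def)
  have ipx: "ip x a = 0" using z pairing_KT[OF x(1) a(1)] x(2) by simp
  have "U \<in> N" using N_iff U(1) by (simp add: dtm_def)
  then have ipU: "ip U a = 0" using N_perp a(1) by blast
  \<comment> \<open>Cramer's rule in rank two: \<open>a\<close> is a combination of \<open>x\<close>
    and \<open>U\<close> with determinants as coefficients.\<close>
  have "(\<lambda>e. dtm x U * a e) = (\<lambda>e. dtm a U * x e + dtm x a * U e)"
  proof (rule eqG)
    show "(\<lambda>e. dtm x U * a e) \<in> L" by (rule cycles_scale[OF a(2)])
    show "(\<lambda>e. dtm a U * x e + dtm x a * U e) \<in> L"
      by (rule cycles_add[OF cycles_scale[OF x(1)] cycles_scale[OF U(1)]])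
  qed (simp_all add: dtm_def algebra_simps)
  then have "ip (\<lambda>e. dtm x U * a e) a = ip (\<lambda>e. dtm a U * x e + dtm x a * U e) a" by simp
  then have "of_int (dtm x U) * ip a a = 0" by (simp add: Jac_pairing(1-6) ipx ipU)
  then have "ip a a = 0" using dx by simp
  then have "a = (\<lambda>_. 0)" using Jac_positive[OF G a(2)] by blast
  then show False using assms(4) by (simp add: dtm_def)
qed

lemma KT_dim: "integral_torus_dim 1 KT"
  by (rule integral_torus_dim1I[OF KT_coords Ker_coords KT_bilinear KT_nz])

lemma torus_KT: "integral_torus KT"
  using KT_dim unfolding integral_torus_def by blast

lemma torus_JG: "integral_torus (Jac G)"
proof -
  have "integral_torus_dim 2 (Jac G)"
    by (rule Jac_dim[OF G TG, of "\<lambda>i. if i = 0 then p else q"])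
      (use pq in \<open>auto simp: inj_on_def less_2_cases_iff lessThan_def image_def\<close>)
  then show ?thesis unfolding integral_torus_def by blast
qed

lemma JH_coords: "int_coords 1 (cycles H) (\<lambda>y i. y e0)"
  by (rule cycles_coords[OF H TH, of "\<lambda>i. e0"]) (auto simp: e0 inj_on_def)

lemma torus_JH: "integral_torus (Jac H)"
proof -
  have "integral_torus_dim 1 (Jac H)"
    by (rule Jac_dim[OF H TH, of "\<lambda>i. e0"]) (auto simp: e0 inj_on_def)
  then show ?thesis unfolding integral_torus_def by blast
qed

lemma torus_sum: "integral_torus (torus_sum KT (Jac H))"
proof (rule integral_torus_sum1[OF KT_coords Ker_coords KT_bilinear KT_nz])
  show "int_coords 1 (Lam (Jac H)) (\<lambda>y i. y e0)" "int_coords 1 (Lam' (Jac H)) (\<lambda>y i. y e0)"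
    using JH_coords H by simp_all
  show "bilinear_pairing (Jac H)" by (rule Jac_bilinear[OF H])
  fix x b assume xb: "x \<in> carrier (Lam (Jac H))" "b \<in> carrier (Lam' (Jac H))" "x e0 = 1" "b e0 = 1"
  then have "x = b" using H by (intro eqH) auto
  then show "ipH x b \<noteq> 0" using Jac_positive[OF H, of x] xb H by auto
qed

lemma morphism_f: "torus_morphism (Jac G) (Jac H) f"
  unfolding torus_morphism_def using torus_JG torus_JH G H
  by (auto simp: hom_def pullback_closed pushforward_closed pullback_add pushforward_add adj_push)

end

lemma hom_into_restricted:
  "h \<in> hom A B \<Longrightarrow> h ` carrier A \<subseteq> X \<Longrightarrow> h \<in> hom A (B\<lparr>carrier := X\<rparr>)"
  by (auto simp: hom_def)

lemma hom_from_restricted: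
  assumes "h \<in> hom A B" "X \<subseteq> carrier A" "h ` X \<subseteq> Y"
  shows "h \<in> hom (A\<lparr>carrier := X\<rparr>) (B\<lparr>carrier := Y\<rparr>)"
proof (rule homI)
  fix x y assume "x \<in> carrier (A\<lparr>carrier := X\<rparr>)" "y \<in> carrier (A\<lparr>carrier := X\<rparr>)"
  then have "x \<in> carrier A" "y \<in> carrier A" using assms(2) by auto
  then show "h (x \<otimes>\<^bsub>A\<lparr>carrier := X\<rparr>\<^esub> y) = h x \<otimes>\<^bsub>B\<lparr>carrier := Y\<rparr>\<^esub> h y"
    using hom_mult[OF assms(1)] by simp
qed (use assms(3) in auto)

lemma Jac_pairing_zero: "pairing (Jac G) x (\<lambda>_. 0) = 0" "pairing (Jac G) (\<lambda>_. 0) x = 0"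
  by (simp_all add: Jac_def)

lemma cycles_dual:
  assumes "F \<in> carrier (real_dual (cycles G))"
  shows "x \<in> carrier (cycles G) \<Longrightarrow> y \<in> carrier (cycles G) \<Longrightarrow> F (\<lambda>e. x e + y e) = F x + F y"
    "F (\<lambda>_. 0) = 0" "x \<notin> carrier (cycles G) \<Longrightarrow> F x = 0"
    "x \<in> carrier (cycles G) \<Longrightarrow> F (\<lambda>e. int n * x e) = real n * F x"
    "x \<in> carrier (cycles G) \<Longrightarrow> y \<in> carrier (cycles G) \<Longrightarrow> F (\<lambda>e. x e - y e) = F x - F y"
proof -
  interpret comm_group "cycles G" by (rule comm_group_cycles)
  show add: "F (\<lambda>e. x e + y e) = F x + F y" if "x \<in> carrier (cycles G)" "y \<in> carrier (cycles G)" for x y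
    using assms that by (simp add: carrier_real_dual)
  show "F (\<lambda>_. 0) = 0" using real_dual_one[OF is_monoid assms] by simp
  show "x \<notin> carrier (cycles G) \<Longrightarrow> F x = 0" using assms by (simp add: carrier_real_dual)
  show "x \<in> carrier (cycles G) \<Longrightarrow> F (\<lambda>e. int n * x e) = real n * F x"
    using real_dual_nat_pow[OF is_monoid assms, of x n] by (simp add: cycles_pow)
  show "F (\<lambda>e. x e - y e) = F x - F y" if "x \<in> carrier (cycles G)" "y \<in> carrier (cycles G)"
    using add[OF cycles_diff[OF that] that(2)] by simp
qed

context split_cover
begin

interpretation CG: comm_group "cycles G" by (rule comm_group_cycles)

lemmas [simp] = G H

lemma period_G: "period (Jac G) a = (\<lambda>x. if x \<in> L then ip x a else 0)"
  by (simp add: period_def)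

lemma period_H: "period (Jac H) c = (\<lambda>y. if y \<in> M then ipH y c else 0)"
  by (simp add: period_def)

lemma periods_G: "F \<in> periods (Jac G) \<longleftrightarrow> (\<exists>a\<in>L. F = (\<lambda>x. if x \<in> L then ip x a else 0))"
  by (auto simp: periods_def period_G)

lemma periods_H: "F \<in> periods (Jac H) \<longleftrightarrow> (\<exists>c\<in>M. F = (\<lambda>y. if y \<in> M then ipH y c else 0))"
  by (auto simp: periods_def period_H)

lemma dual_map_f: "dual_map (Jac H) f F = (\<lambda>y. if y \<in> M then F (pull y) else 0)"
  by (auto simp: dual_map_def fun_eq_iff)

section \<open>The kernel of the push-forward as an elliptic curve\<close>

lemma ipH_nondeg:
  assumes "c \<in> M" "\<And>y. y \<in> M \<Longrightarrow> ipH y c = 0"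
  shows "c = (\<lambda>_. 0)"
  using Jac_positive[OF H assms(1) assms(2)[OF assms(1)]] .

text \<open>The functionals that vanish on pulled-back forms exactly and not just up to a period.
  Closure under real scaling gives \<open>V\<close> a connected image in the torus.\<close>

definition V :: "((nat \<Rightarrow> int) \<Rightarrow> real) set" where
  "V = {F \<in> carrier (real_dual (cycles G)). \<forall>y\<in>M. F (pull y) = 0}"

text \<open>The reals have no torsion, so vanishing on the pulled-back forms extends to their
  saturation.\<close>

lemma V_N:
  assumes F: "F \<in> V" and n: "n \<in> N"
  shows "F n = 0"
proof -
  have FD: "F \<in> carrier (real_dual (cycles G))" using F by (simp add: V_def)
  have "n \<in> saturation (cycles G) (pull ` M)" using n by (simp add: N_def)
  then obtain m :: nat and y where m: "m > 0" "y \<in> M" "(\<lambda>e. int m * n e) = pull y" and nL: "n \<in> L"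
    by (auto simp: saturation_def cycles_pow)
  have "real m * F n = F (pull y)" using cycles_dual(4)[OF FD nL, of m] m(3) by simp
  also have "\<dots> = 0" using F m(2) by (simp add: V_def)
  finally show ?thesis using m(1) by simp
qed

lemma V_rep:
  assumes F: "F \<in> V" and x: "x \<in> L"
  shows "F (rep (cl x)) = F x"
proof -
  note r = rep[OF x]
  have FD: "F \<in> carrier (real_dual (cycles G))" using F by (simp add: V_def)
  have "(\<lambda>e. rep (cl x) e - x e) \<in> N"
    using r x cl_eq[OF r(1) x] N_iff by (simp add: cycles_diff dtm_linear)
  from V_N[OF F this] show ?thesis using cycles_dual(5)[OF FD r(1) x] by simp
qed

definition descend :: "((nat \<Rightarrow> int) \<Rightarrow> real) \<Rightarrow> (nat \<Rightarrow> int) set \<Rightarrow> real" where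
  "descend F C = (if C \<in> cl ` L then F (rep C) else 0)"

lemma descend_cl: "F \<in> V \<Longrightarrow> x \<in> L \<Longrightarrow> descend F (cl x) = F x"
  by (simp add: descend_def V_rep)

lemma descend_dual:
  assumes F: "F \<in> V"
  shows "descend F \<in> carrier (real_dual (cycles G Mod N))"
  unfolding carrier_real_dual carrier_Lam_KT
proof (intro conjI ballI allI impI)
  have FD: "F \<in> carrier (real_dual (cycles G))" using F by (simp add: V_def)
  fix C D assume "C \<in> cl ` L" "D \<in> cl ` L"
  then obtain x y where xy: "x \<in> L" "C = cl x" "y \<in> L" "D = cl y" by blast
  have "C \<otimes>\<^bsub>cycles G Mod N\<^esub> D = cl (\<lambda>e. x e + y e)" using cl_add xy by simp
  then show "descend F (C \<otimes>\<^bsub>cycles G Mod N\<^esub> D) = descend F C + descend F D"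
    using xy descend_cl[OF F cycles_add[OF xy(1,3)]] descend_cl[OF F] cycles_dual(1)[OF FD xy(1,3)] by simp
qed (simp add: descend_def)

text \<open>If \<open>F\<close> restricts to the period of \<open>c\<close> along the pull-back,
  surjectivity on cycles gives \<open>a\<close> with \<open>push a = c\<close>, and subtracting the
  period of \<open>a\<close> moves \<open>F\<close> into \<open>V\<close> within its class. A cycle
  outside the image of \<open>push\<close> would produce a further component.\<close>

lemma carrier_kernel_f:
  "carrier (torus_kernel (Jac G) (Jac H) f) = torus_class (Jac G) ` V"
proof
  show "torus_class (Jac G) ` V \<subseteq> carrier (torus_kernel (Jac G) (Jac H) f)"
  proof
    fix X assume "X \<in> torus_class (Jac G) ` V"
    then obtain F where F: "F \<in> V" "X = torus_class (Jac G) F" by blast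
    have "dual_map (Jac H) f F = (\<lambda>y. if y \<in> M then ipH y (\<lambda>_. 0) else 0)"
      using F(1) by (auto simp: dual_map_f V_def Jac_pairing_zero)
    then have "dual_map (Jac H) f F \<in> periods (Jac H)"
      unfolding periods_H using cycles_zero by blast
    then show "X \<in> carrier (torus_kernel (Jac G) (Jac H) f)"
      unfolding carrier_torus_kernel[OF morphism_f] using F by (auto simp: V_def)
  qed
  show "carrier (torus_kernel (Jac G) (Jac H) f) \<subseteq> torus_class (Jac G) ` V"
  proof
    fix X assume "X \<in> carrier (torus_kernel (Jac G) (Jac H) f)"
    then obtain F where F: "F \<in> carrier (real_dual (cycles G))" "dual_map (Jac H) f F \<in> periods (Jac H)"
      "X = torus_class (Jac G) F"
      unfolding carrier_torus_kernel[OF morphism_f] by auto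
    obtain c where c: "c \<in> M" "dual_map (Jac H) f F = (\<lambda>y. if y \<in> M then ipH y c else 0)"
      using F(2) periods_H by blast
    obtain a where a: "a \<in> L" "push a = c" using push_surj[OF c(1)] by blast
    have per: "period (Jac G) a \<in> carrier (real_dual (cycles G))"
      by (auto simp: period_G carrier_real_dual Jac_pairing cycles_add)
    define F' where "F' = (\<lambda>x. F x - period (Jac G) a x)"
    have F': "F' \<in> carrier (real_dual (cycles G))" unfolding F'_def by (rule real_dual_diff[OF F(1) per])
    have "F (pull y) = ipH y c" if "y \<in> M" for y
      using fun_cong[OF c(2), of y] that by (simp add: dual_map_f)
    then have "F' \<in> V"
      using F' a by (auto simp: V_def F'_def period_G pullback_closed adj_push)
    moreover have "torus_class (Jac G) F = torus_class (Jac G) F'"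
      using torus_class_eq_iff[OF torus_JG, of F F'] F(1) F' a(1)
      by (simp add: F'_def periods_def)
    ultimately show "X \<in> torus_class (Jac G) ` V" using F(3) by blast
  qed
qed

lemma kernel_connected:
  "connectedin (torus_top (Jac G)) (carrier (torus_kernel (Jac G) (Jac H) f))"
  unfolding carrier_kernel_f
proof (rule connectedin_torus_top_lines)
  show "V \<subseteq> carrier (real_dual (Lam (Jac G)))" by (auto simp: V_def)
  show "(\<lambda>x. t * F x) \<in> V" if "F \<in> V" for F t
    using that by (auto simp: V_def carrier_real_dual distrib_left)
  have "(\<lambda>_. 0) \<in> V" by (auto simp: V_def carrier_real_dual)
  then show "V \<noteq> {}" by blast
qed

abbreviation "inc \<equiv> Ker0_inclusion (Jac G) (Jac H) f"

lemma inc_simps: "fst inc = (\<lambda>x. cl x)" "snd inc = (\<lambda>b. b)"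
  by (simp_all add: Ker0_inclusion_def N_def)

lemma morphism_inc: "torus_morphism KT (Jac G) inc"
  unfolding torus_morphism_def inc_simps
  using torus_KT torus_JG normal.r_coset_hom_Mod[OF N_normal] pairing_KT
  by (simp add: hom_def)

lemma dual_map_inc: "dual_map (Jac G) inc F = (\<lambda>x. if x \<in> L then F (cl x) else 0)"
  by (auto simp: dual_map_def inc_simps fun_eq_iff)

lemma periods_KT:
  "F \<in> periods KT \<longleftrightarrow> (\<exists>a\<in>Ker. \<forall>C. F C = (if C \<in> cl ` L then pairing KT C a else 0))"
  unfolding periods_def period_def Lam_KT carrier_Lam_KT by (auto simp: fun_eq_iff image_iff)

lemma dual_map_inc_V:
  assumes F: "F \<in> carrier (real_dual (cycles G Mod N))"
  shows "dual_map (Jac G) inc F \<in> V"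
proof -
  have "dual_map (Jac G) inc F \<in> carrier (real_dual (cycles G))"
    using dual_map_closed[OF morphism_inc, of F] F by simp
  moreover have "F N = 0"
    using real_dual_one[OF group.is_monoid F] normal.factorgroup_is_group[OF N_normal] by simp
  ultimately show ?thesis
    unfolding V_def dual_map_inc using cl_N[OF pull_N] by (auto simp: pullback_closed)
qed

text \<open>Injective because a period of \<open>Jac G\<close> that vanishes on pulled-back forms
  belongs to a cycle with push-forward 0, by non-degeneracy on \<open>H\<close>, and so is already a
  period of \<open>KT\<close>. Onto because functionals in \<open>V\<close> descend to the quotient
  by \<open>N\<close>.\<close>

lemma inclusion_iso:
  "torus_hom KT (Jac G) inc \<in> iso (torus_group KT) (torus_kernel (Jac G) (Jac H) f)"
proof (rule isoI)
  have carr: "carrier (torus_group KT) = torus_class KT ` carrier (real_dual (cycles G Mod N))"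
    by (simp add: carrier_torus_group)
  have val: "torus_hom KT (Jac G) inc (torus_class KT F) = torus_class (Jac G) (dual_map (Jac G) inc F)"
    if "F \<in> carrier (real_dual (cycles G Mod N))" for F
    using torus_hom_class[OF morphism_inc, of F] that by simp
  have img: "torus_hom KT (Jac G) inc ` carrier (torus_group KT) \<subseteq> carrier (torus_kernel (Jac G) (Jac H) f)"
    unfolding carr carrier_kernel_f using val dual_map_inc_V by auto
  show "torus_hom KT (Jac G) inc \<in> hom (torus_group KT) (torus_kernel (Jac G) (Jac H) f)"
    using hom_into_restricted[OF torus_hom_hom[OF morphism_inc] img]
    by (simp add: torus_kernel_def)
  show "bij_betw (torus_hom KT (Jac G) inc) (carrier (torus_group KT)) (carrier (torus_kernel (Jac G) (Jac H) f))"
    unfolding bij_betw_def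
  proof
    show "inj_on (torus_hom KT (Jac G) inc) (carrier (torus_group KT))"
    proof (rule inj_onI)
      fix X Y assume "X \<in> carrier (torus_group KT)" "Y \<in> carrier (torus_group KT)"
        and eq: "torus_hom KT (Jac G) inc X = torus_hom KT (Jac G) inc Y"
      then obtain F F' where F: "F \<in> carrier (real_dual (cycles G Mod N))" "X = torus_class KT F"
        "F' \<in> carrier (real_dual (cycles G Mod N))" "Y = torus_class KT F'"
        unfolding carr by blast
      have D: "dual_map (Jac G) inc F \<in> V" "dual_map (Jac G) inc F' \<in> V" using dual_map_inc_V F by auto
      have "torus_class (Jac G) (dual_map (Jac G) inc F) = torus_class (Jac G) (dual_map (Jac G) inc F')"
        using eq val F by simp
      then have "(\<lambda>x. dual_map (Jac G) inc F x - dual_map (Jac G) inc F' x) \<in> periods (Jac G)"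
        using torus_class_eq_iff[OF torus_JG] D by (simp add: V_def)
      then obtain a where a: "a \<in> L"
        "(\<lambda>x. dual_map (Jac G) inc F x - dual_map (Jac G) inc F' x) = (\<lambda>x. if x \<in> L then ip x a else 0)"
        unfolding periods_G by blast
      have a2: "F (cl x) - F' (cl x) = ip x a" if "x \<in> L" for x
        using fun_cong[OF a(2), of x] that by (simp add: dual_map_inc)
      have "ipH y (push a) = 0" if y: "y \<in> M" for y
        using fun_cong[OF a(2), of "pull y"] D y
        by (simp add: V_def pullback_closed adj_push)
      then have aK: "a \<in> Ker" using ipH_nondeg[OF pushforward_closed[OF a(1)]] a(1) by simp
      have "(\<lambda>C. F C - F' C) \<in> periods KT"
        unfolding periods_KT
      proof (intro bexI[OF _ aK] allI)
        fix C show "F C - F' C = (if C \<in> cl ` L then pairing KT C a else 0)"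
        proof (cases "C \<in> cl ` L")
          case True
          then obtain x where x: "x \<in> L" "C = cl x" by blast
          then show ?thesis using a2[OF x(1)] pairing_KT[OF x(1) aK] by simp
        next
          case False
          then show ?thesis using F unfolding carrier_real_dual carrier_Lam_KT by auto
        qed
      qed
      then show "X = Y" using torus_class_eq_iff[OF torus_KT, of F F'] F by simp
    qed
    show "torus_hom KT (Jac G) inc ` carrier (torus_group KT) = carrier (torus_kernel (Jac G) (Jac H) f)"
    proof
      show "carrier (torus_kernel (Jac G) (Jac H) f) \<subseteq> torus_hom KT (Jac G) inc ` carrier (torus_group KT)"
      proof
        fix X assume "X \<in> carrier (torus_kernel (Jac G) (Jac H) f)"
        then obtain F where F: "F \<in> V" "X = torus_class (Jac G) F" unfolding carrier_kernel_f by blast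
        have "dual_map (Jac G) inc (descend F) = F"
          using F(1) by (auto simp: dual_map_inc descend_cl V_def carrier_real_dual)
        then have "X = torus_hom KT (Jac G) inc (torus_class KT (descend F))"
          using val[OF descend_dual[OF F(1)]] F(2) by simp
        then show "X \<in> torus_hom KT (Jac G) inc ` carrier (torus_group KT)"
          unfolding carr using descend_dual[OF F(1)] by blast
      qed
    qed (rule img)
  qed
qed

lemma kernel_elliptic: "kernel_is_elliptic_curve (Jac G) (Jac H) f"
  unfolding kernel_is_elliptic_curve_def
  using kernel_connected KT_dim inclusion_iso by blast

section \<open>The isogeny onto the Jacobian and its kernel\<close>

abbreviation "KH \<equiv> torus_sum KT (Jac H)"

definition split :: "((nat \<Rightarrow> int) set \<times> (nat \<Rightarrow> int), (nat \<Rightarrow> int) \<times> (nat \<Rightarrow> int), nat \<Rightarrow> int, nat \<Rightarrow> int) torus_map"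
  where "split = (\<lambda>x. (cl x, push x), \<lambda>(a, b) e. a e + pull b e)"

lemma Lam_KH [simp]: "Lam KH = (cycles G Mod N) \<times>\<times> cycles H"
  "Lam' KH = ((cycles G)\<lparr>carrier := Ker\<rparr>) \<times>\<times> cycles H"
  "pairing KH (C, y) (a, c) = pairing KT C a + ipH y c"
  by (simp_all add: torus_sum_def)

lemma split_closed: "a \<in> L \<Longrightarrow> b \<in> M \<Longrightarrow> (\<lambda>e. a e + pull b e) \<in> L"
  by (simp add: cycles_add pullback_closed)

lemma morphism_split: "torus_morphism KH (Jac G) split"
proof -
  have "(\<lambda>x. (cl x, push x)) \<in> hom (cycles G) ((cycles G Mod N) \<times>\<times> cycles H)"
    by (rule homI) (simp_all add: carrier_Lam_KT pushforward_closed cl_add pushforward_add)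
  moreover have "(\<lambda>(a, b) e. a e + pull b e) \<in> hom (((cycles G)\<lparr>carrier := Ker\<rparr>) \<times>\<times> cycles H) (cycles G)"
    by (rule homI) (auto simp: split_closed pullback_add)
  moreover have "pairing KH (cl x, push x) (a, b) = ip x (\<lambda>e. a e + pull b e)"
    if "x \<in> L" "a \<in> Ker" "b \<in> M" for x a b
  proof -
    have "ipH (push x) b = ip x (pull b)"
      using adj_push[of b x] Jac_pairing(7)[of G "pull b" x] Jac_pairing(7)[of H b "push x"] by simp
    then show ?thesis using pairing_KT[OF that(1,2)] by (simp add: Jac_pairing(2))
  qed
  ultimately show ?thesis
    unfolding torus_morphism_def using torus_sum torus_JG by (simp add: split_def)
qed

text \<open>A cycle in both \<open>N\<close> and \<open>Ker\<close> is orthogonal to itself, hence 0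
  by positivity; this settles \<open>f\<^sup>#\<close>. Applying \<open>push\<close> to
  \<open>a + pull b\<close> kills \<open>a\<close> and leaves \<open>d\<close> times
  \<open>b\<close>, which settles \<open>f\<^sub>#\<close>.\<close>

lemma isogeny_split: "torus_isogeny KH (Jac G) split"
proof -
  have "inj_on (\<lambda>x. (cl x, push x)) L"
  proof (rule inj_onI)
    fix x y assume xy: "x \<in> L" "y \<in> L" "(cl x, push x) = (cl y, push y)"
    define z where "z = (\<lambda>e. x e - y e)"
    have z: "z \<in> L" unfolding z_def by (rule cycles_diff[OF xy(1,2)])
    have zN: "z \<in> N" using xy cl_eq[OF xy(1,2)] z N_iff by (simp add: z_def dtm_linear)
    have zK: "z \<in> Ker" using z xy(3) by (simp add: z_def push_diff)
    have "z = (\<lambda>_. 0)" by (rule Jac_positive[OF G z N_perp[OF zN zK]])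
    then show "x = y" by (simp add: z_def fun_eq_iff)
  qed
  moreover have "inj_on (\<lambda>(a, b) e. a e + pull b e) (Ker \<times> M)"
  proof (rule inj_onI)
    fix s t assume "s \<in> Ker \<times> M" "t \<in> Ker \<times> M"
      and eq: "(case s of (a, b) \<Rightarrow> \<lambda>e. a e + pull b e) = (case t of (a, b) \<Rightarrow> \<lambda>e. a e + pull b e)"
    then obtain a b a' b' where s: "s = (a, b)" "a \<in> Ker" "b \<in> M" and t: "t = (a', b')" "a' \<in> Ker" "b' \<in> M"
      by blast
    have eq': "(\<lambda>e. a e + pull b e) = (\<lambda>e. a' e + pull b' e)" using eq s t by simp
    then have "push (\<lambda>e. a e + pull b e) = push (\<lambda>e. a' e + pull b' e)" by simp
    then have "(\<lambda>e. int d * b e) = (\<lambda>e. int d * b' e)"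
      using s t by (simp add: pushforward_add deg)
    then have b: "b = b'" using d by (simp add: fun_eq_iff)
    moreover have "a e = a' e" for e using fun_cong[OF eq', of e] b by simp
    then have "a = a'" by (rule ext)
    ultimately show "s = t" using s t by simp
  qed
  ultimately show ?thesis
    unfolding torus_isogeny_def using morphism_split by (simp add: split_def)
qed

text \<open>The projection to \<open>Jac H\<close> restricts to the isomorphism from the kernel of the isogeny to
  the \<open>d\<close>-torsion points.\<close>

definition proj :: "((nat \<Rightarrow> int) set \<times> (nat \<Rightarrow> int), (nat \<Rightarrow> int) \<times> (nat \<Rightarrow> int), nat \<Rightarrow> int, nat \<Rightarrow> int) torus_map"
  where "proj = (\<lambda>y. (N, y), snd)"

lemma N_carrier: "N \<in> cl ` L"
  using N_eq_cl cycles_zero by blast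

lemma N_mult_N: "N <#>\<^bsub>cycles G\<^esub> N = N"
  using cl_add[OF cycles_zero cycles_zero] N_eq_cl by simp

lemma cl_mult_N: "x \<in> L \<Longrightarrow> cl x <#>\<^bsub>cycles G\<^esub> N = cl x"
  using cl_add[OF _ cycles_zero, of x] N_eq_cl by simp

lemma pairing_N: "a \<in> Ker \<Longrightarrow> pairing KT N a = 0"
  using pairing_KT[OF cycles_zero, of a] N_eq_cl by (simp add: Jac_pairing_zero)

lemma morphism_proj: "torus_morphism KH (Jac H) proj"
proof -
  have "(\<lambda>y. (N, y)) \<in> hom (cycles H) ((cycles G Mod N) \<times>\<times> cycles H)"
    by (rule homI) (simp_all add: carrier_Lam_KT N_carrier N_mult_N)
  moreover have "snd \<in> hom (((cycles G)\<lparr>carrier := Ker\<rparr>) \<times>\<times> cycles H) (cycles H)"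
    by (rule homI) auto
  ultimately show ?thesis
    unfolding torus_morphism_def using torus_sum torus_JH by (auto simp: proj_def pairing_N)
qed

lemma dual_map_split: "dual_map (Jac G) split F = (\<lambda>x. if x \<in> L then F (cl x, push x) else 0)"
  by (auto simp: dual_map_def split_def fun_eq_iff)

lemma dual_map_proj: "dual_map (Jac H) proj F = (\<lambda>y. if y \<in> M then F (N, y) else 0)"
  by (auto simp: dual_map_def proj_def fun_eq_iff)

lemma carrier_KH: "carrier (Lam KH) = cl ` L \<times> M" "carrier (Lam' KH) = Ker \<times> M"
  by (simp_all add: carrier_Lam_KT)

lemma KH_dual:
  assumes F: "F \<in> carrier (real_dual (Lam KH))"
  shows "x \<in> L \<Longrightarrow> y \<in> M \<Longrightarrow> y' \<in> M \<Longrightarrow> F (cl x, \<lambda>e. y e + y' e) = F (cl x, y) + F (N, y')"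
    "\<not> (C \<in> cl ` L \<and> y \<in> M) \<Longrightarrow> F (C, y) = 0"
proof -
  have add: "F (s \<otimes>\<^bsub>Lam KH\<^esub> t) = F s + F t" if "s \<in> cl ` L \<times> M" "t \<in> cl ` L \<times> M" for s t
    using F that unfolding carrier_real_dual carrier_KH by blast
  show "F (cl x, \<lambda>e. y e + y' e) = F (cl x, y) + F (N, y')" if "x \<in> L" "y \<in> M" "y' \<in> M"
    using add[of "(cl x, y)" "(N, y')"] that N_carrier by (simp add: cl_mult_N)
  show "F (C, y) = 0" if "\<not> (C \<in> cl ` L \<and> y \<in> M)"
    using F that unfolding carrier_real_dual by (auto simp: carrier_Lam_KT)
qed

lemma periods_KH:
  "F \<in> periods KH \<longleftrightarrow> (\<exists>a\<in>Ker. \<exists>c\<in>M. \<forall>C y. F (C, y) = (if C \<in> cl ` L \<and> y \<in> M then pairing KT C a + ipH y c else 0))"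
proof
  assume "F \<in> periods KH"
  then obtain a c where ac: "a \<in> Ker" "c \<in> M" "F = period KH (a, c)"
    unfolding periods_def carrier_KH by blast
  have "F (C, y) = (if C \<in> cl ` L \<and> y \<in> M then pairing KT C a + ipH y c else 0)" for C y
    unfolding ac(3) period_def carrier_KH by simp
  then show "\<exists>a\<in>Ker. \<exists>c\<in>M. \<forall>C y. F (C, y) = (if C \<in> cl ` L \<and> y \<in> M then pairing KT C a + ipH y c else 0)"
    using ac(1,2) by blast
next
  assume "\<exists>a\<in>Ker. \<exists>c\<in>M. \<forall>C y. F (C, y) = (if C \<in> cl ` L \<and> y \<in> M then pairing KT C a + ipH y c else 0)"
  then obtain a c where ac: "a \<in> Ker" "c \<in> M"
    and F: "\<And>C y. F (C, y) = (if C \<in> cl ` L \<and> y \<in> M then pairing KT C a + ipH y c else 0)"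
    by blast
  have "F z = period KH (a, c) z" for z
    using F[of "fst z" "snd z"] unfolding period_def carrier_KH by (cases z) simp
  then have "F = period KH (a, c)" by (rule ext)
  then show "F \<in> periods KH" unfolding periods_def carrier_KH using ac by blast
qed

text \<open>Evaluating at \<open>x = pull y\<close> makes the first component neutral, since
  \<open>pull y\<close> lies in \<open>N\<close>, and turns the second into \<open>d\<close> times
  \<open>y\<close>; adjointness identifies the result with the period of
  \<open>push b\<close>.\<close>

lemma split_kernel_torsion:
  assumes F: "F \<in> carrier (real_dual (Lam KH))" and k: "dual_map (Jac G) split F \<in> periods (Jac G)"
  shows "(\<lambda>y. real d * dual_map (Jac H) proj F y) \<in> periods (Jac H)"
proof -
  obtain b where b: "b \<in> L" "dual_map (Jac G) split F = (\<lambda>x. if x \<in> L then ip x b else 0)"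
    using k periods_G by blast
  have D: "dual_map (Jac H) proj F \<in> carrier (real_dual (cycles H))"
    using dual_map_closed[OF morphism_proj F] by simp
  have "real d * dual_map (Jac H) proj F y = (if y \<in> M then ipH y (push b) else 0)" for y
  proof (cases "y \<in> M")
    case True
    have "real d * dual_map (Jac H) proj F y = dual_map (Jac H) proj F (\<lambda>e. int d * y e)"
      using cycles_dual(4)[OF D True, of d] by simp
    also have "\<dots> = F (N, push (pull y))" using True by (simp add: dual_map_proj deg cycles_scale)
    also have "\<dots> = F (cl (pull y), push (pull y))" using cl_N[OF pull_N[OF True]] by simp
    also have "\<dots> = ip (pull y) b"
      using fun_cong[OF b(2), of "pull y"] True by (simp add: dual_map_split pullback_closed)
    also have "\<dots> = ipH y (push b)" by (rule adj_push)
    finally show ?thesis using True by simp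
  next
    case False
    then show ?thesis by (simp add: dual_map_proj)
  qed
  then show ?thesis unfolding periods_H using pushforward_closed[OF b(1)] by blast
qed

text \<open>Every element \<open>(cl x, y)\<close> is the sum of \<open>(cl x, push x)\<close> and
  \<open>(N, y - push x)\<close>; on the first kind \<open>F\<close> is known from \<open>b\<close>,
  on the second from \<open>c\<close>.\<close>

lemma split_kernel_injective:
  assumes F: "F \<in> carrier (real_dual (Lam KH))" and k: "dual_map (Jac G) split F \<in> periods (Jac G)"
    and z: "dual_map (Jac H) proj F \<in> periods (Jac H)"
  shows "F \<in> periods KH"
proof -
  obtain b where b: "b \<in> L" "dual_map (Jac G) split F = (\<lambda>x. if x \<in> L then ip x b else 0)"
    using k periods_G by blast
  obtain c where c: "c \<in> M" "dual_map (Jac H) proj F = (\<lambda>y. if y \<in> M then ipH y c else 0)"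
    using z periods_H by blast
  have Fs: "F (cl x, push x) = ip x b" if "x \<in> L" for x
    using fun_cong[OF b(2), of x] that by (simp add: dual_map_split)
  have Fp: "F (N, y) = ipH y c" if "y \<in> M" for y
    using fun_cong[OF c(2), of y] that by (simp add: dual_map_proj)
  \<comment> \<open>Forced by the isogeny, which must send \<open>(a, c)\<close> to
    \<open>a + pull c = b\<close>.\<close>
  define a where "a = (\<lambda>e. b e - pull c e)"
  have aL: "a \<in> L" unfolding a_def by (rule cycles_diff[OF b(1) pullback_closed[OF c(1)]])
  have sw: "ip x (pull c) = ipH (push x) c" for x
    using adj_push[of c x] Jac_pairing(7)[of G x "pull c"] Jac_pairing(7)[of H c "push x"] by simp
  have "ipH y (push a) = 0" if y: "y \<in> M" for y
  proof -
    have "ipH y (push a) = ip (pull y) b - ip (pull y) (pull c)"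
      by (simp add: adj_push[symmetric] a_def Jac_pairing(4))
    also have "ip (pull y) b = F (N, push (pull y))"
      using Fs[OF pullback_closed[OF y]] cl_N[OF pull_N[OF y]] by simp
    also have "\<dots> = ipH (push (pull y)) c"
      by (rule Fp[OF pushforward_closed[OF pullback_closed[OF y]]])
    finally show ?thesis by (simp add: sw)
  qed
  then have aK: "a \<in> Ker" using ipH_nondeg[OF pushforward_closed[OF aL]] aL by simp
  show ?thesis
    unfolding periods_KH
  proof (intro bexI[OF _ aK] bexI[OF _ c(1)] allI)
    fix C y show "F (C, y) = (if C \<in> cl ` L \<and> y \<in> M then pairing KT C a + ipH y c else 0)"
    proof (cases "C \<in> cl ` L \<and> y \<in> M")
      case True
      then obtain x where x: "x \<in> L" "C = cl x" and y: "y \<in> M" by blast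
      have px: "push x \<in> M" by (rule pushforward_closed[OF x(1)])
      have yp: "(\<lambda>e. y e - push x e) \<in> M" by (rule cycles_diff[OF y px])
      have "F (C, y) = F (cl x, push x) + F (N, \<lambda>e. y e - push x e)"
        using KH_dual(1)[OF F x(1) px yp] x(2) by simp
      also have "\<dots> = ip x b + ipH (\<lambda>e. y e - push x e) c" by (simp add: Fs[OF x(1)] Fp[OF yp])
      also have "\<dots> = ip x a + ipH y c" by (simp add: a_def Jac_pairing(3,4) sw)
      finally show ?thesis using x y pairing_KT[OF x(1) aK] by simp
    next
      case False
      then show ?thesis using KH_dual(2)[OF F, of C y] by auto
    qed
  qed
qed

text \<open>The period \<open>c\<close> of \<open>d\<close> times \<open>E\<close> is a push-forward
  \<open>push b\<close>, by surjectivity on cycles. It remains to find a functional on the factor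
  \<open>KT\<close> that together with \<open>E\<close> restricts to the period of
  \<open>b\<close>.\<close>

lemma split_kernel_surjective:
  assumes E: "E \<in> carrier (real_dual (cycles H))" and t: "(\<lambda>y. real d * E y) \<in> periods (Jac H)"
  shows "\<exists>F\<in>carrier (real_dual (Lam KH)).
    dual_map (Jac G) split F \<in> periods (Jac G) \<and> dual_map (Jac H) proj F = E"
proof -
  obtain c where c: "c \<in> M" "(\<lambda>y. real d * E y) = (\<lambda>y. if y \<in> M then ipH y c else 0)"
    using t periods_H by blast
  obtain b where b: "b \<in> L" "push b = c" using push_surj[OF c(1)] by blast
  \<comment> \<open>The part of the period of \<open>b\<close> that \<open>E\<close> does not
    account for. It vanishes on pulled-back forms because \<open>E (push (pull y))\<close> is
    \<open>d\<close> times \<open>E y\<close>, so it descends to the quotient by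
    \<open>N\<close>.\<close>
  define W where "W = (\<lambda>x. if x \<in> L then ip x b - E (push x) else 0)"
  have "W \<in> carrier (real_dual (cycles G))"
    unfolding carrier_real_dual
    by (auto simp: W_def cycles_add Jac_pairing(1) pushforward_add cycles_dual(1)[OF E] pushforward_closed)
  moreover have "W (pull y) = 0" if y: "y \<in> M" for y
  proof -
    have "E (push (pull y)) = real d * E y" using cycles_dual(4)[OF E y, of d] deg[OF y] by simp
    also have "\<dots> = ipH y c" using fun_cong[OF c(2), of y] y by simp
    finally show ?thesis using y b by (simp add: W_def pullback_closed adj_push)
  qed
  ultimately have W: "W \<in> V" by (simp add: V_def)
  define F where "F = (\<lambda>(C, y). if C \<in> cl ` L \<and> y \<in> M then descend W C + E y else 0)"
  have "F \<in> carrier (real_dual (Lam KH))"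
    unfolding carrier_real_dual
  proof (intro conjI ballI allI impI)
    fix s t assume "s \<in> carrier (Lam KH)" "t \<in> carrier (Lam KH)"
    then obtain x y x' y' where s: "s = (cl x, y)" "x \<in> L" "y \<in> M" and t: "t = (cl x', y')" "x' \<in> L" "y' \<in> M"
      by (auto simp: carrier_Lam_KT)
    have "s \<otimes>\<^bsub>Lam KH\<^esub> t = (cl (\<lambda>e. x e + x' e), \<lambda>e. y e + y' e)"
      using s t by (simp add: cl_add)
    moreover have "W (\<lambda>e. x e + x' e) = W x + W x'"
      using W s t by (auto simp: V_def cycles_dual(1))
    ultimately show "F (s \<otimes>\<^bsub>Lam KH\<^esub> t) = F s + F t"
      using s t by (simp add: F_def descend_cl[OF W] cycles_add cycles_dual(1)[OF E])
  next
    fix s assume "s \<notin> carrier (Lam KH)"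
    then show "F s = 0" by (cases s) (auto simp: F_def carrier_Lam_KT)
  qed
  moreover have "F (cl x, push x) = ip x b" if "x \<in> L" for x
  proof -
    have "F (cl x, push x) = W x + E (push x)"
      using that by (simp add: F_def descend_cl[OF W] pushforward_closed)
    then show ?thesis using that by (simp add: W_def)
  qed
  then have "dual_map (Jac G) split F = (\<lambda>x. if x \<in> L then ip x b else 0)"
    by (auto simp: dual_map_split fun_eq_iff)
  then have "dual_map (Jac G) split F \<in> periods (Jac G)" unfolding periods_G using b(1) by blast
  moreover have "dual_map (Jac H) proj F = E"
  proof
    fix y
    have "descend W N = 0"
      using descend_cl[OF W cycles_zero] N_eq_cl W cycles_dual(2)[of W G] by (simp add: V_def)
    then show "dual_map (Jac H) proj F y = E y"
      using cycles_dual(3)[OF E] N_carrier by (simp add: dual_map_proj F_def)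
  qed
  ultimately show ?thesis by blast
qed

text \<open>The three preceding lemmas say that \<open>\<theta>\<close> lands in the torsion points,
  is injective and is onto. Injectivity is tested on the difference \<open>D\<close> of two
  representatives, which again satisfies the kernel condition.\<close>

lemma split_kernel: "torus_kernel KH (Jac G) split \<cong> torsion d (Jac H)"
proof -
  define \<theta> where "\<theta> = torus_hom KH (Jac H) proj"
  define R where "R = {F \<in> carrier (real_dual (Lam KH)). dual_map (Jac G) split F \<in> periods (Jac G)}"
  have ck: "carrier (torus_kernel KH (Jac G) split) = torus_class KH ` R"
    unfolding R_def by (rule carrier_torus_kernel[OF morphism_split])
  have ct: "carrier (torsion d (Jac H)) = torus_class (Jac H) `
      {E \<in> carrier (real_dual (cycles H)). (\<lambda>y. real d * E y) \<in> periods (Jac H)}"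
    using carrier_torsion[OF torus_JH, of d] by simp
  have RD: "F \<in> carrier (real_dual (Lam KH))" if "F \<in> R" for F using that by (simp add: R_def)
  have val: "\<theta> (torus_class KH F) = torus_class (Jac H) (dual_map (Jac H) proj F)" if "F \<in> R" for F
    unfolding \<theta>_def by (rule torus_hom_class[OF morphism_proj RD[OF that]])
  have PD: "dual_map (Jac H) proj F \<in> carrier (real_dual (cycles H))" if "F \<in> R" for F
    using dual_map_closed[OF morphism_proj RD[OF that]] by simp
  have img: "\<theta> ` (torus_class KH ` R) = carrier (torsion d (Jac H))"
  proof
    show "\<theta> ` (torus_class KH ` R) \<subseteq> carrier (torsion d (Jac H))"
    proof
      fix X assume "X \<in> \<theta> ` (torus_class KH ` R)"
      then obtain F where F: "F \<in> R" "X = torus_class (Jac H) (dual_map (Jac H) proj F)"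
        using val by blast
      have "(\<lambda>y. real d * dual_map (Jac H) proj F y) \<in> periods (Jac H)"
        by (rule split_kernel_torsion) (use F(1) in \<open>auto simp: R_def\<close>)
      then show "X \<in> carrier (torsion d (Jac H))" unfolding ct F(2) using PD[OF F(1)] by blast
    qed
    show "carrier (torsion d (Jac H)) \<subseteq> \<theta> ` (torus_class KH ` R)"
    proof
      fix X assume "X \<in> carrier (torsion d (Jac H))"
      then obtain E where E: "E \<in> carrier (real_dual (cycles H))" "(\<lambda>y. real d * E y) \<in> periods (Jac H)"
        "X = torus_class (Jac H) E" unfolding ct by blast
      obtain F where F: "F \<in> R" "dual_map (Jac H) proj F = E"
        using split_kernel_surjective[OF E(1,2)] unfolding R_def by blast
      have "X = \<theta> (torus_class KH F)" using val[OF F(1)] F(2) E(3) by simp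
      then show "X \<in> \<theta> ` (torus_class KH ` R)" using F(1) by blast
    qed
  qed
  have inj: "inj_on \<theta> (torus_class KH ` R)"
  proof (rule inj_onI)
    fix X Y assume "X \<in> torus_class KH ` R" "Y \<in> torus_class KH ` R" and eq: "\<theta> X = \<theta> Y"
    then obtain F F' where F: "F \<in> R" "X = torus_class KH F" "F' \<in> R" "Y = torus_class KH F'" by blast
    define D where "D = (\<lambda>x. F x - F' x)"
    have D: "D \<in> carrier (real_dual (Lam KH))"
      unfolding D_def by (rule real_dual_diff[OF RD[OF F(1)] RD[OF F(3)]])
    have "dual_map (Jac G) split D = (\<lambda>x. dual_map (Jac G) split F x - dual_map (Jac G) split F' x)"
      unfolding D_def by (rule dual_map_diff)
    moreover obtain b b' where "b \<in> L" "b' \<in> L"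
      "dual_map (Jac G) split F = (\<lambda>x. if x \<in> L then ip x b else 0)"
      "dual_map (Jac G) split F' = (\<lambda>x. if x \<in> L then ip x b' else 0)"
      using F(1,3) unfolding R_def periods_G by blast
    ultimately have "dual_map (Jac G) split D = (\<lambda>x. if x \<in> L then ip x (\<lambda>e. b e - b' e) else 0)"
      "(\<lambda>e. b e - b' e) \<in> L"
      by (auto simp: Jac_pairing(4) cycles_diff)
    then have 1: "dual_map (Jac G) split D \<in> periods (Jac G)" unfolding periods_G by blast
    have "(\<lambda>y. dual_map (Jac H) proj F y - dual_map (Jac H) proj F' y) \<in> periods (Jac H)"
      using eq val F torus_class_eq_iff[OF torus_JH] PD by simp
    then have 2: "dual_map (Jac H) proj D \<in> periods (Jac H)"
      unfolding D_def dual_map_diff .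
    have "D \<in> periods KH" by (rule split_kernel_injective[OF D 1 2])
    then show "X = Y"
      using torus_class_eq_iff[OF torus_sum RD[OF F(1)] RD[OF F(3)]] F(2,4) by (simp add: D_def)
  qed
  have "\<theta> \<in> hom (torus_group KH) (torus_group (Jac H))"
    unfolding \<theta>_def by (rule torus_hom_hom[OF morphism_proj])
  moreover have "torus_class KH ` R \<subseteq> carrier (torus_group KH)"
    unfolding carrier_torus_group using RD by blast
  ultimately have "\<theta> \<in> hom ((torus_group KH)\<lparr>carrier := torus_class KH ` R\<rparr>)
      ((torus_group (Jac H))\<lparr>carrier := carrier (torsion d (Jac H))\<rparr>)"
    by (rule hom_from_restricted) (simp only: img)
  moreover have "(torus_group KH)\<lparr>carrier := torus_class KH ` R\<rparr> = torus_kernel KH (Jac G) split"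
    unfolding ck[symmetric] by (simp add: torus_kernel_def)
  moreover have "(torus_group (Jac H))\<lparr>carrier := carrier (torsion d (Jac H))\<rparr> = torsion d (Jac H)"
    by (simp add: torsion_def)
  ultimately have "\<theta> \<in> hom (torus_kernel KH (Jac G) split) (torsion d (Jac H))" by simp
  moreover have "bij_betw \<theta> (carrier (torus_kernel KH (Jac G) split)) (carrier (torsion d (Jac H)))"
    unfolding bij_betw_def ck using inj img by blast
  ultimately have "\<theta> \<in> iso (torus_kernel KH (Jac G) split) (torsion d (Jac H))" by (rule isoI)
  then show ?thesis unfolding is_iso_def by blast
qed

end

theorem theorem2:
  fixes \<Gamma> G :: "'p mgraph" and TE H :: "'q mgraph" and \<phi> :: "'p \<Rightarrow> 'q" and d :: nat
  assumes "tropical_curve \<Gamma>" and "genus \<Gamma> = 2"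
    and "tropical_curve TE" and "genus TE = 1"
    and "optimal_cover \<Gamma> TE \<phi>" and "has_degree \<Gamma> TE \<phi> d"
    \<comment> \<open>any models in which the Jacobians and the push-forward are computed\<close>
    and "model_of G \<Gamma>" and "model_of H TE" and "harmonic_on G H \<phi>"
  shows "kernel_is_elliptic_curve (Jac G) (Jac H) (push_forward G H \<phi>) \<and>
    (\<exists>f. torus_isogeny
           (torus_sum (Ker0 (Jac G) (Jac H) (push_forward G H \<phi>)) (Jac H)) (Jac G) f \<and>
         torus_kernel
           (torus_sum (Ker0 (Jac G) (Jac H) (push_forward G H \<phi>)) (Jac H)) (Jac G) f
         \<cong> torsion d (Jac H))"
proof -
  have tG: "tropical_curve G" and tH: "tropical_curve H" using assms(7,8) by (auto simp: model_of_def)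
  have gG: "genus G = 2" using model_of_genus[OF assms(7,1)] assms(2) by simp
  have gH: "genus H = 1" using model_of_genus[OF assms(8,3)] assms(4) by simp
  obtain TG where TG: "spanning_tree G TG" using spanning_tree_exists[OF tG] by blast
  obtain TH where TH: "spanning_tree H TH" using spanning_tree_exists[OF tH] by blast
  have "card (edges G - TG) = 2" using spanning_tree_card[OF tG TG] gG by simp
  then obtain p q where pq: "edges G - TG = {p, q}" "p \<noteq> q" by (auto simp: card_2_iff)
  have "card (edges H - TH) = 1" using spanning_tree_card[OF tH TH] gH by simp
  then obtain e0 where e0: "edges H - TH = {e0}" by (auto simp: card_1_singleton_iff)
  have deg: "fibre_degree G H \<phi> d"
    by (rule has_degree_fibre_degree[OF assms(6-9)])
  interpret c: cover_model G H \<phi> by unfold_locales (rule tG tH assms(9))+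
  have d: "d > 0" using c.degree_pos[OF deg] e0 by blast
  obtain y where y: "y \<in> carrier (cycles H)" "\<forall>e\<in>edges H - TH. y e = 1"
    using cycle_extend[OF tH TH, of "\<lambda>e. 1"] by (elim bexE)
  \<comment> \<open>This coefficient is \<open>d\<close>; it supplies the non-zero value from which
    the subgroup argument in \<open>optimal_surjective\<close> starts.\<close>
  have "pushforward_cycle G H \<phi> (pullback_form G H \<phi> y) e0 \<noteq> 0"
    using c.pushforward_pullback[OF deg y(1)] y(2) e0 d by simp
  from optimal_surjective[OF assms(5) gH assms(7-9) TH e0 c.pullback_closed[OF y(1)] this]
  have surj: "\<exists>a\<in>carrier (cycles G). pushforward_cycle G H \<phi> a e0 = 1" .
  interpret split_cover G H \<phi> d TG TH p q e0
    by unfold_locales (use TG pq TH e0 c.pushforward_pullback[OF deg] d surj in auto)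
  show ?thesis using kernel_elliptic isogeny_split split_kernel by blast
qed

end
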